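(* Let $R$ be a regular (Noetherian commutative) ring of prime characteristic $p>0$, and let $I$ and $\mathfrak{a}$ be non-zero proper ideals of $R$ such that $\mathfrak{a}\subseteq\sqrt{I}$. Then $$\mathcal{C}^{\mathfrak{p}}(\mathfrak{a}^{(\bullet)})\le\mathcal{C}^{\sqrt I}(\mathfrak{a}^{(\bullet)})\le\mathcal{C}^{\sqrt{\mathfrak{a}}}(\sqrt{\mathfrak{a}}^{(\bullet)})\le\text{big-height}(\sqrt{\mathfrak{a}})$$ for any prime ideal $\mathfrak{p}$ containing $I$. In particular, $\mathcal{C}^{\sqrt I}(\mathfrak{a}^{\bullet})\le\text{big-height}(\sqrt{\mathfrak{a}})$.
   Context: For an ideal $\mathfrak{a}$: $\mathfrak{a}^\bullet=\{\mathfrak{a}^i\}_{i\ge 0}$; $\mathfrak{a}^{(\bullet)}=\{\mathfrak{a}^{(i)}\}_{i\ge 0}$ with $\mathfrak{a}^{(i)}=\bigcap_{\mathfrak{q}\in\operatorname{Ass}(\mathfrak{a})}(\mathfrak{a}^iR_{\mathfrak{q}}\cap R)$, where $\operatorname{Ass}(\mathfrak{a})$ is the set of associated primes of $\mathfrak{a}$ (of $R/\mathfrak a$); $\text{big-height}(\mathfrak{a})=\max\{\operatorname{ht}(\mathfrak{q}):\mathfrak{q}\in\operatorname{Ass}(\mathfrak{a})\}$; $\sqrt{\mathfrak{a}}^{(\bullet)}$ is the symbolic power filtration of $\sqrt{\mathfrak{a}}$. $J^{[p^e]}$ is the ideal generated by all $f^{p^e}$, $f\in J$. For a filtration of ideals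 $\mathfrak{a}_\bullet$ (i.e. $\mathfrak{a}_0=R$, $\mathfrak{a}_{i+1}\subseteq\mathfrak{a}_i$, $\mathfrak{a}_i\mathfrak{a}_j\subseteq\mathfrak{a}_{i+j}$) and an ideal $J$, put $\nu_{\mathfrak{a}_\bullet}^J(p^e)=\sup\{r\in\mathbb{Z}_{\ge 0}:\mathfrak{a}_r\not\subseteq J^{[p^e]}\}$ and $\mathcal{C}^J(\mathfrak{a}_\bullet)=\lim_{e\to\infty}\nu_{\mathfrak{a}_\bullet}^J(p^e)/p^e$ when this limit exists as a finite real number (it does for all the filtrations and ideals in the statement). *)

theory Defs
  imports
    "HOL-Algebra.Algebra"
    "HOL-Computational_Algebra.Primes"
    "HOL-Library.Extended_Real"
    "HOL-Library.Extended_Nat"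
begin

definition frac_rel :: "('a, 'm) ring_scheme \<Rightarrow> 'a set \<Rightarrow> (('a \<times> 'a) \<times> ('a \<times> 'a)) set"
  where "frac_rel R S = {((a, s), (b, t)). a \<in> carrier R \<and> s \<in> S \<and> b \<in> carrier R \<and> t \<in> S \<and>
           (\<exists>u\<in>S. u \<otimes>\<^bsub>R\<^esub> (a \<otimes>\<^bsub>R\<^esub> t) = u \<otimes>\<^bsub>R\<^esub> (b \<otimes>\<^bsub>R\<^esub> s))}"

definition fraction :: "('a, 'm) ring_scheme \<Rightarrow> 'a set \<Rightarrow> 'a \<Rightarrow> 'a \<Rightarrow> ('a \<times> 'a) set"
  where "fraction R S a s = frac_rel R S `` {(a, s)}"

text \<open>The ring of fractions with denominators in a multiplicative set \<open>S\<close>. A fraction is an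
  equivalence class of pairs; the operations act on all representatives at once and take the class
  of the result.\<close>

definition localization :: "('a, 'm) ring_scheme \<Rightarrow> 'a set \<Rightarrow> ('a \<times> 'a) set ring"
  where "localization R S =
    \<lparr> carrier = (carrier R \<times> S) // frac_rel R S,
      monoid.mult = (\<lambda>A B. frac_rel R S ``
        {(a \<otimes>\<^bsub>R\<^esub> b, s \<otimes>\<^bsub>R\<^esub> t) | a b s t. (a, s) \<in> A \<and> (b, t) \<in> B}),
      monoid.one = fraction R S \<one>\<^bsub>R\<^esub> \<one>\<^bsub>R\<^esub>,
      ring.zero = fraction R S \<zero>\<^bsub>R\<^esub> \<one>\<^bsub>R\<^esub>,
      ring.add = (\<lambda>A B. frac_rel R S ``
        {((a \<otimes>\<^bsub>R\<^esub> t) \<oplus>\<^bsub>R\<^esub> (b \<otimes>\<^bsub>R\<^esub> s), s \<otimes>\<^bsub>R\<^esub> t) | a b s t. (a, s) \<in> A \<and> (b, t) \<in> B}) \<rparr>"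

definition local_at :: "('a, 'm) ring_scheme \<Rightarrow> 'a set \<Rightarrow> ('a \<times> 'a) set ring"
  where "local_at R P = localization R (carrier R - P)"

text \<open>\<open>loc_contract R P J\<close> is $J R_P \cap R$, that is, the preimage under $R \to R_P$ of the
  extension of \<open>J\<close>.\<close>

definition loc_contract :: "('a, 'm) ring_scheme \<Rightarrow> 'a set \<Rightarrow> 'a set \<Rightarrow> 'a set"
  where "loc_contract R P J = {x \<in> carrier R.
    fraction R (carrier R - P) x \<one>\<^bsub>R\<^esub> \<in>
      Idl\<^bsub>local_at R P\<^esub> ((\<lambda>y. fraction R (carrier R - P) y \<one>\<^bsub>R\<^esub>) ` J)}"

definition prime_chain :: "('a, 'm) ring_scheme \<Rightarrow> nat \<Rightarrow> (nat \<Rightarrow> 'a set) \<Rightarrow> bool"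
  where "prime_chain R n Q \<longleftrightarrow>
    (\<forall>i\<le>n. primeideal (Q i) R) \<and> (\<forall>i<n. Q i \<subset> Q (Suc i))"

definition height :: "('a, 'm) ring_scheme \<Rightarrow> 'a set \<Rightarrow> enat"
  where "height R P = Sup {enat n | n. \<exists>Q. prime_chain R n Q \<and> Q n = P}"

definition krull_dim :: "('a, 'm) ring_scheme \<Rightarrow> enat"
  where "krull_dim R = Sup {enat n | n. \<exists>Q. prime_chain R n Q}"

definition min_generators :: "('a, 'm) ring_scheme \<Rightarrow> 'a set \<Rightarrow> nat"
  where "min_generators R J =
    (LEAST n. \<exists>A \<subseteq> carrier R. finite A \<and> card A = n \<and> Idl\<^bsub>R\<^esub> A = J)"

definition regular_local_ring :: "('a, 'm) ring_scheme \<Rightarrow> bool"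
  where "regular_local_ring R \<longleftrightarrow> cring R \<and> noetherian_ring R \<and> (\<exists>!M. maximalideal M R) \<and>
    (\<forall>M. maximalideal M R \<longrightarrow> enat (min_generators R M) = krull_dim R)"

definition regular_ring :: "('a, 'm) ring_scheme \<Rightarrow> bool"
  where "regular_ring R \<longleftrightarrow> cring R \<and> noetherian_ring R \<and>
    (\<forall>P. primeideal P R \<longrightarrow> regular_local_ring (local_at R P))"

text \<open>The additive order of \<open>\<one>\<close>; by the convention of \<open>group.ord\<close> it is 0 if that order is
  infinite.\<close>

definition ring_char :: "('a, 'm) ring_scheme \<Rightarrow> nat"
  where "ring_char R = group.ord (add_monoid R) \<one>\<^bsub>R\<^esub>"

definition radical :: "('a, 'm) ring_scheme \<Rightarrow> 'a set \<Rightarrow> 'a set"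
  where "radical R J = {x \<in> carrier R. \<exists>n::nat. n > 0 \<and> x [^]\<^bsub>R\<^esub> n \<in> J}"

text \<open>Associated primes of the module $R/J$: the primes that are the annihilator of some residue
  class $x + J$.\<close>

definition Ass :: "('a, 'm) ring_scheme \<Rightarrow> 'a set \<Rightarrow> 'a set set"
  where "Ass R J = {P. primeideal P R \<and>
    (\<exists>x\<in>carrier R. P = {r \<in> carrier R. r \<otimes>\<^bsub>R\<^esub> x \<in> J})}"

text \<open>In a Noetherian ring \<open>Ass R J\<close> is finite, and non-empty for proper \<open>J\<close>, so \<open>Max\<close> is the
  actual maximum.\<close>

definition big_height :: "('a, 'm) ring_scheme \<Rightarrow> 'a set \<Rightarrow> enat"
  where "big_height R J = Max (height R ` Ass R J)"

definition ideal_power :: "('a, 'm) ring_scheme \<Rightarrow> 'a set \<Rightarrow> nat \<Rightarrow> 'a set"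
  where "ideal_power R J i = J [^]\<^bsub>ideals_set R\<^esub> i"

definition symbolic_power :: "('a, 'm) ring_scheme \<Rightarrow> 'a set \<Rightarrow> nat \<Rightarrow> 'a set"
  where "symbolic_power R J i =
    carrier R \<inter> (\<Inter>P\<in>Ass R J. loc_contract R P (ideal_power R J i))"

definition frobenius_power :: "('a, 'm) ring_scheme \<Rightarrow> 'a set \<Rightarrow> nat \<Rightarrow> 'a set"
  where "frobenius_power R J q = Idl\<^bsub>R\<^esub> ((\<lambda>f. f [^]\<^bsub>R\<^esub> q) ` J)"

text \<open>Here \<open>F\<close> is a filtration of ideals and \<open>p\<close> the characteristic. The supremum is taken in
  \<^typ>\<open>enat\<close>, so an unbounded set gives \<open>\<infinity>\<close> and not a junk value.\<close>

definition nu :: "('a, 'm) ring_scheme \<Rightarrow> nat \<Rightarrow> 'a set \<Rightarrow> (nat \<Rightarrow> 'a set) \<Rightarrow> nat \<Rightarrow> enat"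
  where "nu R p J F e = Sup {enat r | r. \<not> F r \<subseteq> frobenius_power R J (p ^ e)}"

definition has_C :: "('a, 'm) ring_scheme \<Rightarrow> nat \<Rightarrow> 'a set \<Rightarrow> (nat \<Rightarrow> 'a set) \<Rightarrow> real \<Rightarrow> bool"
  where "has_C R p J F c \<longleftrightarrow>
    (\<lambda>e. ereal_of_enat (nu R p J F e) / ereal (real (p ^ e))) \<longlonglongrightarrow> ereal c"

definition C_exists :: "('a, 'm) ring_scheme \<Rightarrow> nat \<Rightarrow> 'a set \<Rightarrow> (nat \<Rightarrow> 'a set) \<Rightarrow> bool"
  where "C_exists R p J F \<longleftrightarrow> (\<exists>c. has_C R p J F c)"

definition C_inv :: "('a, 'm) ring_scheme \<Rightarrow> nat \<Rightarrow> 'a set \<Rightarrow> (nat \<Rightarrow> 'a set) \<Rightarrow> real"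
  where "C_inv R p J F = (THE c. has_C R p J F c)"

end

(*
  After localizing at an associated prime P of J = sqrt(a), the maximal ideal has d = dim R_P <= ht P
  generators, so J^n R_P lies in J^[q] R_P for n > d q by the pigeonhole principle. To pass from these
  local inclusions to J^(n) <= J^[q] for n > h q, one chooses s outside all associated primes of J
  with s f in J^[q]; since s is regular modulo J, flatness of the Frobenius makes s^q regular modulo
  J^[q], and f lies in J^[q]. This bounds nu(q)/q by h, and nu(p^e)/p^e is nondecreasing because f^p in
  K^[p] implies f in K, so the limits exist; the remaining inequalities come from inclusions of
  filtrations and of Frobenius powers.

  Flatness is used in the form (K^[p] : s^p) = (K : s)^[p]. In a regular local ring of dimension d with
  maximal ideal m, any m-primary K satisfies length(R/K^[p]) <= p^d length(R/K), with equality for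
  K = m^[q], whose colength q^d is known because the parameters form a regular sequence. Hence equality
  holds for every m-primary K, which gives the colon formula for these, and a weak form of the
  Artin--Rees lemma together with Krull's intersection theorem extends it to all ideals. That d
  generators of m form a regular sequence follows from the principal ideal theorem, which moves a given
  element of m down a chain of primes of length d.
*)

theory Submission
  imports Defs
begin

section \<open>Ideals of a commutative ring\<close>

text \<open>Every module that occurs is a subquotient of the ring, so the whole argument is carried
  by ideals: a statement about R/K is one about the ideals above K, the length of L/K is that of the
  interval of ideals from K to L, and the annihilator of s modulo K is (K : s). Exact sequences
  become the comparison of (K + (s))/K with R/(K : s), and membership f in K becomes the assertion
  that (K : f) is the unit ideal, which can be tested at primes. Counting lengths works only where
  they are finite, that is, for \<mm>-primary ideals; this obstacle forces the approximation of K by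
  ideals K + L with L between two powers of \<mm>. L is generated by high powers of generators of
  \<mm>, chosen one after another, so that Artin-Rees is required only for one element at a time,
  where the ascending chain condition gives it at once. The same one-element statement yields the
  principal ideal theorem by comparing lengths modulo powers of x.\<close>

no_notation Sum_Type.Plus (infixr \<open><+>\<close> 65)

context cring begin

lemma ideal_addD: "ideal I R \<Longrightarrow> a \<in> I \<Longrightarrow> b \<in> I \<Longrightarrow> a \<oplus> b \<in> I"
  by (simp add: additive_subgroup.a_closed ideal.axioms(1))

lemma ideal_zeroD: "ideal I R \<Longrightarrow> \<zero> \<in> I"
  by (simp add: additive_subgroup.zero_closed ideal.axioms(1))

lemma ideal_uminusD: "ideal I R \<Longrightarrow> a \<in> I \<Longrightarrow> \<ominus> a \<in> I"
  by (simp add: additive_subgroup.a_inv_closed ideal.axioms(1))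

lemma ideal_minusD: "ideal I R \<Longrightarrow> a \<in> I \<Longrightarrow> b \<in> I \<Longrightarrow> a \<ominus> b \<in> I"
  by (simp add: a_minus_def ideal_addD ideal_uminusD)

lemma ideal_lmultD: "ideal I R \<Longrightarrow> a \<in> I \<Longrightarrow> r \<in> carrier R \<Longrightarrow> r \<otimes> a \<in> I"
  by (simp add: ideal.I_l_closed)

lemma ideal_rmultD: "ideal I R \<Longrightarrow> a \<in> I \<Longrightarrow> r \<in> carrier R \<Longrightarrow> a \<otimes> r \<in> I"
  by (simp add: ideal.I_r_closed)

lemma ideal_carrD: "ideal I R \<Longrightarrow> a \<in> I \<Longrightarrow> a \<in> carrier R"
  by (rule ideal.Icarr)

lemma ideal_subset: "ideal I R \<Longrightarrow> I \<subseteq> carrier R"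
  using ideal_carrD by blast

lemma ideal_oneD: "ideal I R \<Longrightarrow> \<one> \<in> I \<Longrightarrow> I = carrier R"
  by (rule ideal.one_imp_carrier)

lemma ideal_criterion:
  assumes "I \<subseteq> carrier R" "\<zero> \<in> I"
    and add: "\<And>a b. a \<in> I \<Longrightarrow> b \<in> I \<Longrightarrow> a \<oplus> b \<in> I"
    and mult: "\<And>a r. a \<in> I \<Longrightarrow> r \<in> carrier R \<Longrightarrow> r \<otimes> a \<in> I"
  shows "ideal I R"
proof (rule idealI)
  show "subgroup I (add_monoid R)"
  proof (rule add.subgroupI)
    fix a assume a: "a \<in> I"
    then have "(\<ominus> \<one>) \<otimes> a \<in> I" by (intro mult) auto
    moreover have "(\<ominus> \<one>) \<otimes> a = \<ominus> a" using a assms(1) by (simp add: l_minus subsetD)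
    ultimately show "\<ominus> a \<in> I" by simp
  qed (use assms in auto)
next
  fix a x assume "a \<in> I" "x \<in> carrier R"
  then show "x \<otimes> a \<in> I" "a \<otimes> x \<in> I"
    using mult[of a x] assms(1) m_comm[of a x] by auto
qed (rule ring_axioms)

lemma ideal_diff_cancel:
  "ideal I R \<Longrightarrow> a \<oplus> b \<in> I \<Longrightarrow> b \<in> I \<Longrightarrow> a \<in> carrier R \<Longrightarrow> a \<in> I"
proof -
  assume I: "ideal I R" and ab: "a \<oplus> b \<in> I" and b: "b \<in> I" and a: "a \<in> carrier R"
  have "b \<in> carrier R" using I b by (rule ideal_carrD)
  then have "(a \<oplus> b) \<ominus> b = a" using a by algebra
  then show "a \<in> I" using ideal_minusD[OF I ab b] by simp
qed

section \<open>Sums of ideals and adjunction of one element\<close>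

lemma mem_set_add: "a \<in> K <+> L \<longleftrightarrow> (\<exists>k\<in>K. \<exists>l\<in>L. a = k \<oplus> l)"
  by (auto simp: set_add_def')

lemma mem_adjoin: "a \<in> K <+> PIdl s \<longleftrightarrow> (\<exists>k\<in>K. \<exists>r\<in>carrier R. a = k \<oplus> r \<otimes> s)"
  by (auto simp: set_add_def' cgenideal_def)

lemma subset_set_add1: "ideal K R \<Longrightarrow> ideal L R \<Longrightarrow> K \<subseteq> K <+> L"
  unfolding mem_set_add subset_iff using ideal_zeroD ideal_carrD r_zero by metis

lemma subset_set_add2: "ideal K R \<Longrightarrow> ideal L R \<Longrightarrow> L \<subseteq> K <+> L"
  unfolding mem_set_add subset_iff using ideal_zeroD ideal_carrD l_zero by metis

lemma set_add_least: "ideal M R \<Longrightarrow> K \<subseteq> M \<Longrightarrow> L \<subseteq> M \<Longrightarrow> K <+> L \<subseteq> M"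
  unfolding mem_set_add subset_iff using ideal_addD by metis

lemma set_add_mono: "K \<subseteq> K' \<Longrightarrow> L \<subseteq> L' \<Longrightarrow> K <+> L \<subseteq> K' <+> L'"
  unfolding set_add_def' by blast

lemma adjoin_ideal: "ideal K R \<Longrightarrow> s \<in> carrier R \<Longrightarrow> ideal (K <+> PIdl s) R"
  by (simp add: add_ideals cgenideal_ideal)

lemma adjoin_self: "ideal K R \<Longrightarrow> s \<in> carrier R \<Longrightarrow> s \<in> K <+> PIdl s"
  using subset_set_add2[of K "PIdl s"] cgenideal_ideal cgenideal_self by blast

lemma adjoin_subset: "ideal K R \<Longrightarrow> s \<in> carrier R \<Longrightarrow> K \<subseteq> K <+> PIdl s"
  by (simp add: cgenideal_ideal subset_set_add1)

lemma adjoin_least: "ideal M R \<Longrightarrow> K \<subseteq> M \<Longrightarrow> s \<in> M \<Longrightarrow> K <+> PIdl s \<subseteq> M"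
  by (simp add: cgenideal_minimal set_add_least)

lemma adjoin_absorb: "ideal K R \<Longrightarrow> s \<in> K \<Longrightarrow> K <+> PIdl s = K"
  by (meson adjoin_least adjoin_subset ideal_carrD subset_antisym subset_refl)

lemma set_add_assoc':
  assumes "ideal K R" "ideal L R" "ideal M R"
  shows "(K <+> L) <+> M = K <+> (L <+> M)"
proof -
  have "k \<oplus> l \<oplus> m = k \<oplus> (l \<oplus> m)" if "k \<in> K" "l \<in> L" "m \<in> M" for k l m
    using that assms by (simp add: a_assoc ideal_carrD)
  then show ?thesis
    unfolding set_add_def' by fastforce
qed

lemma genideal_insert:
  assumes "S \<subseteq> carrier R" "s \<in> carrier R"
  shows "Idl (insert s S) = Idl S <+> PIdl s"
proof
  have S: "ideal (Idl S) R" using assms by (simp add: genideal_ideal)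
  show "Idl (insert s S) \<subseteq> Idl S <+> PIdl s"
    using adjoin_subset[OF S assms(2)] adjoin_self[OF S assms(2)] genideal_self[OF assms(1)]
    by (intro genideal_minimal adjoin_ideal S assms) auto
  show "Idl S <+> PIdl s \<subseteq> Idl (insert s S)"
    using assms genideal_self[of "insert s S"] genideal_minimal[of "Idl (insert s S)" S]
    by (intro adjoin_least) (auto simp: genideal_ideal)
qed

lemma genideal_of_ideal: "ideal K R \<Longrightarrow> Idl K = K"
  by (meson genideal_minimal genideal_self ideal_subset subset_antisym subset_refl)

lemma genideal_mono: "S \<subseteq> T \<Longrightarrow> T \<subseteq> carrier R \<Longrightarrow> Idl S \<subseteq> Idl T"
  by (rule subset_Idl_subset)

lemma ideal_prodI: "a \<in> I \<Longrightarrow> b \<in> J \<Longrightarrow> a \<otimes> b \<in> I \<cdot> J"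
  by (rule ideal_prod.prod)

lemma ideal_prod_least:
  assumes "ideal K R" "\<And>a b. a \<in> I \<Longrightarrow> b \<in> J \<Longrightarrow> a \<otimes> b \<in> K"
  shows "I \<cdot> J \<subseteq> K"
proof
  fix x assume "x \<in> I \<cdot> J"
  then show "x \<in> K" by induct (use assms ideal_addD in auto)
qed

section \<open>Colon ideals\<close>

definition colon :: "'a set \<Rightarrow> 'a \<Rightarrow> 'a set"
  where "colon K s = {a \<in> carrier R. a \<otimes> s \<in> K}"

lemma mem_colon: "a \<in> colon K s \<longleftrightarrow> a \<in> carrier R \<and> a \<otimes> s \<in> K"
  by (simp add: colon_def)

lemma colon_ideal:
  assumes K: "ideal K R" and s: "s \<in> carrier R"
  shows "ideal (colon K s) R"
proof (rule ideal_criterion)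
  fix a r assume a: "a \<in> colon K s" and r: "r \<in> carrier R"
  then show "r \<otimes> a \<in> colon K s"
    using s ideal_lmultD[OF K, of "a \<otimes> s" r] by (simp add: mem_colon m_assoc)
qed (use s ideal_zeroD[OF K] ideal_addD[OF K] in \<open>auto simp: mem_colon l_distr\<close>)

lemma subset_colon: "ideal K R \<Longrightarrow> s \<in> carrier R \<Longrightarrow> K \<subseteq> colon K s"
  using ideal_rmultD ideal_carrD by (auto simp: mem_colon)

lemma colon_mono: "K \<subseteq> L \<Longrightarrow> colon K s \<subseteq> colon L s"
  by (auto simp: colon_def)

text \<open>Trades membership for properness of an ideal; proper ideals lie in a prime, so
  membership can be tested after localization or by Nakayama's lemma.\<close>

lemma colon_eq_carrier:
  assumes "ideal K R" "s \<in> carrier R"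
  shows "colon K s = carrier R \<longleftrightarrow> s \<in> K"
proof
  assume "colon K s = carrier R"
  then have "\<one> \<in> colon K s" by simp
  then show "s \<in> K" using assms(2) by (simp add: mem_colon)
qed (use assms ideal_lmultD in \<open>auto simp: mem_colon\<close>)

section \<open>Powers of ideals\<close>

lemma ideal_power_0: "ideal_power R J 0 = carrier R"
  and ideal_power_Suc: "ideal_power R J (Suc n) = ideal_power R J n \<cdot> J"
  by (simp_all add: ideal_power_def ideals_set_def)

lemma ideal_power_ideal: "ideal J R \<Longrightarrow> ideal (ideal_power R J n) R"
  by (induct n) (simp_all add: ideal_power_0 ideal_power_Suc oneideal ideal_prod_is_ideal)

lemma ideal_power_1: "ideal J R \<Longrightarrow> ideal_power R J (Suc 0) = J"
  by (metis ideal_power_0 ideal_power_Suc ideal_prod_commute ideal_prod_one oneideal)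

lemma ideal_power_add:
  assumes "ideal J R"
  shows "ideal_power R J (m + n) = ideal_power R J m \<cdot> ideal_power R J n"
proof (induct n)
  case 0 then show ?case by (simp add: ideal_power_0 ideal_prod_one ideal_power_ideal assms)
next
  case (Suc n) then show ?case
    by (simp add: ideal_power_Suc ideal_prod_assoc ideal_power_ideal assms)
qed

lemma ideal_power_antimono:
  assumes J: "ideal J R" and "m \<le> n"
  shows "ideal_power R J n \<subseteq> ideal_power R J m"
proof -
  obtain k where "n = m + k" using \<open>m \<le> n\<close> le_Suc_ex by blast
  then show ?thesis
    using ideal_prod_inter[OF ideal_power_ideal[OF J] ideal_power_ideal[OF J], of m k]
    by (simp add: ideal_power_add[OF J])
qed

lemma ideal_power_mono: "I \<subseteq> J \<Longrightarrow> ideal_power R I n \<subseteq> ideal_power R J n"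
proof (induct n)
  case (Suc n)
  have "x \<in> ideal_power R J n \<cdot> J" if "x \<in> ideal_power R I n \<cdot> I" for x
    using that by induct (use Suc in \<open>auto intro: ideal_prod.intros\<close>)
  then show ?case by (auto simp: ideal_power_Suc)
qed (simp add: ideal_power_0)

lemma ideal_power_subset: "ideal J R \<Longrightarrow> 0 < n \<Longrightarrow> ideal_power R J n \<subseteq> J"
  using ideal_power_antimono[of J "Suc 0" n] ideal_power_1 by auto

lemma pow_in_ideal_power: "ideal J R \<Longrightarrow> x \<in> J \<Longrightarrow> x [^] (n::nat) \<in> ideal_power R J n"
  by (induct n) (auto simp: ideal_power_0 ideal_power_Suc intro: ideal_prod.prod)

lemma pow_in_ideal: "ideal J R \<Longrightarrow> x \<in> J \<Longrightarrow> 0 < n \<Longrightarrow> x [^] (n::nat) \<in> J"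
  using pow_in_ideal_power ideal_power_subset by blast

lemma pow_ideal_le: "ideal J R \<Longrightarrow> x \<in> carrier R \<Longrightarrow> x [^] (m::nat) \<in> J \<Longrightarrow> m \<le> n \<Longrightarrow> x [^] n \<in> J"
  by (metis ideal_rmultD le_add_diff_inverse nat_pow_closed nat_pow_mult)

text \<open>Pigeonhole: among a + b factors, either a come from \<open>J\<close> or b are multiples
  of \<open>x\<close>. In the induction the last factor j + r x is split; the j-part uses the claim
  for (a - 1, b), the x-part the claim for (a, b - 1).\<close>

lemma ideal_power_adjoin:
  assumes J: "ideal J R" and x: "x \<in> carrier R"
  shows "ideal_power R (J <+> PIdl x) (a + b) \<subseteq> ideal_power R J a <+> PIdl (x [^] b)"
proof (induct "a + b" arbitrary: a b)
  case 0
  then show ?case by (simp add: ideal_power_0 oneideal adjoin_subset)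
next
  case (Suc n)
  have target: "ideal (ideal_power R J a <+> PIdl (x [^] b)) R"
    by (simp add: J x adjoin_ideal ideal_power_ideal)
  have sub: "ideal (J <+> PIdl x) R" by (simp add: J x adjoin_ideal)
  show ?case
  proof (cases "a = 0 \<or> b = 0")
    case True
    then have "\<one> \<in> ideal_power R J a <+> PIdl (x [^] b)"
    proof
      assume "a = 0" then show ?thesis
        using adjoin_subset[of "carrier R" "x [^] b"] x by (simp add: ideal_power_0 oneideal subset_iff)
    next
      assume "b = 0" then show ?thesis
        using adjoin_self[of "ideal_power R J a" \<one>] J by (simp add: ideal_power_ideal)
    qed
    then have "ideal_power R J a <+> PIdl (x [^] b) = carrier R"
      using ideal_oneD target by blast
    then show ?thesis by (simp add: ideal_subset ideal_power_ideal sub)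
  next
    case False
    then obtain a' b' where ab: "a = Suc a'" "b = Suc b'" by (meson old.nat.exhaust)
    have n1: "n = a' + b" and n2: "n = a + b'" using Suc(2) ab by auto
    show ?thesis unfolding Suc(2)[symmetric] ideal_power_Suc
    proof (rule ideal_prod_least[OF target])
      fix u v assume u: "u \<in> ideal_power R (J <+> PIdl x) n" and v: "v \<in> J <+> PIdl x"
      from v obtain j r where j: "j \<in> J" and r: "r \<in> carrier R" and v': "v = j \<oplus> r \<otimes> x"
        unfolding mem_adjoin by blast
      have jc: "j \<in> carrier R" using J j ideal_carrD by blast
      obtain k1 r1 where k1: "k1 \<in> ideal_power R J a'" and r1: "r1 \<in> carrier R" 
        and u1: "u = k1 \<oplus> r1 \<otimes> x [^] b"
        using Suc(1)[OF n1] u n1 unfolding subset_iff mem_adjoin by blast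
      obtain k2 r2 where k2: "k2 \<in> ideal_power R J a" and r2: "r2 \<in> carrier R" 
        and u2: "u = k2 \<oplus> r2 \<otimes> x [^] b'"
        using Suc(1)[OF n2] u n2 unfolding subset_iff mem_adjoin by blast
      have kc: "k1 \<in> carrier R" "k2 \<in> carrier R"
        using k1 k2 J ideal_power_ideal ideal_carrD by blast+
      have "k1 \<otimes> j \<in> ideal_power R J a" using k1 j ab by (simp add: ideal_power_Suc ideal_prodI)
      moreover have "u \<otimes> j = k1 \<otimes> j \<oplus> (r1 \<otimes> j) \<otimes> x [^] b" 
        unfolding u1 using kc r1 jc x nat_pow_closed[OF x, of b] by algebra
      ultimately have A: "u \<otimes> j \<in> ideal_power R J a <+> PIdl (x [^] b)"
        unfolding mem_adjoin using r1 jc by blast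
      have xb: "x [^] b = x [^] b' \<otimes> x" using ab x by simp
      have "k2 \<otimes> (r \<otimes> x) \<in> ideal_power R J a"
        using k2 J r x by (simp add: ideal_power_ideal ideal_rmultD)
      moreover have "u \<otimes> (r \<otimes> x) = k2 \<otimes> (r \<otimes> x) \<oplus> (r2 \<otimes> r) \<otimes> x [^] b" 
        unfolding u2 xb using kc r2 r x nat_pow_closed[OF x, of b'] by algebra
      ultimately have B: "u \<otimes> (r \<otimes> x) \<in> ideal_power R J a <+> PIdl (x [^] b)"
        unfolding mem_adjoin using r2 r by blast
      have uc: "u \<in> carrier R" using u1 kc r1 x by simp
      have "u \<otimes> v = u \<otimes> j \<oplus> u \<otimes> (r \<otimes> x)" unfolding v' using uc jc r x by algebra
      then show "u \<otimes> v \<in> ideal_power R J a <+> PIdl (x [^] b)"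
        using ideal_addD[OF target A B] by simp
    qed
  qed
qed

section \<open>Prime ideals\<close>

lemma primeD: "primeideal P R \<Longrightarrow> a \<otimes> b \<in> P \<Longrightarrow> a \<in> carrier R \<Longrightarrow> b \<in> carrier R \<Longrightarrow> a \<in> P \<or> b \<in> P"
  by (rule primeideal.I_prime)

lemma prime_ideal: "primeideal P R \<Longrightarrow> ideal P R"
  by (simp add: primeideal_def)

lemma prime_one: "primeideal P R \<Longrightarrow> \<one> \<notin> P"
  by (metis ideal_oneD prime_ideal primeideal.I_notcarr)

lemma prime_powD: "primeideal P R \<Longrightarrow> x \<in> carrier R \<Longrightarrow> x [^] (n::nat) \<in> P \<Longrightarrow> x \<in> P"
proof (induct n)
  case (Suc n)
  then show ?case using primeD[of P "x [^] n" x] by auto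
qed (simp add: prime_one)

end

section \<open>Noetherian rings\<close>

locale noetherian_cring = cring + noetherian_ring

context noetherian_cring begin

lemma maximal_ideal_exists:
  assumes "S \<noteq> {}" "\<And>I. I \<in> S \<Longrightarrow> ideal I R"
  obtains M where "M \<in> S" "\<And>I. I \<in> S \<Longrightarrow> M \<subseteq> I \<Longrightarrow> I = M"
proof -
  have "\<exists>M\<in>S. \<forall>Y\<in>S. M \<subseteq> Y \<longrightarrow> Y = M"
  proof (rule subset_Zorn)
    fix C assume C: "subset.chain S C"
    show "\<exists>U\<in>S. \<forall>Y\<in>C. Y \<subseteq> U"
    proof (cases "C = {}")
      case True then show ?thesis using assms(1) by blast
    next
      case False
      have "subset.chain {I. ideal I R} C"
        using C assms(2) by (auto simp: pred_on.chain_def)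
      then have "\<Union>C \<in> C" using ideal_chain_is_trivial False by blast
      then show ?thesis using C by (auto simp: pred_on.chain_def)
    qed
  qed
  then show ?thesis using that by blast
qed

lemma noetherian_induct [consumes 1, case_names step]:
  assumes I: "ideal I R"
    and step: "\<And>I. ideal I R \<Longrightarrow> (\<And>J. ideal J R \<Longrightarrow> I \<subset> J \<Longrightarrow> \<Phi> J) \<Longrightarrow> \<Phi> I"
  shows "\<Phi> I"
proof (rule ccontr)
  assume "\<not> \<Phi> I"
  then have "{J. ideal J R \<and> \<not> \<Phi> J} \<noteq> {}" using I by blast
  then obtain M where "M \<in> {J. ideal J R \<and> \<not> \<Phi> J}" 
    and max: "\<And>J. J \<in> {J. ideal J R \<and> \<not> \<Phi> J} \<Longrightarrow> M \<subseteq> J \<Longrightarrow> J = M"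
    using maximal_ideal_exists[of "{J. ideal J R \<and> \<not> \<Phi> J}"] by (metis (lifting) mem_Collect_eq)
  then show False using step[of M] by (metis (lifting) mem_Collect_eq psubset_eq)
qed

lemma ideal_sequence_stable:
  fixes I :: "nat \<Rightarrow> 'a set"
  assumes "\<And>n. ideal (I n) R" "\<And>n. I n \<subseteq> I (Suc n)"
  shows "\<exists>c. \<forall>n\<ge>c. I n = I c"
proof -
  obtain M where "M \<in> range I" and max: "\<And>J. J \<in> range I \<Longrightarrow> M \<subseteq> J \<Longrightarrow> J = M"
    by (rule maximal_ideal_exists[of "range I"]) (use assms(1) in auto)
  then obtain c where "M = I c" by blast
  moreover have "I c \<subseteq> I n" if "c \<le> n" for n
    using that assms(2) by (simp add: lift_Suc_mono_le)
  ultimately have "I n = I c" if "c \<le> n" for n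
    using that max[of "I n"] by simp
  then show ?thesis by blast
qed

lemma maximal_above:
  assumes I: "ideal I R" and "I \<noteq> carrier R"
  obtains M where "maximalideal M R" "I \<subseteq> M"
proof -
  let ?S = "{J. ideal J R \<and> I \<subseteq> J \<and> J \<noteq> carrier R}"
  obtain M where M: "M \<in> ?S" and max: "\<And>J. J \<in> ?S \<Longrightarrow> M \<subseteq> J \<Longrightarrow> J = M"
    by (rule maximal_ideal_exists[of ?S]) (use assms in auto)
  have "J = M \<or> J = carrier R" if "ideal J R" "M \<subseteq> J" for J
    using max[of J] that M by fastforce
  then have "maximalideal M R" using M by (intro maximalidealI) auto
  then show ?thesis using that M by blast
qed

lemma prime_above:
  assumes "ideal I R" "I \<noteq> carrier R"
  obtains P where "primeideal P R" "I \<subseteq> P"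
  using maximal_above[OF assms] maximalideal_prime by metis

text \<open>A finite family of primes is recorded as a list, since \<open>J\<close> need only contain a product with
  repetitions.\<close>

lemma contains_prime_product:
  assumes "ideal J R"
  shows "\<exists>Ps. (\<forall>P\<in>set Ps. primeideal P R \<and> J \<subseteq> P) \<and> foldr (ideal_prod R) Ps (carrier R) \<subseteq> J"
  using assms
proof (induct rule: noetherian_induct)
  case (step J)
  have fold_ideal: "ideal (foldr (ideal_prod R) Ps (carrier R)) R" if "\<forall>P\<in>set Ps. primeideal P R" for Ps
    using that by (induct Ps) (auto simp: oneideal ideal_prod_is_ideal prime_ideal)
  show ?case
  proof (cases "J = carrier R \<or> primeideal J R")
    case True
    then show ?thesis
    proof
      assume "J = carrier R" then show ?thesis by (intro exI[of _ "[]"]) auto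
    next
      assume "primeideal J R" then show ?thesis
        by (intro exI[of _ "[J]"]) (simp add: ideal_prod_one prime_ideal)
    qed
  next
    case False
    then obtain a b where ab: "a \<in> carrier R" "b \<in> carrier R" "a \<otimes> b \<in> J" "a \<notin> J" "b \<notin> J"
      using primeidealI[OF step(1) is_cring] by blast
    have sub: "J \<subset> J <+> PIdl c" if "c \<in> carrier R" "c \<notin> J" for c
      using that adjoin_subset[OF step(1)] adjoin_self[OF step(1)] by blast
    obtain Ps where Ps: "\<forall>P\<in>set Ps. primeideal P R \<and> J <+> PIdl a \<subseteq> P" 
        "foldr (ideal_prod R) Ps (carrier R) \<subseteq> J <+> PIdl a"
      using step(2)[OF adjoin_ideal[OF step(1) ab(1)] sub[OF ab(1,4)]] by blast
    obtain Qs where Qs: "\<forall>P\<in>set Qs. primeideal P R \<and> J <+> PIdl b \<subseteq> P" 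
        "foldr (ideal_prod R) Qs (carrier R) \<subseteq> J <+> PIdl b"
      using step(2)[OF adjoin_ideal[OF step(1) ab(2)] sub[OF ab(2,5)]] by blast
    let ?p = "foldr (ideal_prod R) Ps (carrier R)" and ?q = "foldr (ideal_prod R) Qs (carrier R)"
    have app: "foldr (ideal_prod R) (Ps' @ Qs) (carrier R) = foldr (ideal_prod R) Ps' (carrier R) \<cdot> ?q" 
      if "\<forall>P\<in>set Ps'. primeideal P R" for Ps'
      using that
    proof (induct Ps')
      case Nil
      then show ?case
        using fold_ideal[of Qs] Qs ideal_prod_commute[OF oneideal, of ?q] by (simp add: ideal_prod_one)
    next
      case (Cons P Ps')
      then show ?case
        using fold_ideal Qs by (simp add: ideal_prod_assoc prime_ideal)
    qed
    \<comment> \<open>(J + (a))(J + (b)) lies in J because a b does, so the two lists of primes can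
      be concatenated.\<close>
    have "?p \<cdot> ?q \<subseteq> J"
    proof (rule ideal_prod_least[OF step(1)])
      fix u v assume "u \<in> ?p" "v \<in> ?q"
      then obtain j r k s where *: "j \<in> J" "r \<in> carrier R" "u = j \<oplus> r \<otimes> a"
        "k \<in> J" "s \<in> carrier R" "v = k \<oplus> s \<otimes> b"
        using Ps(2) Qs(2) unfolding subset_iff mem_adjoin by meson
      have c: "j \<in> carrier R" "k \<in> carrier R" using * ideal_carrD[OF step(1)] by auto
      have "u \<otimes> v = (j \<otimes> (k \<oplus> s \<otimes> b) \<oplus> (r \<otimes> a) \<otimes> k) \<oplus> (r \<otimes> s) \<otimes> (a \<otimes> b)"
        unfolding *(3,6) using *(2,5) c ab(1,2) by algebra
      also have "\<dots> \<in> J"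
        by (intro ideal_addD[OF step(1)])
          (use * c ab ideal_rmultD[OF step(1)] ideal_lmultD[OF step(1)] in simp_all)
      finally show "u \<otimes> v \<in> J" .
    qed
    moreover have "\<forall>P\<in>set (Ps @ Qs). primeideal P R \<and> J \<subseteq> P"
      using Ps(1) Qs(1) adjoin_subset[OF step(1) ab(1)] adjoin_subset[OF step(1) ab(2)]
      by (metis Un_iff set_append subset_trans)
    moreover have "foldr (ideal_prod R) (Ps @ Qs) (carrier R) = ?p \<cdot> ?q"
      using app Ps(1) by blast
    ultimately show ?thesis by metis
  qed
qed

lemma prime_contains_product:
  assumes "primeideal Q R" "\<forall>P\<in>set Ps. ideal P R" "foldr (ideal_prod R) Ps (carrier R) \<subseteq> Q"
  shows "\<exists>P\<in>set Ps. P \<subseteq> Q"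
  using assms(2,3)
proof (induct Ps)
  case Nil
  then show ?case using prime_one[OF assms(1)] by auto
next
  case (Cons P Ps)
  let ?f = "foldr (ideal_prod R) Ps (carrier R)"
  have f: "ideal ?f R" using Cons(2) by (induct Ps) (auto simp: oneideal ideal_prod_is_ideal)
  show ?case
  proof (cases "P \<subseteq> Q")
    case False
    then obtain a where a: "a \<in> P" "a \<notin> Q" by blast
    have "?f \<subseteq> Q"
    proof
      fix b assume b: "b \<in> ?f"
      then have "a \<otimes> b \<in> Q" using Cons(3) a by (auto intro: ideal_prodI)
      then show "b \<in> Q" using a b f Cons(2) primeD[OF assms(1), of a b] ideal_carrD by auto
    qed
    then show ?thesis using Cons by auto
  qed auto
qed

text \<open>Every factor of the prime product inside \<open>K\<close> must be \<open>M\<close>, so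
  the product is a power of \<open>M\<close>.\<close>

lemma only_prime_imp_power:
  assumes K: "ideal K R" and M: "ideal M R" and only: "\<And>P. primeideal P R \<Longrightarrow> K \<subseteq> P \<Longrightarrow> P = M"
  obtains n where "ideal_power R M n \<subseteq> K"
proof -
  obtain Ps where Ps: "\<forall>P\<in>set Ps. primeideal P R \<and> K \<subseteq> P" "foldr (ideal_prod R) Ps (carrier R) \<subseteq> K"
    using contains_prime_product[OF K] by blast
  have "\<forall>P\<in>set Ps. P = M" using Ps only by blast
  then have "foldr (ideal_prod R) Ps (carrier R) = ideal_power R M (length Ps)"
  proof (induct Ps)
    case (Cons P Ps)
    then show ?case
      using M by (simp add: ideal_power_Suc ideal_prod_commute[OF M ideal_power_ideal[OF M]])
  qed (simp add: ideal_power_0)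
  then show ?thesis using that Ps by blast
qed

text \<open>For a principal ideal the Artin--Rees lemma follows directly from the ascending chain
  condition.\<close>

lemma artin_rees_principal:
  assumes K: "ideal K R" and s: "s \<in> carrier R" and x: "x \<in> carrier R"
  obtains c where "\<And>n. c \<le> n \<Longrightarrow> colon (K <+> PIdl (x [^] (n::nat))) s \<subseteq> colon K s <+> PIdl (x [^] (n - c))"
proof -
  let ?L = "K <+> PIdl s"
  have L: "ideal ?L R" using K s by (rule adjoin_ideal)
  \<comment> \<open>The ideals (K + (s) : x^n) ascend with n; the index where they become constant
    serves as the Artin-Rees constant \<open>c\<close>.\<close>
  have "colon ?L (x [^] n) \<subseteq> colon ?L (x [^] Suc n)" for n :: nat
  proof
    fix a assume "a \<in> colon ?L (x [^] n)"
    then show "a \<in> colon ?L (x [^] Suc n)"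
      using ideal_rmultD[OF L, of "a \<otimes> x [^] n" x] x by (simp add: mem_colon m_assoc)
  qed
  then have "\<exists>c::nat. \<forall>n\<ge>c. colon ?L (x [^] n) = colon ?L (x [^] c)"
    by (intro ideal_sequence_stable[of "\<lambda>n. colon ?L (x [^] (n::nat))"] colon_ideal L nat_pow_closed x)
  then obtain c :: nat where c: "\<And>n. c \<le> n \<Longrightarrow> colon ?L (x [^] n) = colon ?L (x [^] c)"
    by metis
  have "colon (K <+> PIdl (x [^] n)) s \<subseteq> colon K s <+> PIdl (x [^] (n - c))" if n: "c \<le> n" for n
  proof
    fix a assume "a \<in> colon (K <+> PIdl (x [^] n)) s"
    then obtain k b where a: "a \<in> carrier R" and k: "k \<in> K" and b: "b \<in> carrier R" 
      and as: "a \<otimes> s = k \<oplus> b \<otimes> x [^] n"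
      unfolding mem_colon mem_adjoin by blast
    have kc: "k \<in> carrier R" using K k ideal_carrD by blast
    have xn: "x [^] n \<in> carrier R" using x by simp
    \<comment> \<open>Thus b lies in (K + (s) : x^n) = (K + (s) : x^c). Writing b x^c = k' + b' s
      and moving b' x^(n-c) s to the left leaves (a - b' x^(n-c)) s in K.\<close>
    have "b \<otimes> x [^] n = \<ominus> k \<oplus> a \<otimes> s" unfolding as using kc b xn by algebra
    then have "b \<in> colon ?L (x [^] n)" using b k a K ideal_uminusD unfolding mem_colon mem_adjoin by blast
    then have "b \<in> colon ?L (x [^] c)" using c n by blast
    then obtain k' b' where k': "k' \<in> K" and b': "b' \<in> carrier R" and bx: "b \<otimes> x [^] c = k' \<oplus> b' \<otimes> s"
      unfolding mem_colon mem_adjoin by blast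
    have k'c: "k' \<in> carrier R" using K k' ideal_carrD by blast
    let ?y = "x [^] (n - c)"
    have y: "?y \<in> carrier R" "x [^] c \<in> carrier R" using x by simp_all
    have xy: "x [^] n = x [^] c \<otimes> ?y" using n x by (simp add: nat_pow_mult)
    have "b \<otimes> x [^] n = (b \<otimes> x [^] c) \<otimes> ?y" unfolding xy using b y by algebra
    then have "b \<otimes> x [^] n = (k' \<oplus> b' \<otimes> s) \<otimes> ?y" by (simp only: bx)
    then have "a \<otimes> s = k \<oplus> (k' \<oplus> b' \<otimes> s) \<otimes> ?y" using as by simp
    then have "(a \<ominus> b' \<otimes> ?y) \<otimes> s = (k \<oplus> (k' \<oplus> b' \<otimes> s) \<otimes> ?y) \<ominus> b' \<otimes> ?y \<otimes> s" 
      using a b' s y by (simp add: minus_eq l_distr l_minus)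
    also have "\<dots> = k \<oplus> k' \<otimes> ?y" using kc k'c b' s y by algebra
    also have "\<dots> \<in> K" using k k' y K by (intro ideal_addD[OF K] ideal_rmultD[OF K])
    finally have "a \<ominus> b' \<otimes> ?y \<in> colon K s" using a b' y by (simp add: mem_colon)
    moreover have "a = (a \<ominus> b' \<otimes> ?y) \<oplus> b' \<otimes> ?y" using a b' y by algebra
    ultimately show "a \<in> colon K s <+> PIdl ?y" unfolding mem_adjoin using b' by blast
  qed
  then show ?thesis using that by blast
qed

text \<open>The linear bound of the Artin--Rees lemma is lost here, since the exponent of each generator
  depends on those chosen before it.\<close>

lemma weak_artin_rees:
  assumes K: "ideal K R" and s: "s \<in> carrier R" and J: "ideal J R"
  obtains L n where "ideal L R" "ideal_power R J n \<subseteq> L" "L \<subseteq> ideal_power R J t" 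
    "colon (K <+> L) s \<subseteq> colon K s <+> ideal_power R J t"
proof -
  let ?J = "ideal_power R J t"
  have Jt: "ideal ?J R" using J by (rule ideal_power_ideal)
  obtain A where A: "A \<subseteq> carrier R" "finite A" "J = Idl A" using finetely_gen[OF J] by blast
  \<comment> \<open>Induction over the generators of \<open>J\<close>: for each new one, a suitable
    power is adjoined to \<open>L\<close>, and Artin-Rees is applied with the base
    \<open>K <+> L\<close> obtained so far.\<close>
  have "\<exists>L n. ideal L R \<and> ideal_power R (Idl B) n \<subseteq> L \<and> L \<subseteq> ?J \<and> colon (K <+> L) s \<subseteq> colon K s <+> ?J" 
    if "B \<subseteq> A" for B
    using finite_subset[OF that A(2)] that
  proof (induct B rule: finite_induct)
    case empty
    have "ideal_power R (Idl {}) 1 \<subseteq> {\<zero>}"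
      using ideal_power_1[of "Idl {}"] genideal_minimal[OF zeroideal] by (simp add: genideal_ideal)
    moreover have "K <+> {\<zero>} = K" using ideal_carrD[OF K] by (auto simp: mem_set_add)
    ultimately show ?case
      using subset_set_add1[OF colon_ideal[OF K s] Jt] zeroideal ideal_zeroD[OF Jt]
      by (intro exI[of _ "{\<zero>}"] exI[of _ 1]) auto
  next
    case (insert x B)
    then obtain L n where L: "ideal L R" "ideal_power R (Idl B) n \<subseteq> L" "L \<subseteq> ?J"
      "colon (K <+> L) s \<subseteq> colon K s <+> ?J" by blast
    have x: "x \<in> carrier R" and B: "B \<subseteq> carrier R" using insert A by auto
    have KL: "ideal (K <+> L) R" using K L by (simp add: add_ideals)
    obtain c where c: "\<And>n. c \<le> n \<Longrightarrow> colon ((K <+> L) <+> PIdl (x [^] (n::nat))) s 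
        \<subseteq> colon (K <+> L) s <+> PIdl (x [^] (n - c))"
      using artin_rees_principal[OF KL s x] by blast
    \<comment> \<open>Artin-Rees loses \<open>c\<close> powers of x; the remaining x^t lies in
      J^t.\<close>
    let ?N = "c + t"
    have "x \<in> J" using insert A genideal_self by blast
    then have xt: "x [^] t \<in> ?J" using J pow_in_ideal_power by blast
    let ?L = "L <+> PIdl (x [^] ?N)"
    have "colon (K <+> ?L) s \<subseteq> colon (K <+> L) s <+> PIdl (x [^] t)"
      using c[of ?N] K L x by (simp add: set_add_assoc' cgenideal_ideal)
    also have "\<dots> \<subseteq> colon K s <+> ?J"
      using L(4) xt subset_set_add2[OF colon_ideal[OF K s] Jt]
      by (intro adjoin_least add_ideals colon_ideal K s Jt) auto
    finally have 1: "colon (K <+> ?L) s \<subseteq> colon K s <+> ?J" .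
    have "ideal_power R (Idl (insert x B)) (n + ?N) \<subseteq> ideal_power R (Idl B) n <+> PIdl (x [^] ?N)"
      unfolding genideal_insert[OF B x] by (rule ideal_power_adjoin) (use B x genideal_ideal in auto)
    also have "\<dots> \<subseteq> ?L" using L(2) by (rule set_add_mono) simp
    finally have 2: "ideal_power R (Idl (insert x B)) (n + ?N) \<subseteq> ?L" .
    have "x [^] ?N \<in> ?J"
      using xt Jt pow_ideal_le[OF Jt x xt, of ?N] by simp
    then have 3: "?L \<subseteq> ?J" by (intro adjoin_least Jt L)
    have "ideal ?L R" using L x by (simp add: adjoin_ideal)
    then show ?case using 1 2 3 by blast
  qed
  then show ?thesis using that A(3) by blast
qed

end

section \<open>Local rings\<close>

locale noetherian_local = noetherian_cring +
  fixes \<mm> assumes maximal: "maximalideal \<mm> R" and unique: "maximalideal M R \<Longrightarrow> M = \<mm>"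
begin

lemma \<mm>_ideal: "ideal \<mm> R" and \<mm>_prime: "primeideal \<mm> R"
  using maximal maximalideal_prime by (simp_all add: maximalideal_def)

lemma ideal_le_\<mm>: "ideal I R \<Longrightarrow> I \<noteq> carrier R \<Longrightarrow> I \<subseteq> \<mm>"
  using maximal_above unique by metis

lemma prime_le_\<mm>: "primeideal P R \<Longrightarrow> P \<subseteq> \<mm>"
  using ideal_le_\<mm> prime_ideal primeideal.I_notcarr by blast

text \<open>Nakayama's lemma in the form used below. Applied to I = (K : f), it gives f in
  K.\<close>

lemma one_in_add_\<mm>:
  assumes I: "ideal I R" and "\<one> \<in> I <+> \<mm>"
  shows "I = carrier R"
proof (rule ccontr)
  assume "I \<noteq> carrier R"
  then have "I <+> \<mm> \<subseteq> \<mm>" by (rule set_add_least[OF \<mm>_ideal ideal_le_\<mm>[OF I] subset_refl])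
  then show False using assms(2) prime_one[OF \<mm>_prime] by (meson subsetD)
qed

text \<open>The element 1 - b is a unit. Instead of inverting it, one observes that it lies in (K :
  a), which therefore cannot be inside \<mm>.\<close>

lemma one_minus_cancel:
  assumes K: "ideal K R" and b: "b \<in> \<mm>" and a: "a \<in> carrier R" and ab: "a \<ominus> b \<otimes> a \<in> K"
  shows "a \<in> K"
proof -
  have bc: "b \<in> carrier R" using b \<mm>_ideal ideal_carrD by blast
  have "(\<one> \<ominus> b) \<otimes> a = a \<ominus> b \<otimes> a" using a bc by algebra
  then have "\<one> \<ominus> b \<in> colon K a" using ab a bc by (simp add: mem_colon)
  moreover have "\<one> = (\<one> \<ominus> b) \<oplus> b" using bc by algebra
  ultimately have "\<one> \<in> colon K a <+> \<mm>" using b unfolding mem_set_add by blast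
  then show ?thesis using one_in_add_\<mm> colon_ideal colon_eq_carrier K a by blast
qed

text \<open>Weak Artin-Rees with s = f and t = 1: f in K + \<mm>^n makes (K + L : f) the unit ideal,
  hence (K : f) + \<mm> as well, and Nakayama's lemma applies.\<close>

lemma krull_intersection:
  assumes K: "ideal K R" and f: "f \<in> carrier R"
    and mem: "\<And>t. f \<in> K <+> ideal_power R \<mm> t"
  shows "f \<in> K"
proof -
  obtain L n where L: "ideal L R" "ideal_power R \<mm> n \<subseteq> L" 
    "colon (K <+> L) f \<subseteq> colon K f <+> ideal_power R \<mm> 1"
    by (rule weak_artin_rees[OF K f \<mm>_ideal, of 1])
  have "f \<in> K <+> L" using mem[of n] L(2) set_add_mono by blast
  then have "\<one> \<in> colon (K <+> L) f" using f by (simp add: mem_colon)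
  then have "\<one> \<in> colon K f <+> \<mm>" using L(3) ideal_power_1[OF \<mm>_ideal] by auto
  then show ?thesis using one_in_add_\<mm> colon_ideal colon_eq_carrier K f by blast
qed

end

section \<open>Length\<close>

lemma enat_le_addE:
  assumes "enat k \<le> a + b"
  obtains m n where "k = m + n" "enat m \<le> a" "enat n \<le> b"
proof (cases a)
  case (enat a')
  show ?thesis
  proof (cases "k \<le> a'")
    case True
    then show ?thesis using that[of k 0] enat zero_enat_def by auto
  next
    case False
    then have "enat (k - a') \<le> b"
      using assms enat by (cases b) auto
    then show ?thesis using that[of a' "k - a'"] enat False by auto
  qed
next
  case infinity
  then show ?thesis using that[of k 0] zero_enat_def by auto
qed

text \<open>Inequalities between possibly infinite lengths thereby reduce to statements about single
  finite chains.\<close>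

lemma enat_le_by_nat: "(\<And>k. enat k \<le> a \<Longrightarrow> enat k \<le> b) \<Longrightarrow> a \<le> b"
proof (cases a)
  case infinity
  assume *: "\<And>k. enat k \<le> a \<Longrightarrow> enat k \<le> b"
  show ?thesis
  proof (cases b)
    case (enat b')
    then show ?thesis using *[of "Suc b'"] infinity by simp
  qed simp
qed simp

context cring begin

text \<open>The ends of the chain need not be \<open>K\<close> and \<open>L\<close>. This leaves the
  supremum of the lengths unchanged and allows chains to be truncated or mapped freely.\<close>

definition chain_between :: "'a set \<Rightarrow> 'a set \<Rightarrow> nat \<Rightarrow> (nat \<Rightarrow> 'a set) \<Rightarrow> bool"
  where "chain_between K L n C \<longleftrightarrow>
    (\<forall>i\<le>n. ideal (C i) R \<and> K \<subseteq> C i \<and> C i \<subseteq> L) \<and> (\<forall>i<n. C i \<subset> C (Suc i))"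

text \<open>\<open>len K L\<close> is the length of the module \<open>L/K\<close>.\<close>

definition len :: "'a set \<Rightarrow> 'a set \<Rightarrow> enat"
  where "len K L = Sup {enat n | n. \<exists>C. chain_between K L n C}"

lemma len_ge: "chain_between K L n C \<Longrightarrow> enat n \<le> len K L"
  unfolding len_def by (rule Sup_upper) blast

text \<open>A chain longer than n can be cut off at n, so if none of length n exists, the supremum
  is at most n - 1.\<close>

lemma len_ge_iff:
  assumes "ideal K R" "K \<subseteq> L"
  shows "enat n \<le> len K L \<longleftrightarrow> (\<exists>C. chain_between K L n C)"
proof
  assume n: "enat n \<le> len K L"
  show "\<exists>C. chain_between K L n C"
  proof (rule ccontr)
    assume no: "\<nexists>C. chain_between K L n C"
    have "chain_between K L 0 (\<lambda>_. K)" using assms by (simp add: chain_between_def)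
    then obtain n' where n': "n = Suc n'" using no by (metis not0_implies_Suc)
    have "m \<le> n'" if "chain_between K L m C" for m C
    proof (rule ccontr)
      assume "\<not> m \<le> n'"
      then have "chain_between K L n C" using that n' by (auto simp: chain_between_def)
      then show False using no by blast
    qed
    then have "len K L \<le> enat n'" unfolding len_def by (intro Sup_least) auto
    then show False using n n' by (metis Suc_n_not_le_n enat_ord_simps(1) order_trans)
  qed
qed (use len_ge in blast)

lemma len_map:
  assumes "ideal K R" "K \<subseteq> L"
    and \<phi>: "\<And>J. ideal J R \<Longrightarrow> K \<subseteq> J \<Longrightarrow> J \<subseteq> L \<Longrightarrow> ideal (\<phi> J) R \<and> K' \<subseteq> \<phi> J \<and> \<phi> J \<subseteq> L'"
    and strict: "\<And>J J'. ideal J R \<Longrightarrow> ideal J' R \<Longrightarrow> K \<subseteq> J \<Longrightarrow> J' \<subseteq> L \<Longrightarrow> J \<subset> J' \<Longrightarrow> \<phi> J \<subset> \<phi> J'"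
  shows "len K L \<le> len K' L'"
proof (rule enat_le_by_nat)
  fix k assume "enat k \<le> len K L"
  then obtain C where C: "chain_between K L k C" using len_ge_iff assms(1,2) by blast
  then have "chain_between K' L' k (\<lambda>i. \<phi> (C i))"
    unfolding chain_between_def using \<phi> strict by (simp add: Suc_leI)
  then show "enat k \<le> len K' L'" by (rule len_ge)
qed

lemma len_mono: "K' \<subseteq> K \<Longrightarrow> L \<subseteq> L' \<Longrightarrow> len K L \<le> len K' L'"
proof -
  assume "K' \<subseteq> K" "L \<subseteq> L'"
  then have "chain_between K' L' n C" if "chain_between K L n C" for n C
    using that unfolding chain_between_def by (meson order_trans)
  then show ?thesis unfolding len_def by (intro Sup_subset_mono) blast
qed

text \<open>Intersecting a strict chain with an ideal, or adding an ideal to it, may collapse steps;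
  this counts those that survive.\<close>

lemma len_weak_chain:
  assumes K: "ideal K R" "K \<subseteq> L"
    and "\<And>i. i \<le> n \<Longrightarrow> ideal (F i) R \<and> K \<subseteq> F i \<and> F i \<subseteq> L" "\<And>i. i < n \<Longrightarrow> F i \<subseteq> F (Suc i)"
  shows "enat (card {i. i < n \<and> F i \<noteq> F (Suc i)}) \<le> len K L"
proof -
  have "\<exists>C. chain_between K L (card {i. i < n \<and> F i \<noteq> F (Suc i)}) C \<and> C (card {i. i < n \<and> F i \<noteq> F (Suc i)}) = F n"
    using assms(3,4)
  proof (induct n)
    case 0
    then show ?case by (intro exI[of _ "\<lambda>_. F 0"]) (auto simp: chain_between_def)
  next
    case (Suc n)
    define c where "c = card {i. i < n \<and> F i \<noteq> F (Suc i)}"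
    obtain C where C: "chain_between K L c C" "C c = F n" using Suc unfolding c_def by auto
    show ?case
    proof (cases "F n = F (Suc n)")
      case True
      then have "{i. i < Suc n \<and> F i \<noteq> F (Suc i)} = {i. i < n \<and> F i \<noteq> F (Suc i)}"
        using less_Suc_eq by auto
      then show ?thesis using C True unfolding c_def by auto
    next
      case False
      then have "{i. i < Suc n \<and> F i \<noteq> F (Suc i)} = insert n {i. i < n \<and> F i \<noteq> F (Suc i)}"
        by (auto simp: less_Suc_eq)
      then have card: "card {i. i < Suc n \<and> F i \<noteq> F (Suc i)} = Suc c" by (simp add: c_def)
      have "C c \<subset> F (Suc n)" using False Suc(3)[of n] C(2) by auto
      then have "chain_between K L (Suc c) (C(Suc c := F (Suc n)))"
        using C(1) Suc(2)[of "Suc n"] unfolding chain_between_def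
        by (simp add: less_Suc_eq le_Suc_eq)
      then show ?thesis unfolding card by (metis fun_upd_same)
    qed
  qed
  then show ?thesis using len_ge by blast
qed

text \<open>For \<open>\<le>\<close>: by the modular law, a strict step of a chain cannot collapse
  both in its intersection with L and in its sum with L, so every step is counted on one side. For
  \<open>\<ge>\<close>: chains are concatenated.\<close>

lemma len_add:
  assumes K: "ideal K R" and L: "ideal L R" and M: "ideal M R" and KL: "K \<subseteq> L" and LM: "L \<subseteq> M"
  shows "len K M = len K L + len L M"
proof (rule antisym)
  have KM: "K \<subseteq> M" using KL LM by blast
  show "len K M \<le> len K L + len L M"
  proof (rule enat_le_by_nat)
    fix k assume "enat k \<le> len K M"
    then obtain C where C: "chain_between K M k C" using len_ge_iff K KM by blast
    have Ci: "ideal (C i) R" "K \<subseteq> C i" "C i \<subseteq> M" if "i \<le> k" for i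
      using C that by (auto simp: chain_between_def)
    have CS: "C i \<subset> C (Suc i)" if "i < k" for i
      using C that by (auto simp: chain_between_def)
    have CS': "C i \<subseteq> C (Suc i)" if "i < k" for i
      using CS[OF that] by blast
    let ?A = "{i. i < k \<and> C i \<inter> L \<noteq> C (Suc i) \<inter> L}" 
    let ?B = "{i. i < k \<and> C i <+> L \<noteq> C (Suc i) <+> L}"
    have A: "enat (card ?A) \<le> len K L"
    proof (rule len_weak_chain[OF K KL])
      fix i assume "i \<le> k"
      then show "ideal (C i \<inter> L) R \<and> K \<subseteq> C i \<inter> L \<and> C i \<inter> L \<subseteq> L"
        using Ci L KL i_intersect by simp
    next
      fix i assume "i < k"
      then show "C i \<inter> L \<subseteq> C (Suc i) \<inter> L" using CS' by blast
    qed
    have B: "enat (card ?B) \<le> len L M"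
      by (rule len_weak_chain[OF L LM])
         (use Ci CS' LM L M in \<open>simp_all add: add_ideals subset_set_add2 set_add_least set_add_mono\<close>)
    have "i \<in> ?A \<union> ?B" if i: "i < k" for i
    proof (rule ccontr)
      assume "i \<notin> ?A \<union> ?B"
      then have eq: "C i \<inter> L = C (Suc i) \<inter> L" "C i <+> L = C (Suc i) <+> L" using i by auto
      have I: "ideal (C i) R" "ideal (C (Suc i)) R" using Ci i by auto
      have "C (Suc i) \<subseteq> C i"
      proof
        fix x assume x: "x \<in> C (Suc i)"
        then have "x \<in> C i <+> L" using eq(2) subset_set_add1[OF I(2) L] by blast
        then obtain c l where cl: "c \<in> C i" "l \<in> L" "x = c \<oplus> l" unfolding mem_set_add by blast
        have "c \<in> C (Suc i)" using cl CS[OF i] by blast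
        moreover have "l \<in> carrier R" "c \<in> carrier R" using cl L I ideal_carrD by blast+
        moreover have "l \<oplus> c = x" using calculation cl a_comm by blast
        ultimately have "l \<in> C (Suc i)" using ideal_diff_cancel[OF I(2), of l c] x by simp
        then have "l \<in> C i" using cl eq by blast
        then show "x \<in> C i" using cl ideal_addD[OF I(1)] by blast
      qed
      then show False using CS[OF i] by blast
    qed
    then have "{..<k} \<subseteq> ?A \<union> ?B" by blast
    then have "k \<le> card (?A \<union> ?B)"
      using card_mono[of "?A \<union> ?B" "{..<k}"] by simp
    also have "\<dots> \<le> card ?A + card ?B" by (rule card_Un_le)
    finally have "enat k \<le> enat (card ?A) + enat (card ?B)" by simp
    also have "\<dots> \<le> len K L + len L M" using A B by (rule add_mono)
    finally show "enat k \<le> len K L + len L M" .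
  qed
  show "len K L + len L M \<le> len K M"
  proof (rule enat_le_by_nat)
    fix k assume "enat k \<le> len K L + len L M"
    then obtain m n where k: "k = m + n" and "enat m \<le> len K L" "enat n \<le> len L M"
      by (rule enat_le_addE)
    then obtain C D where C: "chain_between K L m C" and D: "chain_between L M n D"
      using len_ge_iff K L KL LM by meson
    \<comment> \<open>\<open>D 0\<close> is skipped, since it may coincide with \<open>C m\<close>;
      the step at i = m goes from \<open>C m\<close> to \<open>D 1\<close> and is strict because
      \<open>D 0\<close> is strictly below \<open>D 1\<close>.\<close>
    let ?E = "\<lambda>i. if i \<le> m then C i else D (i - m)"
    have "?E i \<subset> ?E (Suc i)" if i: "i < k" for i
    proof -
      consider "i < m" | "i = m" | "m < i" by linarith
      then show ?thesis
      proof cases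
        case 2
        then have "0 < n" using i k by simp
        then have "C m \<subseteq> L" "L \<subseteq> D 0" "D 0 \<subset> D 1" using C D by (auto simp: chain_between_def)
        then show ?thesis using 2 by auto
      next
        case 3
        then have "D (i - m) \<subset> D (Suc (i - m))" using D i k by (auto simp: chain_between_def)
        then show ?thesis using 3 by (simp add: Suc_diff_le)
      qed (use C in \<open>auto simp: chain_between_def\<close>)
    qed
    moreover have "ideal (?E i) R \<and> K \<subseteq> ?E i \<and> ?E i \<subseteq> M" if i: "i \<le> k" for i
    proof (cases "i \<le> m")
      case True
      then show ?thesis using C LM unfolding chain_between_def by auto
    next
      case False
      then have "i - m \<le> n" using i k by simp
      then show ?thesis using D KL False unfolding chain_between_def by auto
    qed
    ultimately have "chain_between K M k ?E" unfolding chain_between_def by blast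
    then show "enat k \<le> len K M" by (rule len_ge)
  qed
qed

lemma len_pos:
  assumes "ideal K R" "ideal L R" "K \<subset> L"
  shows "1 \<le> len K L"
proof -
  have "chain_between K L 1 (\<lambda>i. if i = 0 then K else L)"
    unfolding chain_between_def using assms by auto
  then show ?thesis using len_ge by (metis one_enat_def)
qed

lemma len_self: "len K K = 0"
proof -
  have "n = 0" if "chain_between K K n C" for n C
    using that unfolding chain_between_def by (metis Suc_leI le_eq_less_or_eq not_gr_zero psubsetE subset_antisym)
  then have "len K K \<le> 0" unfolding len_def by (intro Sup_least) (auto simp: zero_enat_def)
  then show ?thesis by simp
qed

lemma len_eq_0_iff: "ideal K R \<Longrightarrow> ideal L R \<Longrightarrow> K \<subseteq> L \<Longrightarrow> len K L = 0 \<longleftrightarrow> K = L"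
  using len_pos[of K L] len_self by (metis not_one_le_zero psubsetI)

lemma len_maximalideal: "maximalideal M R \<Longrightarrow> len M (carrier R) = 1"
proof (rule antisym)
  assume M: "maximalideal M R"
  have "n \<le> 1" if C: "chain_between M (carrier R) n C" for n C
  proof (rule ccontr)
    assume "\<not> n \<le> 1"
    then have "C 0 \<subset> C 1" "C 1 \<subset> C 2" "M \<subseteq> C 0" "ideal (C 1) R" "C 2 \<subseteq> carrier R"
      using C unfolding chain_between_def by (auto simp: numeral_2_eq_2)
    then show False using maximalideal.I_maximal[OF M, of "C 1"] by blast
  qed
  then show "len M (carrier R) \<le> 1" unfolding len_def by (intro Sup_least) (auto simp: one_enat_def)
  show "1 \<le> len M (carrier R)"
    by (intro len_pos oneideal) (use M ideal_subset maximalideal.I_notcarr in \<open>auto simp: maximalideal_def\<close>)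
qed

text \<open>Multiplication by s induces R/(K : s) = (K + (s))/K. On ideals this isomorphism is given
  by the two strictly monotone maps J to (J : s) and J to K + J s.\<close>

lemma len_adjoin:
  assumes K: "ideal K R" and s: "s \<in> carrier R"
  shows "len K (K <+> PIdl s) = len (colon K s) (carrier R)"
proof (rule antisym)
  have cK: "ideal (colon K s) R" using K s by (rule colon_ideal)
  show "len K (K <+> PIdl s) \<le> len (colon K s) (carrier R)"
  proof (rule len_map[of _ _ "\<lambda>J. colon J s"])
    fix J J' assume J: "ideal J R" "ideal J' R" "K \<subseteq> J" "J' \<subseteq> K <+> PIdl s" "J \<subset> J'"
    then obtain x where x: "x \<in> J'" "x \<notin> J" by blast
    then obtain k r where kr: "k \<in> K" "r \<in> carrier R" "x = k \<oplus> r \<otimes> s"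
      using J(4) unfolding subset_iff mem_adjoin by blast
    have k: "k \<in> carrier R" using kr K ideal_carrD by blast
    have "r \<otimes> s \<oplus> k = x" using kr s k a_comm by simp
    then have "r \<in> colon J' s" 
      using ideal_diff_cancel[OF J(2), of "r \<otimes> s" k] x kr J s by (auto simp: mem_colon)
    moreover have "r \<notin> colon J s"
      using x kr J ideal_addD[OF J(1), of k "r \<otimes> s"] by (auto simp: mem_colon)
    ultimately show "colon J s \<subset> colon J' s" using J(5) colon_mono by blast
  qed (use K s adjoin_subset colon_ideal colon_mono in \<open>auto simp: mem_colon\<close>)
  show "len (colon K s) (carrier R) \<le> len K (K <+> PIdl s)"
  proof (rule len_map[OF cK, of _ "\<lambda>J. {k \<oplus> j \<otimes> s | k j. k \<in> K \<and> j \<in> J}"])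
    fix J assume J: "ideal J R"
    have id: "ideal {k \<oplus> j \<otimes> s | k j. k \<in> K \<and> j \<in> J} R"
    proof (rule ideal_criterion)
      fix a b assume "a \<in> {k \<oplus> j \<otimes> s | k j. k \<in> K \<and> j \<in> J}" "b \<in> {k \<oplus> j \<otimes> s | k j. k \<in> K \<and> j \<in> J}"
      then obtain k j k' j' where *: "k \<in> K" "j \<in> J" "a = k \<oplus> j \<otimes> s" "k' \<in> K" "j' \<in> J" "b = k' \<oplus> j' \<otimes> s"
        by blast
      have c: "k \<in> carrier R" "j \<in> carrier R" "k' \<in> carrier R" "j' \<in> carrier R" 
        using * ideal_carrD K J by blast+
      have "a \<oplus> b = (k \<oplus> k') \<oplus> (j \<oplus> j') \<otimes> s" unfolding * using c s by algebra
      then show "a \<oplus> b \<in> {k \<oplus> j \<otimes> s | k j. k \<in> K \<and> j \<in> J}"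
        using * ideal_addD[OF K, of k k'] ideal_addD[OF J, of j j'] by blast
    next
      fix a r assume "a \<in> {k \<oplus> j \<otimes> s | k j. k \<in> K \<and> j \<in> J}" and r: "r \<in> carrier R"
      then obtain k j where *: "k \<in> K" "j \<in> J" "a = k \<oplus> j \<otimes> s"
        by blast
      have c: "k \<in> carrier R" "j \<in> carrier R"
        using * ideal_carrD K J by blast+
      have "r \<otimes> a = (r \<otimes> k) \<oplus> (r \<otimes> j) \<otimes> s" unfolding * using c s r by algebra
      then show "r \<otimes> a \<in> {k \<oplus> j \<otimes> s | k j. k \<in> K \<and> j \<in> J}"
        using * ideal_lmultD[OF K, of k r] ideal_lmultD[OF J, of j r] r by blast
    next
      have "\<zero> = \<zero> \<oplus> \<zero> \<otimes> s" using s by simp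
      then show "\<zero> \<in> {k \<oplus> j \<otimes> s | k j. k \<in> K \<and> j \<in> J}" using ideal_zeroD K J by blast
    qed (use ideal_carrD K J s in auto)
    have "k \<in> {k \<oplus> j \<otimes> s | k j. k \<in> K \<and> j \<in> J}" if "k \<in> K" for k
    proof -
      have "k = k \<oplus> \<zero> \<otimes> s" using s that ideal_carrD[OF K] by simp
      then show ?thesis using that ideal_zeroD[OF J] by blast
    qed
    then show "ideal {k \<oplus> j \<otimes> s | k j. k \<in> K \<and> j \<in> J} R \<and> K \<subseteq> {k \<oplus> j \<otimes> s | k j. k \<in> K \<and> j \<in> J} 
        \<and> {k \<oplus> j \<otimes> s | k j. k \<in> K \<and> j \<in> J} \<subseteq> K <+> PIdl s"
      using id ideal_carrD[OF J] unfolding mem_adjoin subset_iff by blast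
  next
    fix J J' assume J: "ideal J R" "ideal J' R" "colon K s \<subseteq> J" "J' \<subseteq> carrier R" "J \<subset> J'"
    then obtain j where j: "j \<in> J'" "j \<notin> J" by blast
    have jc: "j \<in> carrier R" using j J by blast
    have "j \<otimes> s = \<zero> \<oplus> j \<otimes> s" using jc s by simp
    then have "j \<otimes> s \<in> {k \<oplus> j \<otimes> s | k j. k \<in> K \<and> j \<in> J'}" using j ideal_zeroD K by blast
    moreover have "j \<otimes> s \<noteq> k \<oplus> i \<otimes> s" if "k \<in> K" "i \<in> J" for k i
    proof
      assume eq: "j \<otimes> s = k \<oplus> i \<otimes> s"
      have c: "k \<in> carrier R" "i \<in> carrier R" using that K J(1) ideal_carrD by blast+
      have "(j \<ominus> i) \<otimes> s = j \<otimes> s \<ominus> i \<otimes> s" using c jc s by algebra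
      also have "\<dots> = k" unfolding eq using c s by algebra
      finally have "j \<ominus> i \<in> J" using that jc c J(3) by (auto simp: mem_colon)
      moreover have "j = (j \<ominus> i) \<oplus> i" using jc c by algebra
      ultimately show False using j that ideal_addD[OF J(1)] by metis
    qed
    ultimately show "{k \<oplus> j \<otimes> s | k j. k \<in> K \<and> j \<in> J} \<subset> {k \<oplus> j \<otimes> s | k j. k \<in> K \<and> j \<in> J'}"
      using J(5) by blast
  qed (auto simp: mem_colon)
qed

text \<open>As z is regular modulo L, every quotient (L + (z^i))/(L + (z^(i+1))) is a copy of R/(L +
  (z)).\<close>

lemma len_adjoin_power:
  assumes L: "ideal L R" and z: "z \<in> carrier R"
    and nzd: "\<And>a. a \<in> carrier R \<Longrightarrow> a \<otimes> z \<in> L \<Longrightarrow> a \<in> L"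
  shows "len (L <+> PIdl (z [^] n)) (carrier R) = enat n * len (L <+> PIdl z) (carrier R)"
proof (induct n)
  case 0
  have "L <+> PIdl \<one> = carrier R"
    using adjoin_ideal[OF L, of \<one>] adjoin_self[OF L, of \<one>] ideal_oneD by simp
  then show ?case by (simp add: len_self zero_enat_def[symmetric])
next
  case (Suc n)
  have powers: "a \<in> L" if "a \<in> carrier R" "a \<otimes> z [^] n \<in> L" for a and n :: nat
    using that
  proof (induct n arbitrary: a)
    case (Suc n)
    have "(a \<otimes> z [^] n) \<otimes> z \<in> L" using Suc(2,3) z by (simp add: m_assoc)
    then have "a \<otimes> z [^] n \<in> L" using nzd Suc(2) z by simp
    then show ?case using Suc by blast
  qed simp
  let ?K = "L <+> PIdl (z [^] Suc n)"
  have zn: "z [^] n \<in> carrier R" "z [^] Suc n \<in> carrier R" using z nat_pow_closed by blast+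
  have K: "ideal ?K R" using L zn by (simp add: adjoin_ideal del: nat_pow_Suc)
  have "z [^] Suc n \<in> L <+> PIdl (z [^] n)"
    using ideal_rmultD[OF adjoin_ideal adjoin_self, OF L zn(1) L zn(1) z] by simp
  then have sub: "?K \<subseteq> L <+> PIdl (z [^] n)"
    using L zn by (intro adjoin_least adjoin_ideal adjoin_subset)
  have KL: "?K <+> PIdl (z [^] n) = L <+> PIdl (z [^] n)"
  proof (rule subset_antisym)
    show "?K <+> PIdl (z [^] n) \<subseteq> L <+> PIdl (z [^] n)"
      by (rule adjoin_least[OF adjoin_ideal[OF L zn(1)] sub adjoin_self[OF L zn(1)]])
    show "L <+> PIdl (z [^] n) \<subseteq> ?K <+> PIdl (z [^] n)"
      using adjoin_subset[OF L zn(2)] by (intro set_add_mono) auto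
  qed
  have "colon ?K (z [^] n) = L <+> PIdl z"
  proof (intro subset_antisym subsetI)
    fix a assume "a \<in> colon ?K (z [^] n)"
    then obtain l r where a: "a \<in> carrier R" "l \<in> L" "r \<in> carrier R" 
      "a \<otimes> z [^] n = l \<oplus> r \<otimes> z [^] Suc n"
      unfolding mem_colon mem_adjoin by blast
    have l: "l \<in> carrier R" using a L ideal_carrD by blast
    have "(a \<ominus> r \<otimes> z) \<otimes> z [^] n = a \<otimes> z [^] n \<ominus> r \<otimes> (z [^] n \<otimes> z)"
      using a z zn(1) by algebra
    also have "\<dots> = l" unfolding a(4) nat_pow_Suc using l a(3) z zn(1) by algebra
    finally have "a \<ominus> r \<otimes> z \<in> L" using powers[of "a \<ominus> r \<otimes> z" n] a z by simp
    moreover have "a = (a \<ominus> r \<otimes> z) \<oplus> r \<otimes> z" using a z by algebra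
    ultimately show "a \<in> L <+> PIdl z" unfolding mem_adjoin using a by blast
  next
    fix a assume "a \<in> L <+> PIdl z"
    then obtain l r where a: "l \<in> L" "r \<in> carrier R" "a = l \<oplus> r \<otimes> z"
      unfolding mem_adjoin by blast
    have l: "l \<in> carrier R" using a L ideal_carrD by blast
    have "a \<otimes> z [^] n = l \<otimes> z [^] n \<oplus> r \<otimes> z [^] Suc n"
      unfolding a nat_pow_Suc using l a(2) z zn(1) by algebra
    moreover have "l \<otimes> z [^] n \<in> L" using a zn L ideal_rmultD by blast
    ultimately show "a \<in> colon ?K (z [^] n)"
      unfolding mem_colon mem_adjoin using a l z by blast
  qed
  then have "len ?K (L <+> PIdl (z [^] n)) = len (L <+> PIdl z) (carrier R)"
    using len_adjoin[OF K zn(1)] KL by simp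
  then have "len ?K (carrier R) = len (L <+> PIdl z) (carrier R) + enat n * len (L <+> PIdl z) (carrier R)"
    using len_add[OF K adjoin_ideal[OF L zn(1)] oneideal sub] Suc 
      ideal_subset[OF adjoin_ideal[OF L zn(1)]] by simp
  also have "\<dots> = enat (Suc n) * len (L <+> PIdl z) (carrier R)"
    by (simp add: eSuc_enat[symmetric] mult_eSuc)
  finally show ?case .
qed

end

section \<open>Socles and finite length over a local ring\<close>

context noetherian_local begin

text \<open>Take the least j with \<mm>^j L inside K. A product a b outside K with a in \<mm>^(j-1)
  and b in L is then killed by \<mm> modulo K.\<close>

lemma socle_element:
  assumes K: "ideal K R" and L: "ideal L R" and "K \<subset> L" and pow: "ideal_power R \<mm> n \<subseteq> K"
  obtains s where "s \<in> L" "s \<notin> K" "colon K s = \<mm>"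
proof -
  let ?P = "\<lambda>j. \<forall>a\<in>ideal_power R \<mm> j. \<forall>l\<in>L. a \<otimes> l \<in> K"
  have "?P n" using pow K L ideal_carrD ideal_rmultD by blast
  then obtain j where j: "?P j" "\<And>i. i < j \<Longrightarrow> \<not> ?P i" using exists_least_iff[of ?P] by auto
  obtain l where l: "l \<in> L" "l \<notin> K" using \<open>K \<subset> L\<close> by blast
  have "\<not> ?P 0" using l ideal_carrD[OF L] by (force simp: ideal_power_0)
  then obtain i where i: "j = Suc i" using j(1) not0_implies_Suc by metis
  then obtain a b where ab: "a \<in> ideal_power R \<mm> i" "b \<in> L" "a \<otimes> b \<notin> K" using j(2)[of i] by auto
  have c: "a \<in> carrier R" "b \<in> carrier R" 
    using ab L ideal_carrD ideal_power_ideal[OF \<mm>_ideal] by blast+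
  have cK: "ideal (colon K (a \<otimes> b)) R" using K c by (simp add: colon_ideal)
  have "y \<in> colon K (a \<otimes> b)" if y: "y \<in> \<mm>" for y
  proof -
    have "a \<otimes> y \<in> ideal_power R \<mm> j" using i y ab by (simp add: ideal_power_Suc ideal_prodI)
    then have "(a \<otimes> y) \<otimes> b \<in> K" using j(1) ab by blast
    moreover have "y \<in> carrier R" using y \<mm>_ideal ideal_carrD by blast
    moreover have "(a \<otimes> y) \<otimes> b = y \<otimes> (a \<otimes> b)" using calculation c by algebra
    ultimately show ?thesis by (simp add: mem_colon)
  qed
  then have "\<mm> \<subseteq> colon K (a \<otimes> b)" by blast
  moreover have "colon K (a \<otimes> b) \<subseteq> \<mm>"
    using ab c K cK by (intro ideal_le_\<mm>) (auto simp: colon_eq_carrier)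
  ultimately have "colon K (a \<otimes> b) = \<mm>" by blast
  moreover have "a \<otimes> b \<in> L" using ab c L by (simp add: ideal_lmultD)
  ultimately show ?thesis using that ab by blast
qed

lemma len_adjoin_socle:
  "ideal K R \<Longrightarrow> s \<in> carrier R \<Longrightarrow> colon K s = \<mm> \<Longrightarrow> len K (K <+> PIdl s) = 1"
  using len_adjoin len_maximalideal maximal by simp

text \<open>Adjoining a socle element raises the ideal by length one, and Noetherian induction
  reaches the unit ideal.\<close>

lemma len_finite:
  assumes "ideal K R" "ideal_power R \<mm> n \<subseteq> K"
  shows "len K (carrier R) \<noteq> \<infinity>"
  using assms
proof (induct rule: noetherian_induct)
  case (step K)
  show ?case
  proof (cases "K = carrier R")
    case False
    then have "K \<subset> carrier R" using step(1) ideal_subset by blast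
    then obtain s where s: "s \<in> carrier R" "s \<notin> K" "colon K s = \<mm>"
      using socle_element[OF step(1) oneideal _ step(3)] by blast
    have sub: "K \<subset> K <+> PIdl s" using s step(1) adjoin_subset adjoin_self by blast
    have id: "ideal (K <+> PIdl s) R" using s step(1) adjoin_ideal by blast
    have "len (K <+> PIdl s) (carrier R) \<noteq> \<infinity>" using step(2)[OF id sub] step(3) sub by blast
    then show ?thesis
      using len_add[OF step(1) id oneideal] sub ideal_subset[OF id] len_adjoin_socle[OF step(1) s(1,3)]
      by (cases "len (K <+> PIdl s) (carrier R)") (auto simp: one_enat_def)
  qed (simp add: len_self)
qed

end

section \<open>Localization at a prime ideal\<close>

locale localization_at_prime = cring +
  fixes P assumes P_prime: "primeideal P R"
begin

abbreviation "S \<equiv> carrier R - P"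
abbreviation "A \<equiv> local_at R P"
abbreviation "fr \<equiv> fraction R S"
abbreviation "\<iota> \<equiv> \<lambda>a. fraction R S a \<one>"

lemma S_one: "\<one> \<in> S" and S_mult: "s \<in> S \<Longrightarrow> t \<in> S \<Longrightarrow> s \<otimes> t \<in> S" and S_carr: "s \<in> S \<Longrightarrow> s \<in> carrier R"
  using prime_one[OF P_prime] primeD[OF P_prime] by auto

lemma frac_relI:
  assumes "a \<in> carrier R" "s \<in> S" "b \<in> carrier R" "t \<in> S" "u \<in> S" "u \<otimes> (a \<otimes> t) = u \<otimes> (b \<otimes> s)"
  shows "((a, s), (b, t)) \<in> frac_rel R S"
  unfolding frac_rel_def using assms by blast

lemma frac_relE:
  assumes "((a, s), (b, t)) \<in> frac_rel R S"
  obtains u where "a \<in> carrier R" "s \<in> S" "b \<in> carrier R" "t \<in> S" "u \<in> S" "u \<otimes> (a \<otimes> t) = u \<otimes> (b \<otimes> s)"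
  using assms unfolding frac_rel_def by blast

lemma equiv_frac_rel: "equiv (carrier R \<times> S) (frac_rel R S)"
proof (rule equivI)
  show "frac_rel R S \<subseteq> (carrier R \<times> S) \<times> (carrier R \<times> S)" by (auto simp: frac_rel_def)
  show "refl_on (carrier R \<times> S) (frac_rel R S)"
    by (rule refl_onI) (use S_one in \<open>auto intro!: frac_relI[of _ _ _ _ \<one>]\<close>)
  show "sym (frac_rel R S)"
  proof (rule symI, clarsimp simp del: Diff_iff)
    fix a s b t assume "((a, s), b, t) \<in> frac_rel R S"
    then obtain u where "a \<in> carrier R" "s \<in> S" "b \<in> carrier R" "t \<in> S" "u \<in> S" "u \<otimes> (a \<otimes> t) = u \<otimes> (b \<otimes> s)"
      by (rule frac_relE)
    then show "((b, t), a, s) \<in> frac_rel R S" by (intro frac_relI[of _ _ _ _ u]) auto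
  qed
  show "trans (frac_rel R S)"
  proof (rule transI, clarsimp simp del: Diff_iff)
    fix a s b t c w assume "((a, s), b, t) \<in> frac_rel R S" "((b, t), c, w) \<in> frac_rel R S"
    then obtain u v where 1: "a \<in> carrier R" "s \<in> S" "b \<in> carrier R" "t \<in> S" "u \<in> S" "u \<otimes> (a \<otimes> t) = u \<otimes> (b \<otimes> s)"
      and 2: "c \<in> carrier R" "w \<in> S" "v \<in> S" "v \<otimes> (b \<otimes> w) = v \<otimes> (c \<otimes> t)"
      by (elim frac_relE)
    have c: "s \<in> carrier R" "t \<in> carrier R" "u \<in> carrier R" "v \<in> carrier R" "w \<in> carrier R"
      using 1 2 by auto
    \<comment> \<open>The middle denominator t enters the multiplier because it cannot be cancelled
      in a ring with zero divisors.\<close>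
    have "(u \<otimes> v \<otimes> t) \<otimes> (a \<otimes> w) = (v \<otimes> w) \<otimes> (u \<otimes> (a \<otimes> t))" using 1(1) c by algebra
    also have "\<dots> = (u \<otimes> s) \<otimes> (v \<otimes> (b \<otimes> w))" unfolding 1(6) using 1(3) c by algebra
    also have "\<dots> = (u \<otimes> v \<otimes> t) \<otimes> (c \<otimes> s)" unfolding 2(4) using 2(1) c by algebra
    finally show "((a, s), c, w) \<in> frac_rel R S"
      using 1 2 by (intro frac_relI[of _ _ _ _ "u \<otimes> v \<otimes> t"] S_mult)
  qed
qed

lemma fr_eq_iff:
  assumes "a \<in> carrier R" "s \<in> S" "b \<in> carrier R" "t \<in> S"
  shows "fr a s = fr b t \<longleftrightarrow> (\<exists>u\<in>S. u \<otimes> (a \<otimes> t) = u \<otimes> (b \<otimes> s))"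
proof -
  have "fr a s = fr b t \<longleftrightarrow> ((a, s), (b, t)) \<in> frac_rel R S"
    unfolding fraction_def using eq_equiv_class_iff[OF equiv_frac_rel] assms by simp
  then show ?thesis using assms by (auto simp: frac_rel_def)
qed

lemma fr_eqI: "a \<in> carrier R \<Longrightarrow> s \<in> S \<Longrightarrow> b \<in> carrier R \<Longrightarrow> t \<in> S \<Longrightarrow> a \<otimes> t = b \<otimes> s \<Longrightarrow> fr a s = fr b t"
  using fr_eq_iff S_one by auto

lemma carrier_A: "carrier A = {fr a s | a s. a \<in> carrier R \<and> s \<in> S}"
  by (auto simp: local_at_def localization_def quotient_def fraction_def)

lemma fr_closed: "a \<in> carrier R \<Longrightarrow> s \<in> S \<Longrightarrow> fr a s \<in> carrier A"
  unfolding carrier_A by blast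

lemma fr_cases:
  assumes "x \<in> carrier A"
  obtains a s where "a \<in> carrier R" "s \<in> S" "x = fr a s"
  using assms unfolding carrier_A by blast

lemma mem_fr: "(b, t) \<in> fr a s \<longleftrightarrow> ((a, s), (b, t)) \<in> frac_rel R S"
  by (simp add: fraction_def)

text \<open>The operations of \<open>localization\<close> collect the results for all
  representatives. As these are equivalent to one another, the image is a single class, which is
  what well-definedness means here.\<close>

lemma class_collapse:
  assumes "x \<in> Y" "Y \<subseteq> frac_rel R S `` {x}"
  shows "frac_rel R S `` Y = frac_rel R S `` {x}"
  using assms equiv_frac_rel unfolding equiv_def trans_def by blast

lemma fr_self: "a \<in> carrier R \<Longrightarrow> s \<in> S \<Longrightarrow> (a, s) \<in> fr a s"
  unfolding mem_fr by (rule frac_relI[of _ _ _ _ \<one>]) (use S_one in auto)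

lemma mult_fr:
  assumes a: "a \<in> carrier R" "s \<in> S" and b: "b \<in> carrier R" "t \<in> S"
  shows "fr a s \<otimes>\<^bsub>A\<^esub> fr b t = fr (a \<otimes> b) (s \<otimes> t)"
proof -
  have "fr a s \<otimes>\<^bsub>A\<^esub> fr b t = frac_rel R S `` {(a' \<otimes> b', s' \<otimes> t') | a' b' s' t'. (a', s') \<in> fr a s \<and> (b', t') \<in> fr b t}"
    by (simp add: local_at_def localization_def)
  also have "\<dots> = frac_rel R S `` {(a \<otimes> b, s \<otimes> t)}"
  proof (rule class_collapse)
    show "(a \<otimes> b, s \<otimes> t) \<in> {(a' \<otimes> b', s' \<otimes> t') | a' b' s' t'. (a', s') \<in> fr a s \<and> (b', t') \<in> fr b t}"
      using fr_self[OF a] fr_self[OF b] by blast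
    show "{(a' \<otimes> b', s' \<otimes> t') | a' b' s' t'. (a', s') \<in> fr a s \<and> (b', t') \<in> fr b t} \<subseteq> frac_rel R S `` {(a \<otimes> b, s \<otimes> t)}"
    proof
      fix z assume "z \<in> {(a' \<otimes> b', s' \<otimes> t') | a' b' s' t'. (a', s') \<in> fr a s \<and> (b', t') \<in> fr b t}"
      then obtain a' s' b' t' where z: "z = (a' \<otimes> b', s' \<otimes> t')" and "(a', s') \<in> fr a s" "(b', t') \<in> fr b t"
        by blast
      then obtain u v where 1: "a' \<in> carrier R" "s' \<in> S" "u \<in> S" "u \<otimes> (a \<otimes> s') = u \<otimes> (a' \<otimes> s)"
        and 2: "b' \<in> carrier R" "t' \<in> S" "v \<in> S" "v \<otimes> (b \<otimes> t') = v \<otimes> (b' \<otimes> t)"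
        unfolding mem_fr by (elim frac_relE)
      have c: "s \<in> carrier R" "t \<in> carrier R" "s' \<in> carrier R" "t' \<in> carrier R" "u \<in> carrier R" "v \<in> carrier R"
        using 1 2 a b by auto
      have "(u \<otimes> v) \<otimes> ((a \<otimes> b) \<otimes> (s' \<otimes> t')) = (u \<otimes> (a \<otimes> s')) \<otimes> (v \<otimes> (b \<otimes> t'))"
        using a(1) b(1) c by algebra
      also have "\<dots> = (u \<otimes> v) \<otimes> ((a' \<otimes> b') \<otimes> (s \<otimes> t))"
        unfolding 1(4) 2(4) using 1(1) 2(1) c by algebra
      finally have "((a \<otimes> b, s \<otimes> t), (a' \<otimes> b', s' \<otimes> t')) \<in> frac_rel R S"
        using 1 2 a b by (intro frac_relI[of _ _ _ _ "u \<otimes> v"] S_mult m_closed)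
      then show "z \<in> frac_rel R S `` {(a \<otimes> b, s \<otimes> t)}" unfolding z by blast
    qed
  qed
  finally show ?thesis by (simp add: fraction_def)
qed

lemma add_fr:
  assumes a: "a \<in> carrier R" "s \<in> S" and b: "b \<in> carrier R" "t \<in> S"
  shows "fr a s \<oplus>\<^bsub>A\<^esub> fr b t = fr (a \<otimes> t \<oplus> b \<otimes> s) (s \<otimes> t)"
proof -
  have "fr a s \<oplus>\<^bsub>A\<^esub> fr b t = frac_rel R S `` {(a' \<otimes> t' \<oplus> b' \<otimes> s', s' \<otimes> t') | a' b' s' t'. (a', s') \<in> fr a s \<and> (b', t') \<in> fr b t}"
    by (simp add: local_at_def localization_def)
  also have "\<dots> = frac_rel R S `` {(a \<otimes> t \<oplus> b \<otimes> s, s \<otimes> t)}"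
  proof (rule class_collapse)
    show "(a \<otimes> t \<oplus> b \<otimes> s, s \<otimes> t) \<in> {(a' \<otimes> t' \<oplus> b' \<otimes> s', s' \<otimes> t') | a' b' s' t'. (a', s') \<in> fr a s \<and> (b', t') \<in> fr b t}"
      using fr_self[OF a] fr_self[OF b] by blast
    show "{(a' \<otimes> t' \<oplus> b' \<otimes> s', s' \<otimes> t') | a' b' s' t'. (a', s') \<in> fr a s \<and> (b', t') \<in> fr b t} 
        \<subseteq> frac_rel R S `` {(a \<otimes> t \<oplus> b \<otimes> s, s \<otimes> t)}"
    proof
      fix z assume "z \<in> {(a' \<otimes> t' \<oplus> b' \<otimes> s', s' \<otimes> t') | a' b' s' t'. (a', s') \<in> fr a s \<and> (b', t') \<in> fr b t}"
      then obtain a' s' b' t' where z: "z = (a' \<otimes> t' \<oplus> b' \<otimes> s', s' \<otimes> t')" and "(a', s') \<in> fr a s" "(b', t') \<in> fr b t"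
        by blast
      then obtain u v where 1: "a' \<in> carrier R" "s' \<in> S" "u \<in> S" "u \<otimes> (a \<otimes> s') = u \<otimes> (a' \<otimes> s)"
        and 2: "b' \<in> carrier R" "t' \<in> S" "v \<in> S" "v \<otimes> (b \<otimes> t') = v \<otimes> (b' \<otimes> t)"
        unfolding mem_fr by (elim frac_relE)
      have c: "s \<in> carrier R" "t \<in> carrier R" "s' \<in> carrier R" "t' \<in> carrier R" "u \<in> carrier R" "v \<in> carrier R"
        using 1 2 a b by auto
      have "(u \<otimes> v) \<otimes> ((a \<otimes> t \<oplus> b \<otimes> s) \<otimes> (s' \<otimes> t')) 
          = (v \<otimes> t \<otimes> t') \<otimes> (u \<otimes> (a \<otimes> s')) \<oplus> (u \<otimes> s \<otimes> s') \<otimes> (v \<otimes> (b \<otimes> t'))"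
        using a(1) b(1) c by algebra
      also have "\<dots> = (u \<otimes> v) \<otimes> ((a' \<otimes> t' \<oplus> b' \<otimes> s') \<otimes> (s \<otimes> t))"
        unfolding 1(4) 2(4) using 1(1) 2(1) c by algebra
      finally have "((a \<otimes> t \<oplus> b \<otimes> s, s \<otimes> t), (a' \<otimes> t' \<oplus> b' \<otimes> s', s' \<otimes> t')) \<in> frac_rel R S"
        using 1 2 a b c by (intro frac_relI[of _ _ _ _ "u \<otimes> v"] S_mult m_closed a_closed)
      then show "z \<in> frac_rel R S `` {(a \<otimes> t \<oplus> b \<otimes> s, s \<otimes> t)}" unfolding z by blast
    qed
  qed
  finally show ?thesis by (simp add: fraction_def)
qed

lemma one_A: "\<one>\<^bsub>A\<^esub> = fr \<one> \<one>" and zero_A: "\<zero>\<^bsub>A\<^esub> = fr \<zero> \<one>"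
  by (simp_all add: local_at_def localization_def)

lemma A_cring: "cring A"
proof (intro cringI abelian_groupI comm_monoidI)
  note S_one[simp, intro] S_mult[simp, intro]
  have sc: "s \<in> carrier R" if "s \<in> S" for s using that by simp
  show "x \<oplus>\<^bsub>A\<^esub> y \<in> carrier A" if "x \<in> carrier A" "y \<in> carrier A" for x y
    using that by (elim fr_cases) (simp add: add_fr fr_closed S_carr del: Diff_iff)
  show "x \<otimes>\<^bsub>A\<^esub> y \<in> carrier A" if "x \<in> carrier A" "y \<in> carrier A" for x y
    using that by (elim fr_cases) (simp add: mult_fr fr_closed S_carr del: Diff_iff)
  show "\<zero>\<^bsub>A\<^esub> \<in> carrier A" "\<one>\<^bsub>A\<^esub> \<in> carrier A" by (simp_all add: one_A zero_A fr_closed del: Diff_iff)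
  fix x y assume "x \<in> carrier A" "y \<in> carrier A"
  then obtain a s b t where x: "a \<in> carrier R" "s \<in> S" "x = fr a s" and y: "b \<in> carrier R" "t \<in> S" "y = fr b t"
    by (elim fr_cases)
  note c = x(1) y(1) x(2)[THEN sc] y(2)[THEN sc]
  have "b \<otimes> s \<oplus> a \<otimes> t = a \<otimes> t \<oplus> b \<otimes> s" using c by algebra
  then show "x \<oplus>\<^bsub>A\<^esub> y = y \<oplus>\<^bsub>A\<^esub> x" using x y c m_comm[of s t] by (simp add: add_fr del: Diff_iff)
  show "x \<otimes>\<^bsub>A\<^esub> y = y \<otimes>\<^bsub>A\<^esub> x" using x y c m_comm[of s t] m_comm[of a b] by (simp add: mult_fr del: Diff_iff)
  show "\<zero>\<^bsub>A\<^esub> \<oplus>\<^bsub>A\<^esub> x = x" "\<one>\<^bsub>A\<^esub> \<otimes>\<^bsub>A\<^esub> x = x"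
    using x c by (simp_all add: zero_A one_A add_fr mult_fr del: Diff_iff)
  show "\<exists>y\<in>carrier A. y \<oplus>\<^bsub>A\<^esub> x = \<zero>\<^bsub>A\<^esub>"
  proof
    have "\<ominus> a \<otimes> s \<oplus> a \<otimes> s = \<zero>" using c by algebra
    then have "fr (\<ominus> a) s \<oplus>\<^bsub>A\<^esub> x = fr \<zero> (s \<otimes> s)" using x c by (simp add: add_fr del: Diff_iff)
    also have "\<dots> = fr \<zero> \<one>" using x c by (intro fr_eqI) (simp_all del: Diff_iff)
    finally show "fr (\<ominus> a) s \<oplus>\<^bsub>A\<^esub> x = \<zero>\<^bsub>A\<^esub>" by (simp add: zero_A)
    show "fr (\<ominus> a) s \<in> carrier A" using x by (intro fr_closed) auto
  qed
  fix z assume "z \<in> carrier A"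
  then obtain d w where z: "d \<in> carrier R" "w \<in> S" "z = fr d w"
    by (elim fr_cases)
  note c = c z(1) z(2)[THEN sc]
  have "(a \<otimes> t \<oplus> b \<otimes> s) \<otimes> w \<oplus> d \<otimes> (s \<otimes> t) = a \<otimes> (t \<otimes> w) \<oplus> (b \<otimes> w \<oplus> d \<otimes> t) \<otimes> s"
    "s \<otimes> t \<otimes> w = s \<otimes> (t \<otimes> w)"
    using c by algebra+
  then show "x \<oplus>\<^bsub>A\<^esub> y \<oplus>\<^bsub>A\<^esub> z = x \<oplus>\<^bsub>A\<^esub> (y \<oplus>\<^bsub>A\<^esub> z)"
    using x y z c by (simp add: add_fr del: Diff_iff)
  show "x \<otimes>\<^bsub>A\<^esub> y \<otimes>\<^bsub>A\<^esub> z = x \<otimes>\<^bsub>A\<^esub> (y \<otimes>\<^bsub>A\<^esub> z)"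
    using x y z c by (simp add: mult_fr m_assoc del: Diff_iff)
  have "fr ((a \<otimes> t \<oplus> b \<otimes> s) \<otimes> d) (s \<otimes> t \<otimes> w) = fr ((a \<otimes> d) \<otimes> (t \<otimes> w) \<oplus> (b \<otimes> d) \<otimes> (s \<otimes> w)) ((s \<otimes> w) \<otimes> (t \<otimes> w))"
  proof (rule fr_eqI)
    show "(a \<otimes> t \<oplus> b \<otimes> s) \<otimes> d \<otimes> (s \<otimes> w \<otimes> (t \<otimes> w)) =
       (a \<otimes> d \<otimes> (t \<otimes> w) \<oplus> b \<otimes> d \<otimes> (s \<otimes> w)) \<otimes> (s \<otimes> t \<otimes> w)" using c by algebra
  qed (use c x y z in \<open>auto simp del: Diff_iff\<close>)
  then show "(x \<oplus>\<^bsub>A\<^esub> y) \<otimes>\<^bsub>A\<^esub> z = x \<otimes>\<^bsub>A\<^esub> z \<oplus>\<^bsub>A\<^esub> y \<otimes>\<^bsub>A\<^esub> z"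
    using x y z c by (simp add: add_fr mult_fr del: Diff_iff)
qed

sublocale A: cring A by (rule A_cring)

lemma \<iota>_closed: "a \<in> carrier R \<Longrightarrow> \<iota> a \<in> carrier A"
  using S_one by (rule fr_closed[rotated])

lemma \<iota>_hom: "\<iota> \<in> ring_hom R A"
  using S_one fr_closed by (intro ring_hom_memI) (simp_all add: mult_fr add_fr one_A del: Diff_iff)

lemma \<iota>_add: "a \<in> carrier R \<Longrightarrow> b \<in> carrier R \<Longrightarrow> \<iota> (a \<oplus> b) = \<iota> a \<oplus>\<^bsub>A\<^esub> \<iota> b"
  and \<iota>_mult: "a \<in> carrier R \<Longrightarrow> b \<in> carrier R \<Longrightarrow> \<iota> (a \<otimes> b) = \<iota> a \<otimes>\<^bsub>A\<^esub> \<iota> b"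
  by (simp_all add: ring_hom_add[OF \<iota>_hom] ring_hom_mult[OF \<iota>_hom])

lemma \<iota>_pow: "a \<in> carrier R \<Longrightarrow> \<iota> (a [^] (n::nat)) = \<iota> a [^]\<^bsub>A\<^esub> n"
  by (induct n) (simp_all add: \<iota>_mult one_A)

lemma fr_eq_mult: "a \<in> carrier R \<Longrightarrow> s \<in> S \<Longrightarrow> fr a s = fr \<one> s \<otimes>\<^bsub>A\<^esub> \<iota> a"
  using S_one by (subst mult_fr) auto

lemma \<iota>_unit: "s \<in> S \<Longrightarrow> fr \<one> s \<otimes>\<^bsub>A\<^esub> \<iota> s = \<one>\<^bsub>A\<^esub>"
  using S_one S_carr[of s] fr_eqI[of s s \<one> \<one>] by (subst mult_fr) (simp_all add: one_A del: Diff_iff)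

lemma fr_mult_cancel: "a \<in> carrier R \<Longrightarrow> s \<in> S \<Longrightarrow> fr a s \<otimes>\<^bsub>A\<^esub> \<iota> s = \<iota> a"
  using S_one S_carr[of s] fr_eqI[of "a \<otimes> s" s a \<one>] by (subst mult_fr) (simp_all del: Diff_iff)

section \<open>Extension and contraction of ideals\<close>

definition ext :: "'a set \<Rightarrow> ('a \<times> 'a) set set" where "ext J = Idl\<^bsub>A\<^esub> (\<iota> ` J)"

definition contr :: "('a \<times> 'a) set set \<Rightarrow> 'a set" where "contr Q = {x \<in> carrier R. \<iota> x \<in> Q}"

lemma ext_ideal: "J \<subseteq> carrier R \<Longrightarrow> ideal (ext J) A"
  unfolding ext_def using \<iota>_closed by (intro A.genideal_ideal) blast

lemma \<iota>_in_ext: "J \<subseteq> carrier R \<Longrightarrow> x \<in> J \<Longrightarrow> \<iota> x \<in> ext J"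
  unfolding ext_def using \<iota>_closed by (intro subsetD[OF A.genideal_self]) blast+

lemma ext_least: "ideal Q A \<Longrightarrow> (\<And>x. x \<in> J \<Longrightarrow> \<iota> x \<in> Q) \<Longrightarrow> ext J \<subseteq> Q"
  unfolding ext_def by (intro A.genideal_minimal) blast+

lemma ext_eq: 
  assumes J: "ideal J R"
  shows "ext J = {fr a s | a s. a \<in> J \<and> s \<in> S}" (is "_ = ?E")
proof
  have Jc: "J \<subseteq> carrier R" using J by (rule ideal_subset)
  show "?E \<subseteq> ext J"
  proof clarify
    fix a s assume "a \<in> J" "s \<in> carrier R" "s \<notin> P"
    then show "fr a s \<in> ext J"
      using Jc fr_eq_mult[of a s] A.ideal_lmultD[OF ext_ideal[OF Jc] \<iota>_in_ext[OF Jc]] fr_closed[of \<one> s] by auto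
  qed
  have "ideal ?E A"
  proof (rule A.ideal_criterion)
    show "?E \<subseteq> carrier A" using Jc fr_closed by blast
    show "\<zero>\<^bsub>A\<^esub> \<in> ?E" unfolding zero_A using ideal_zeroD[OF J] S_one by blast
  next
    fix x y assume "x \<in> ?E" "y \<in> ?E"
    then obtain a s b t where x: "a \<in> J" "s \<in> S" "x = fr a s" and y: "b \<in> J" "t \<in> S" "y = fr b t" by blast
    have "a \<otimes> t \<oplus> b \<otimes> s \<in> J" using x y J by (auto intro!: ideal_addD[OF J] ideal_rmultD[OF J])
    moreover have "x \<oplus>\<^bsub>A\<^esub> y = fr (a \<otimes> t \<oplus> b \<otimes> s) (s \<otimes> t)" unfolding x y
      using x y Jc by (intro add_fr) auto
    ultimately show "x \<oplus>\<^bsub>A\<^esub> y \<in> ?E" using S_mult[OF x(2) y(2)] by blast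
  next
    fix x r assume "x \<in> ?E" "r \<in> carrier A"
    then obtain a s b t where x: "a \<in> J" "s \<in> S" "x = fr a s" and r: "b \<in> carrier R" "t \<in> S" "r = fr b t" 
      by (blast elim: fr_cases)
    have "r \<otimes>\<^bsub>A\<^esub> x = fr (b \<otimes> a) (t \<otimes> s)" unfolding x r using x r Jc by (intro mult_fr) auto
    then show "r \<otimes>\<^bsub>A\<^esub> x \<in> ?E" using S_mult[OF r(2) x(2)] ideal_lmultD[OF J x(1) r(1)] by blast
  qed
  then show "ext J \<subseteq> ?E" by (rule ext_least) (use S_one in blast)
qed

text \<open>Clearing denominators; through it, symbolic powers are described by multipliers inside
  R.\<close>

lemma \<iota>_in_ext_iff:
  assumes J: "ideal J R" and x: "x \<in> carrier R"
  shows "\<iota> x \<in> ext J \<longleftrightarrow> (\<exists>u\<in>S. u \<otimes> x \<in> J)"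
proof
  assume "\<iota> x \<in> ext J"
  then obtain a s where a: "a \<in> J" "s \<in> S" "\<iota> x = fr a s" unfolding ext_eq[OF J] by blast
  have ac: "a \<in> carrier R" "s \<in> carrier R" using a J ideal_carrD by auto
  obtain u where u: "u \<in> S" "u \<otimes> (x \<otimes> s) = u \<otimes> (a \<otimes> \<one>)"
    using fr_eq_iff[OF x S_one ac(1) a(2)] a(3) by blast
  have uc: "u \<in> carrier R" using u by simp
  have "(u \<otimes> s) \<otimes> x = u \<otimes> (x \<otimes> s)" using uc ac x by algebra
  then have "(u \<otimes> s) \<otimes> x \<in> J" using u a ac uc ideal_lmultD[OF J] by simp
  then show "\<exists>u\<in>S. u \<otimes> x \<in> J" using S_mult[OF u(1) a(2)] by blast
next
  assume "\<exists>u\<in>S. u \<otimes> x \<in> J"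
  then obtain u where u: "u \<in> S" "u \<otimes> x \<in> J" by blast
  have "\<iota> x = fr (u \<otimes> x) u" using u x S_one by (intro fr_eqI) (auto simp: m_comm)
  then show "\<iota> x \<in> ext J" unfolding ext_eq[OF J] using u by blast
qed

lemma loc_contract_iff: "ideal J R \<Longrightarrow> x \<in> loc_contract R P J \<longleftrightarrow> x \<in> carrier R \<and> (\<exists>u\<in>S. u \<otimes> x \<in> J)"
  unfolding loc_contract_def ext_def[symmetric] using \<iota>_in_ext_iff by blast

lemma contr_ideal: "ideal Q A \<Longrightarrow> ideal (contr Q) R"
proof (rule ideal_criterion)
  assume Q: "ideal Q A"
  show "\<zero> \<in> contr Q" using A.ideal_zeroD[OF Q] by (simp add: contr_def zero_A)
qed (auto simp: contr_def \<iota>_add \<iota>_mult A.ideal_addD A.ideal_lmultD \<iota>_closed)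

text \<open>An ideal of R_P is generated by its numerators, since a/s times s is a. Hence
  contraction is injective on ideals, which transfers strict chains and finite generation.\<close>

lemma ext_contr:
  assumes Q: "ideal Q A"
  shows "ext (contr Q) = Q"
proof
  show "ext (contr Q) \<subseteq> Q" using Q by (rule ext_least) (simp add: contr_def)
  show "Q \<subseteq> ext (contr Q)"
  proof
    fix x assume x: "x \<in> Q"
    then have "x \<in> carrier A" using Q A.ideal_carrD by blast
    then obtain a s where a: "a \<in> carrier R" "s \<in> S" "x = fr a s" by (rule fr_cases)
    have "\<iota> a \<in> Q" using fr_mult_cancel[OF a(1,2)] A.ideal_rmultD[OF Q x \<iota>_closed[OF S_carr[OF a(2)]]] a(3) by simp
    then have "a \<in> contr Q" using a by (simp add: contr_def)
    then show "x \<in> ext (contr Q)" unfolding ext_eq[OF contr_ideal[OF Q]] using a by blast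
  qed
qed

lemma contr_mono: "Q \<subseteq> Q' \<Longrightarrow> contr Q \<subseteq> contr Q'"
  by (auto simp: contr_def)

lemma contr_strict: "ideal Q A \<Longrightarrow> ideal Q' A \<Longrightarrow> Q \<subset> Q' \<Longrightarrow> contr Q \<subset> contr Q'"
  using contr_mono[of Q Q'] ext_contr by (metis psubset_eq)

lemma contr_prime:
  assumes Q: "primeideal Q A"
  shows "primeideal (contr Q) R"
proof (rule primeidealI)
  have Qi: "ideal Q A" using Q by (rule A.prime_ideal)
  show "ideal (contr Q) R" using Qi by (rule contr_ideal)
  show "cring R" by (rule is_cring)
  show "carrier R \<noteq> contr Q"
    using A.prime_one[OF Q] one_A by (auto simp: contr_def)
  fix a b assume "a \<in> carrier R" "b \<in> carrier R" "a \<otimes> b \<in> contr Q"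
  then show "a \<in> contr Q \<or> b \<in> contr Q"
    using A.primeD[OF Q, of "\<iota> a" "\<iota> b"] by (auto simp: contr_def \<iota>_mult \<iota>_closed)
qed

lemma proper_disjoint:
  assumes Q: "ideal Q A" "Q \<noteq> carrier A"
  shows "contr Q \<subseteq> P"
proof
  fix x assume x: "x \<in> contr Q"
  show "x \<in> P"
  proof (rule ccontr)
    assume "x \<notin> P"
    then have "x \<in> S" using x by (auto simp: contr_def)
    then have "\<one>\<^bsub>A\<^esub> \<in> Q" using A.ideal_lmultD[OF Q(1), of "\<iota> x" "fr \<one> x"] \<iota>_unit[of x] x fr_closed[of \<one> x]
      by (auto simp: contr_def)
    then show False using Q A.ideal_oneD by blast
  qed
qed

lemma contr_ext_prime:
  assumes Q: "primeideal Q R" "Q \<subseteq> P"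
  shows "contr (ext Q) = Q"
proof
  note Qi = prime_ideal[OF Q(1)]
  show "Q \<subseteq> contr (ext Q)" using \<iota>_in_ext[OF ideal_subset[OF Qi]] ideal_carrD[OF Qi] by (auto simp: contr_def)
  show "contr (ext Q) \<subseteq> Q"
  proof
    fix x assume "x \<in> contr (ext Q)"
    then obtain u where "x \<in> carrier R" "u \<in> S" "u \<otimes> x \<in> Q" using \<iota>_in_ext_iff[OF Qi] by (auto simp: contr_def)
    then show "x \<in> Q" using primeD[OF Q(1), of u x] Q(2) by auto
  qed
qed

lemma ext_prime:
  assumes Q: "primeideal Q R" "Q \<subseteq> P"
  shows "primeideal (ext Q) A"
proof (rule primeidealI)
  note Qi = prime_ideal[OF Q(1)]
  show id: "ideal (ext Q) A" using Qi ideal_subset ext_ideal by blast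
  show "cring A" by (rule A_cring)
  show "carrier A \<noteq> ext Q"
  proof
    assume "carrier A = ext Q"
    then have "\<one> \<in> contr (ext Q)" using \<iota>_closed by (auto simp: contr_def)
    then show False using contr_ext_prime[OF Q] prime_one[OF Q(1)] by simp
  qed
  fix x y assume "x \<in> carrier A" "y \<in> carrier A" and xy: "x \<otimes>\<^bsub>A\<^esub> y \<in> ext Q"
  then obtain a s b t where x: "a \<in> carrier R" "s \<in> S" "x = fr a s" and y: "b \<in> carrier R" "t \<in> S" "y = fr b t" 
    by (elim fr_cases)
  have "\<iota> (a \<otimes> b) = fr (a \<otimes> b) (s \<otimes> t) \<otimes>\<^bsub>A\<^esub> \<iota> (s \<otimes> t)"
    using x y S_mult by (intro fr_mult_cancel[symmetric]) blast+
  also have "\<dots> = (x \<otimes>\<^bsub>A\<^esub> y) \<otimes>\<^bsub>A\<^esub> \<iota> (s \<otimes> t)" using mult_fr[OF x(1,2) y(1,2)] x y by simp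
  also have "\<dots> \<in> ext Q" using x y by (intro A.ideal_rmultD[OF id xy] \<iota>_closed) auto
  finally have "a \<otimes> b \<in> Q" using contr_ext_prime[OF Q] x y by (auto simp: contr_def)
  then have "a \<in> Q \<or> b \<in> Q" using primeD[OF Q(1)] x y by blast
  then show "x \<in> ext Q \<or> y \<in> ext Q" unfolding ext_eq[OF Qi] using x y by blast
qed

lemma ext_P_maximal: "maximalideal (ext P) A"
  and A_unique_maximal: "maximalideal M A \<Longrightarrow> M = ext P"
proof -
  have prime: "primeideal (ext P) A" using ext_prime P_prime by blast
  have le: "J \<subseteq> ext P" if "ideal J A" "J \<noteq> carrier A" for J
  proof -
    have "ext (contr J) \<subseteq> ext P"
      using proper_disjoint[OF that] \<iota>_in_ext[OF ideal_subset[OF prime_ideal[OF P_prime]]]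
      by (intro ext_least A.prime_ideal prime) blast
    then show ?thesis using ext_contr[OF that(1)] by simp
  qed
  show max: "maximalideal (ext P) A"
    by (rule maximalidealI) (use prime le primeideal.I_notcarr A.prime_ideal in blast)+
  show "M = ext P" if M: "maximalideal M A"
  proof -
    have "ideal M A" using M by (simp add: maximalideal_def)
    moreover have "carrier A \<noteq> M" using M by (rule maximalideal.I_notcarr)
    ultimately show ?thesis
      using maximalideal.I_maximal[OF M A.prime_ideal[OF prime]] le A.ideal_subset[OF A.prime_ideal[OF prime]]
        primeideal.I_notcarr[OF prime] by metis
  qed
qed

text \<open>Needed to carry the colon formula for Frobenius powers from the local rings back to R.
  Both inclusions clear denominators.\<close>

lemma colon_ext:
  assumes K: "ideal K R" and s: "s \<in> carrier R"
  shows "A.colon (ext K) (\<iota> s) = ext (colon K s)"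
proof (intro subset_antisym subsetI)
  have cK: "ideal (colon K s) R" using K s by (rule colon_ideal)
  fix x assume "x \<in> A.colon (ext K) (\<iota> s)"
  then have x: "x \<in> carrier A" "x \<otimes>\<^bsub>A\<^esub> \<iota> s \<in> ext K" by (auto simp: A.mem_colon)
  then obtain a t where a: "a \<in> carrier R" "t \<in> S" "x = fr a t" by (blast elim: fr_cases)
  have t: "\<iota> t \<in> carrier A" and \<iota>s: "\<iota> s \<in> carrier A" using a s \<iota>_closed by auto
  have "\<iota> (a \<otimes> s) = (x \<otimes>\<^bsub>A\<^esub> \<iota> t) \<otimes>\<^bsub>A\<^esub> \<iota> s"
    unfolding a(3) fr_mult_cancel[OF a(1,2)] using a(1) s by (rule \<iota>_mult)
  also have "\<dots> = (x \<otimes>\<^bsub>A\<^esub> \<iota> s) \<otimes>\<^bsub>A\<^esub> \<iota> t"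
    using A.m_lcomm[OF x(1) t \<iota>s] A.m_comm[OF t \<iota>s] A.m_assoc[OF x(1)] t \<iota>s by simp
  also have "\<dots> \<in> ext K" using a by (intro A.ideal_rmultD[OF ext_ideal[OF ideal_subset[OF K]] x(2)] \<iota>_closed) auto
  finally have "\<exists>u\<in>S. u \<otimes> (a \<otimes> s) \<in> K" using \<iota>_in_ext_iff[OF K m_closed[OF a(1) s]] by simp
  then obtain u where u: "u \<in> S" "u \<otimes> (a \<otimes> s) \<in> K" by (rule bexE)
  then have "u \<otimes> a \<in> colon K s" using a s by (simp add: mem_colon m_assoc)
  then have "\<iota> a \<in> ext (colon K s)" using \<iota>_in_ext_iff[OF cK a(1)] u by blast
  then show "x \<in> ext (colon K s)"
    unfolding a(3) using fr_eq_mult[OF a(1,2)] a fr_closed[of \<one> t] A.ideal_lmultD[OF ext_ideal[OF ideal_subset[OF cK]]] by auto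
next
  fix x assume "x \<in> ext (colon K s)"
  then obtain a t where a: "a \<in> colon K s" "t \<in> S" "x = fr a t" using ext_eq[OF colon_ideal[OF K s]] by blast
  have ac: "a \<in> carrier R" "a \<otimes> s \<in> K" using a by (auto simp: mem_colon)
  have "x \<otimes>\<^bsub>A\<^esub> \<iota> s = fr (a \<otimes> s) t" unfolding a using mult_fr[OF ac(1) a(2) s S_one] a by simp
  then have "x \<otimes>\<^bsub>A\<^esub> \<iota> s \<in> ext K" unfolding ext_eq[OF K] using ac a by blast
  then show "x \<in> A.colon (ext K) (\<iota> s)" using a ac by (auto simp: A.mem_colon intro!: fr_closed)
qed

end

lemma (in noetherian_cring) noetherian_local_at:
  assumes P: "primeideal P R"
  shows "noetherian_local (local_at R P) (localization_at_prime.ext R P P)"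
proof -
  interpret L: localization_at_prime R P
    by (intro localization_at_prime.intro is_cring localization_at_prime_axioms.intro P)
  have "noetherian_ring L.A"
  proof (rule L.A.noetherian_ringI)
    fix Q assume Q: "ideal Q L.A"
    obtain B where B: "B \<subseteq> carrier R" "finite B" "L.contr Q = Idl B"
      using finetely_gen[OF L.contr_ideal[OF Q]] by blast
    have B': "L.\<iota> ` B \<subseteq> carrier L.A" using B L.\<iota>_closed by blast
    have id: "ideal (Idl\<^bsub>L.A\<^esub> (L.\<iota> ` B)) L.A" using B' by (rule L.A.genideal_ideal)
    have "L.contr Q \<subseteq> L.contr (Idl\<^bsub>L.A\<^esub> (L.\<iota> ` B))"
      unfolding B(3) using B L.A.genideal_self[OF B']
      by (intro genideal_minimal L.contr_ideal id) (auto simp: L.contr_def)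
    then have "L.ext (L.contr Q) \<subseteq> Idl\<^bsub>L.A\<^esub> (L.\<iota> ` B)"
      by (intro L.ext_least id) (auto simp: L.contr_def)
    then have "Q \<subseteq> Idl\<^bsub>L.A\<^esub> (L.\<iota> ` B)" using L.ext_contr[OF Q] by simp
    moreover have "Idl\<^bsub>L.A\<^esub> (L.\<iota> ` B) \<subseteq> Q"
      using genideal_self[OF B(1)] B(3) by (intro L.A.genideal_minimal Q) (auto simp: L.contr_def)
    ultimately show "\<exists>C\<subseteq>carrier L.A. finite C \<and> Q = Idl\<^bsub>L.A\<^esub> C" using B' B(2) by blast
  qed
  then show ?thesis
    by (intro noetherian_local.intro noetherian_cring.intro noetherian_local_axioms.intro
        L.A_cring L.ext_P_maximal L.A_unique_maximal)
qed

section \<open>Chains of primes\<close>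

text \<open>A form of Krull's principal ideal theorem. If \<open>\<mm>\<close> were the only prime containing \<open>P\<close> and \<open>x\<close>,
  then, for \<open>y \<in> Q - P\<close>, the length of \<open>R/(P + (x\<^sup>N) + (y))\<close> would be bounded in \<open>N\<close>, which forces a
  power of \<open>x\<close> into \<open>P + (y) \<subseteq> Q\<close>.\<close>

lemma (in noetherian_local) intermediate_prime_below_\<mm>:
  assumes P: "primeideal P R" and Q: "primeideal Q R" and "P \<subset> Q" "Q \<subset> \<mm>" and x: "x \<in> \<mm>"
  obtains P' where "primeideal P' R" "P \<subset> P'" "P' \<subset> \<mm>" "x \<in> P'"
proof (rule ccontr)
  assume "\<not> thesis"
  then have no: "\<not> (primeideal P' R \<and> P \<subset> P' \<and> P' \<subset> \<mm> \<and> x \<in> P')" for P' using that by blast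
  have xQ: "x \<notin> Q" using no[of Q] assms by blast
  note Pi = prime_ideal[OF P] and Qi = prime_ideal[OF Q]
  have xc: "x \<in> carrier R" using x \<mm>_ideal ideal_carrD by blast
  have xP: "x \<notin> P" using xQ \<open>P \<subset> Q\<close> by blast
  let ?K = "\<lambda>N::nat. P <+> PIdl (x [^] N)"
  have K: "ideal (?K N) R" for N by (intro adjoin_ideal Pi nat_pow_closed xc)
  have Px: "ideal (P <+> PIdl x) R" using Pi xc by (rule adjoin_ideal)
  \<comment> \<open>Under the assumption to be refuted, \<mm> is the only prime over P + (x), so
    R/(P + (x)) has a finite length l.\<close>
  have "P' = \<mm>" if "primeideal P' R" "P <+> PIdl x \<subseteq> P'" for P'
  proof -
    have "P \<subseteq> P'" "x \<in> P'" using that adjoin_subset[OF Pi xc] adjoin_self[OF Pi xc] by blast+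
    then show ?thesis using no[of P'] that(1) prime_le_\<mm> xP by blast
  qed
  then obtain n where "ideal_power R \<mm> n \<subseteq> P <+> PIdl x"
    using only_prime_imp_power[OF Px \<mm>_ideal] by blast
  then obtain l where l: "len (P <+> PIdl x) (carrier R) = enat l"
    using len_finite[OF Px] by blast
  have lenK: "len (?K N) (carrier R) = enat (N * l)" for N
  proof -
    have "a \<in> P" if "a \<in> carrier R" "a \<otimes> x \<in> P" for a
      using primeD[OF P that(2,1) xc] xP by blast
    then show ?thesis using len_adjoin_power[OF Pi xc] l by simp
  qed
  obtain y where y: "y \<in> Q" "y \<notin> P" using \<open>P \<subset> Q\<close> by blast
  have yc: "y \<in> carrier R" using y Qi ideal_carrD by blast
  have colon_y: "colon P y = P"
    using primeD[OF P _ _ yc] y(2) subset_colon[OF Pi yc] by (auto simp: mem_colon)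
  \<comment> \<open>Artin-Rees with (P : y) = P: dividing by y costs at most \<open>c\<close> powers
    of x, uniformly in N.\<close>
  obtain c where c: "\<And>N. c \<le> N \<Longrightarrow> colon (?K N) y \<subseteq> ?K (N - c)"
    using artin_rees_principal[OF Pi yc xc] unfolding colon_y by blast
  let ?L = "\<lambda>N. ?K N <+> PIdl y"
  have L: "ideal (?L N) R" for N using K yc by (rule adjoin_ideal)
  \<comment> \<open>R/(P + (x^N)) has length N l. Its part generated by y is R/(P + (x^N) : y), of
    length at least (N - c) l, so at most c l remains for the quotient.\<close>
  have bound: "len (?L N) (carrier R) \<le> enat (c * l)" if N: "c \<le> N" for N
  proof -
    have "enat ((N - c) * l) \<le> len (colon (?K N) y) (carrier R)"
      unfolding lenK[symmetric] by (intro len_mono c N subset_refl)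
    then have "enat ((N - c) * l) \<le> len (?K N) (?L N)" unfolding len_adjoin[OF K yc] .
    moreover have "enat (N * l) = len (?K N) (?L N) + len (?L N) (carrier R)"
      using len_add[OF K L oneideal adjoin_subset[OF K yc] ideal_subset[OF L]] lenK by simp
    moreover have "(N - c) * l + c * l = N * l" using N by (metis add_mult_distrib le_add_diff_inverse2)
    ultimately show ?thesis
      by (cases "len (?K N) (?L N)"; cases "len (?L N) (carrier R)") auto
  qed
  have L_decr: "?L (Suc N) \<subseteq> ?L N" for N
  proof -
    have "x [^] Suc N \<in> ?K N" 
      using ideal_rmultD[OF K[of N] adjoin_self[OF Pi] xc] xc by simp
    then have "?K (Suc N) \<subseteq> ?K N" by (intro adjoin_least K adjoin_subset Pi nat_pow_closed xc)
    then show ?thesis by (rule set_add_mono) (rule subset_refl)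
  qed
  \<comment> \<open>Were the decreasing ideals \<open>?L N\<close> always strictly decreasing, their
    colengths would exceed the bound c l.\<close>
  obtain N where N: "?L (Suc N) = ?L N"
  proof (rule ccontr)
    assume "\<not> thesis"
    then have strict: "?L (Suc N) \<subset> ?L N" for N using that L_decr by blast
    have "enat j \<le> len (?L (c + j)) (carrier R)" for j
    proof (induct j)
      case (Suc j)
      have "len (?L (c + Suc j)) (carrier R) = len (?L (Suc (c + j))) (?L (c + j)) + len (?L (c + j)) (carrier R)"
        using len_add[OF L L oneideal L_decr ideal_subset[OF L], of "c + j"] by simp
      moreover have "1 \<le> len (?L (Suc (c + j))) (?L (c + j))" by (intro len_pos L strict)
      ultimately show ?case
        using Suc add_mono[of 1 _ "enat j"] by (simp add: one_enat_def)
    qed (simp add: zero_enat_def[symmetric])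
    from order_trans[OF this bound[of "c + Suc (c * l)"]] show False by simp
  qed
  have "x [^] N \<in> ?L (Suc N)"
    unfolding N using adjoin_self[OF Pi, of "x [^] N"] adjoin_subset[OF K yc] xc by blast
  then obtain w a where w: "w \<in> ?K (Suc N)" "a \<in> carrier R" "x [^] N = w \<oplus> a \<otimes> y"
    unfolding mem_adjoin[of _ "?K (Suc N)"] by blast
  from w(1) obtain p b where p: "p \<in> P" "b \<in> carrier R" "w = p \<oplus> b \<otimes> x [^] Suc N"
    unfolding mem_adjoin by blast
  note pba = p(1,2) w(2) w(3)[unfolded p(3)]
  have pc: "p \<in> carrier R" and xN: "x [^] N \<in> carrier R" using pba Pi ideal_carrD xc by auto
  \<comment> \<open>The relation x^N = p + b x^(N+1) + a y puts (1 - b x) x^N into Q, and 1 - b x is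
    a unit.\<close>
  have "x [^] N \<ominus> (b \<otimes> x) \<otimes> x [^] N = ((p \<oplus> b \<otimes> x [^] Suc N) \<oplus> a \<otimes> y) \<ominus> (b \<otimes> x) \<otimes> x [^] N"
    by (rule arg_cong[OF pba(4)])
  also have "\<dots> = p \<oplus> a \<otimes> y"
    unfolding nat_pow_Suc using pba(2,3) pc xN xc yc by algebra
  also have "\<dots> \<in> Q" 
    using pba y \<open>P \<subset> Q\<close> ideal_lmultD[OF Qi y(1)] by (intro ideal_addD[OF Qi]) auto
  finally have "x [^] N \<in> Q"
    by (rule one_minus_cancel[OF Qi ideal_lmultD[OF \<mm>_ideal x pba(2)] xN])
  then show False using prime_powD[OF Q xc] xQ by blast
qed

context noetherian_cring begin

text \<open>After localization at M, extension and contraction keep the strict inclusions between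
  the primes inside M.\<close>

lemma intermediate_prime:
  assumes P: "primeideal P R" and Q: "primeideal Q R" and M: "primeideal M R"
    and "P \<subset> Q" "Q \<subset> M" and x: "x \<in> M"
  obtains P' where "primeideal P' R" "P \<subset> P'" "P' \<subset> M" "x \<in> P'"
proof -
  interpret L: localization_at_prime R M
    by (intro localization_at_prime.intro is_cring localization_at_prime_axioms.intro M)
  interpret A: noetherian_local L.A "L.ext M" using M by (rule noetherian_local_at)
  have eq: "L.contr (L.ext J) = J" if "J \<in> {P, Q, M}" for J
    using that assms by (intro L.contr_ext_prime) auto
  have prime: "primeideal (L.ext J) L.A" if "J \<in> {P, Q}" for J
    using that assms by (intro L.ext_prime) auto
  have strict: "L.ext J \<subset> L.ext J'" if "J \<subset> J'" "J \<in> {P, Q, M}" "J' \<in> {P, Q, M}" for J J'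
  proof -
    have "primeideal J' R" using that assms by auto
    then have "J' \<subseteq> carrier R" "ideal J R" using that assms prime_ideal ideal_subset by auto
    then have "L.ext J \<subseteq> L.ext J'"
      using that(1) by (intro L.ext_least L.ext_ideal L.\<iota>_in_ext) auto
    then show ?thesis using eq that by (metis psubset_eq)
  qed
  have xc: "x \<in> carrier R" using x M prime_ideal ideal_carrD by blast
  have "L.\<iota> x \<in> L.ext M" using x M prime_ideal ideal_subset by (intro L.\<iota>_in_ext) auto
  then obtain P' where P': "primeideal P' L.A" "L.ext P \<subset> P'" "P' \<subset> L.ext M" "L.\<iota> x \<in> P'"
    using A.intermediate_prime_below_\<mm>[of "L.ext P" "L.ext Q" "L.\<iota> x"] prime strict assms(4,5) by auto
  show ?thesis
  proof
    show "primeideal (L.contr P') R" using P'(1) by (rule L.contr_prime)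
    show "P \<subset> L.contr P'" 
      using L.contr_strict[OF L.A.prime_ideal[OF prime] L.A.prime_ideal P'(2)] P'(1) eq by auto
    show "L.contr P' \<subset> M" 
      using L.contr_strict[OF L.A.prime_ideal A.\<mm>_ideal P'(3)] P'(1) eq by auto
    show "x \<in> L.contr P'" using P' xc by (simp add: L.contr_def)
  qed
qed

lemma prime_chain_prefix: "prime_chain R n Q \<Longrightarrow> m \<le> n \<Longrightarrow> prime_chain R m Q"
  by (auto simp: prime_chain_def)

lemma prime_chain_tail: "prime_chain R (Suc n) Q \<Longrightarrow> prime_chain R n (\<lambda>i. Q (Suc i))"
  by (auto simp: prime_chain_def)

lemma prime_chain_extend:
  "prime_chain R n Q \<Longrightarrow> primeideal P R \<Longrightarrow> Q n \<subset> P \<Longrightarrow> prime_chain R (Suc n) (Q(Suc n := P))"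
  by (auto simp: prime_chain_def less_Suc_eq le_Suc_eq)

text \<open>The element descends one prime at a time: the prime just below the top is exchanged, by
  \<open>intermediate_prime\<close>, for one containing x, and the shorter chain ending there is
  treated by induction. The ends stay fixed.\<close>

lemma prime_chain_through:
  assumes "prime_chain R (Suc n) Q" "x \<in> Q (Suc n)"
  obtains Q' where "prime_chain R (Suc n) Q'" "Q' 0 = Q 0" "Q' (Suc n) = Q (Suc n)" "x \<in> Q' 1"
proof -
  have "\<exists>Q'. prime_chain R (Suc n) Q' \<and> Q' 0 = Q 0 \<and> Q' (Suc n) = Q (Suc n) \<and> x \<in> Q' 1"
    using assms
  proof (induct n arbitrary: Q)
    case 0
    then show ?case by auto
  next
    case (Suc n)
    have Q: "primeideal (Q n) R" "primeideal (Q (Suc n)) R" "primeideal (Q (Suc (Suc n))) R" 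
      "Q n \<subset> Q (Suc n)" "Q (Suc n) \<subset> Q (Suc (Suc n))"
      using Suc(2) by (auto simp: prime_chain_def)
    obtain P where P: "primeideal P R" "Q n \<subset> P" "P \<subset> Q (Suc (Suc n))" "x \<in> P"
      using intermediate_prime[OF Q Suc(3)] .
    have "prime_chain R (Suc n) (Q(Suc n := P))"
      using Suc(2) P by (intro prime_chain_extend) (auto intro: prime_chain_prefix)
    from Suc(1)[OF this] P obtain Q' where Q': "prime_chain R (Suc n) Q'" "Q' 0 = Q 0" "Q' (Suc n) = P" "x \<in> Q' 1"
      by auto
    have "prime_chain R (Suc (Suc n)) (Q'(Suc (Suc n) := Q (Suc (Suc n))))"
      using Q' P Q by (intro prime_chain_extend) auto
    moreover have "(Q'(Suc (Suc n) := Q (Suc (Suc n)))) 0 = Q 0" "x \<in> (Q'(Suc (Suc n) := Q (Suc (Suc n)))) 1"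
      "(Q'(Suc (Suc n) := Q (Suc (Suc n)))) (Suc (Suc n)) = Q (Suc (Suc n))"
      using Q' by simp_all
    ultimately show ?case by blast
  qed
  then show ?thesis using that by blast
qed

end

context noetherian_local begin

lemma krull_intersection_principal:
  assumes K: "ideal K R" and x: "x \<in> \<mm>" and mem: "\<And>n::nat. f \<in> K <+> PIdl (x [^] n)"
  shows "f \<in> K"
proof -
  have xc: "x \<in> carrier R" using x \<mm>_ideal ideal_carrD by blast
  have fc: "f \<in> carrier R" using mem[of 0] adjoin_ideal[OF K, of "x [^] (0::nat)"] ideal_carrD xc by blast
  show ?thesis
  proof (rule krull_intersection[OF K fc])
    fix t
    have "PIdl (x [^] t) \<subseteq> ideal_power R \<mm> t"
      by (intro cgenideal_minimal ideal_power_ideal \<mm>_ideal pow_in_ideal_power x)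
    then show "f \<in> K <+> ideal_power R \<mm> t" using mem[of t] set_add_mono by blast
  qed
qed

text \<open>The top may be replaced by \<mm>, which contains x. That the bottom is kept matters
  below, where it is compared with a given ideal.\<close>

lemma prime_chain_through_element:
  assumes Q: "prime_chain R (Suc n) Q" and x: "x \<in> \<mm>"
  obtains Q' where "prime_chain R (Suc n) Q'" "Q' 0 = Q 0" "x \<in> Q' 1"
proof -
  define Q' where "Q' = (\<lambda>i. if i = Suc n then \<mm> else Q i)"
  have Qp: "primeideal (Q i) R" if "i \<le> Suc n" for i using Q that by (simp add: prime_chain_def)
  have "Q i \<subset> Q' (Suc i)" if "i < Suc n" for i
    using that Q prime_le_\<mm>[OF Qp, of "Suc n"] by (auto simp: Q'_def prime_chain_def)
  then have "prime_chain R (Suc n) Q'"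
    using \<mm>_prime Qp unfolding prime_chain_def by (auto simp: Q'_def)
  moreover have "x \<in> Q' (Suc n)" using x by (simp add: Q'_def)
  moreover have "Q' 0 = Q 0" by (simp add: Q'_def)
  ultimately show ?thesis using prime_chain_through[of n Q' x] that by metis
qed

text \<open>The base \<open>K\<close> plays the role of the zero ideal of \<open>R/K\<close>: if the maximal ideal of a local ring of
  dimension at least \<open>n\<close> has \<open>n\<close> generators, the ring is a domain.\<close>

lemma prime_chain_bottom:
  assumes "finite X'" "X' \<subseteq> carrier R" "ideal K R" "Idl (K \<union> X') = \<mm>" "card X' \<le> n"
    "prime_chain R n Q" "K \<subseteq> Q 0"
  shows "Q 0 = K"
  using assms
proof (induct X' arbitrary: K n Q rule: finite_induct)
  case empty
  then have "K = \<mm>" using genideal_of_ideal by simp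
  moreover have "primeideal (Q 0) R" using empty by (simp add: prime_chain_def)
  ultimately show ?case using prime_le_\<mm> empty by blast
next
  case (insert x X')
  have x: "x \<in> carrier R" and K: "ideal K R" and X': "X' \<subseteq> carrier R" using insert by auto
  obtain n' where n': "n = Suc n'" using insert by (metis Suc_le_D card_insert_disjoint)
  have Kc: "K \<subseteq> carrier R" using K by (rule ideal_subset)
  have Qp: "primeideal (Q i) R" if "i \<le> n" for i using insert that by (simp add: prime_chain_def)
  have xm: "x \<in> \<mm>" using insert(6) genideal_self[of "K \<union> insert x X'"] Kc x X' by auto
  have Km: "K \<subseteq> \<mm>" using insert(6) genideal_self[of "K \<union> insert x X'"] Kc x X' by auto
  \<comment> \<open>After this rerouting, the tail of the chain lies above K + (x), modulo which one
    generator of \<mm> fewer is left, so the induction hypothesis identifies \<open>Q' 1\<close>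
    with K + (x).\<close>
  obtain Q' where Q': "prime_chain R n Q'" "Q' 0 = Q 0" "x \<in> Q' 1"
    using prime_chain_through_element[of n' Q x] insert(8) n' xm by blast
  let ?K = "K <+> PIdl x"
  have K': "ideal ?K R" using K x by (rule adjoin_ideal)
  have Q'p: "primeideal (Q' i) R" if "i \<le> n" for i using Q' that by (simp add: prime_chain_def)
  have less: "Q 0 \<subset> Q' 1" using Q' n' by (auto simp: prime_chain_def)
  have "Idl (?K \<union> X') = \<mm>"
  proof
    show "Idl (?K \<union> X') \<subseteq> \<mm>"
    proof (intro genideal_minimal \<mm>_ideal Un_least)
      show "?K \<subseteq> \<mm>" using Km xm by (intro adjoin_least \<mm>_ideal)
      show "X' \<subseteq> \<mm>" using insert(6) genideal_self[of "K \<union> insert x X'"] Kc x X' by auto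
    qed
    have "insert x X' \<union> K \<subseteq> Idl (?K \<union> X')"
      using adjoin_subset[OF K x] adjoin_self[OF K x] genideal_self[of "?K \<union> X'"] ideal_subset[OF K'] X' by blast
    then have "Idl (K \<union> insert x X') \<subseteq> Idl (?K \<union> X')"
      using ideal_subset[OF K'] X' by (intro genideal_minimal genideal_ideal) auto
    then show "\<mm> \<subseteq> Idl (?K \<union> X')" using insert(6) by simp
  qed
  moreover have "card X' \<le> n'" using insert n' by simp
  moreover have "prime_chain R n' (\<lambda>i. Q' (Suc i))" using Q'(1) n' prime_chain_tail by simp
  moreover have "?K \<subseteq> Q' (Suc 0)"
    using Q' less insert(9) n' Q'p[of 1] by (intro adjoin_least prime_ideal) auto
  ultimately have Q'1: "Q' 1 = ?K" using insert(3)[OF X' K'] by simp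
  have Q0: "primeideal (Q 0) R" using Qp by simp
  note Q0i = prime_ideal[OF Q0]
  have xQ: "x \<notin> Q 0"
  proof
    assume "x \<in> Q 0"
    then have "?K \<subseteq> Q 0" using insert(9) by (intro adjoin_least Q0i)
    then show False using less Q'1 by blast
  qed
  \<comment> \<open>From Q 0 inside K + (x) and x outside the prime Q 0 one gets Q 0 inside K + x Q
    0. Iterating puts Q 0 into K + (x^n) for all n, and Krull's intersection theorem
    finishes.\<close>
  have step: "\<exists>k\<in>K. \<exists>r\<in>Q 0. y = k \<oplus> r \<otimes> x" if y: "y \<in> Q 0" for y
  proof -
    have "y \<in> ?K" using y less Q'1 by blast
    then obtain k r where kr: "k \<in> K" "r \<in> carrier R" "y = k \<oplus> r \<otimes> x" unfolding mem_adjoin by blast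
    then have "k \<in> carrier R" "k \<in> Q 0" using Kc insert(9) by auto
    then have "r \<otimes> x \<in> Q 0"
      using ideal_diff_cancel[OF Q0i, of "r \<otimes> x" k] kr x y a_comm by auto
    then have "r \<in> Q 0" using primeD[OF Q0, of r x] kr x xQ by blast
    then show ?thesis using kr by blast
  qed
  have "Q 0 \<subseteq> K"
  proof
    fix y assume y: "y \<in> Q 0"
    have "\<exists>k\<in>K. \<exists>r\<in>Q 0. y = k \<oplus> r \<otimes> x [^] n" for n :: nat
    proof (induct n)
      case 0
      have "y = \<zero> \<oplus> y \<otimes> x [^] (0::nat)" using y ideal_carrD[OF Q0i] by simp
      then show ?case using y ideal_zeroD[OF K] by blast
    next
      case (Suc n)
      then obtain k r where kr: "k \<in> K" "r \<in> Q 0" "y = k \<oplus> r \<otimes> x [^] n" by blast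
      obtain k' r' where kr': "k' \<in> K" "r' \<in> Q 0" "r = k' \<oplus> r' \<otimes> x" using step[OF kr(2)] by blast
      have c: "k \<in> carrier R" "k' \<in> carrier R" "r' \<in> carrier R" "x [^] n \<in> carrier R" 
        using kr kr' Kc ideal_carrD[OF Q0i] x by auto
      have "y = (k \<oplus> k' \<otimes> x [^] n) \<oplus> r' \<otimes> (x [^] n \<otimes> x)"
        unfolding kr(3) kr'(3) using c x by algebra
      moreover have "k \<oplus> k' \<otimes> x [^] n \<in> K" using kr kr' c by (intro ideal_addD[OF K] ideal_rmultD[OF K])
      ultimately show ?case using kr' by auto
    qed
    then have "y \<in> K <+> PIdl (x [^] n)" for n :: nat
      unfolding mem_adjoin using ideal_carrD[OF Q0i] by metis
    then show "y \<in> K" using krull_intersection_principal[OF K xm] by blast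
  qed
  then show ?case using insert(9) by blast
qed

text \<open>A chain with more steps than generators and its tail would both have K as their bottom
  prime, although the first step is strict.\<close>

lemma prime_chain_length_le:
  assumes "finite X'" "X' \<subseteq> carrier R" "ideal K R" "Idl (K \<union> X') = \<mm>"
    "prime_chain R n Q" "K \<subseteq> Q 0"
  shows "n \<le> card X'"
proof (rule ccontr)
  assume "\<not> n \<le> card X'"
  then obtain n' where n': "n = Suc n'" "card X' \<le> n'" by (metis Suc_le_D not_less_eq_eq)
  have "Q 0 = K" using prime_chain_bottom[OF assms(1-4) _ assms(5,6)] n' by simp
  moreover have "Q 0 \<subset> Q (Suc 0)" using assms(5) n' by (auto simp: prime_chain_def)
  moreover have "prime_chain R n' (\<lambda>i. Q (Suc i))" using assms(5) n' prime_chain_tail by simp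
  ultimately show False
    using prime_chain_bottom[OF assms(1-4) n'(2), of "\<lambda>i. Q (Suc i)"] by auto
qed

end

section \<open>Regular systems of parameters\<close>

text \<open>\<open>chain_ex\<close> says dim R >= d, while d generators of \<mm> bound the dimension
  from above by \<open>prime_chain_length_le\<close>. Thus the x i form a regular system of
  parameters.\<close>

locale parameter_system = noetherian_local +
  fixes d :: nat and x :: "nat \<Rightarrow> 'a"
  assumes x_carr: "i < d \<Longrightarrow> x i \<in> carrier R"
    and x_gen: "Idl (x ` {..<d}) = \<mm>"
    and chain_ex: "\<exists>Q. prime_chain R d Q"
begin

lemma x_mem: "i < d \<Longrightarrow> x i \<in> \<mm>"
  using genideal_self[of "x ` {..<d}"] x_carr x_gen by auto

lemma partial_gen:
  assumes "T \<subseteq> {..<d}"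
  shows "Idl (Idl (x ` T) \<union> x ` ({..<d} - T)) = \<mm>"
proof
  have T: "x ` T \<subseteq> carrier R" using assms x_carr by auto
  have TI: "Idl (x ` T) \<subseteq> carrier R" using T genideal_ideal ideal_subset by blast
  show "Idl (Idl (x ` T) \<union> x ` ({..<d} - T)) \<subseteq> \<mm>"
    using assms x_mem by (intro genideal_minimal Un_least \<mm>_ideal) auto
  have "x ` {..<d} \<subseteq> Idl (x ` T) \<union> x ` ({..<d} - T)"
    using genideal_self[OF T] by auto
  moreover have "Idl (x ` T) \<union> x ` ({..<d} - T) \<subseteq> carrier R" using TI x_carr by auto
  ultimately show "\<mm> \<subseteq> Idl (Idl (x ` T) \<union> x ` ({..<d} - T))"
    unfolding x_gen[symmetric] by (rule genideal_mono)
qed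

text \<open>Modulo the x i with i in T the dimension is at least d - |T|: each parameter is moved
  into the second prime of the chain, and the bottom prime is dropped.\<close>

lemma partial_chain:
  assumes "finite T" "T \<subseteq> {..<d}"
  shows "\<exists>Q. prime_chain R (d - card T) Q \<and> x ` T \<subseteq> Q 0"
  using assms
proof (induct T rule: finite_induct)
  case empty
  then show ?case using chain_ex by simp
next
  case (insert j T)
  then obtain Q where Q: "prime_chain R (d - card T) Q" "x ` T \<subseteq> Q 0" by auto
  have "card (insert j T) \<le> d" using insert(4) card_mono[of "{..<d}" "insert j T"] by simp
  then have n: "d - card T = Suc (d - card (insert j T))" using insert by simp
  obtain Q' where Q': "prime_chain R (d - card T) Q'" "Q' 0 = Q 0" "x j \<in> Q' 1"
    using prime_chain_through_element[of "d - card (insert j T)" Q "x j"] Q(1) x_mem[of j] insert(4) n by auto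
  have "Q' 0 \<subset> Q' 1" using Q'(1) unfolding n prime_chain_def by auto
  then have "x ` insert j T \<subseteq> Q' 1" using Q Q' by auto
  then show ?case using prime_chain_tail[of _ Q'] Q'(1) unfolding n by (intro exI[of _ "\<lambda>i. Q' (Suc i)"]) auto
qed

lemma card_le:
  assumes "T \<subseteq> {..<d}"
  shows "card (x ` ({..<d} - T)) \<le> d - card T"
proof -
  have "card ({..<d} - T) = d - card T" using assms finite_subset[OF assms] by (simp add: card_Diff_subset)
  then show ?thesis using card_image_le[of "{..<d} - T" x] by simp
qed

text \<open>Modulo these parameters, d - |T| elements generate \<mm> and a chain with d - |T| steps
  exists, so \<open>prime_chain_bottom\<close> makes the ideal equal to the bottom prime of that
  chain.\<close>

lemma partial_prime:
  assumes "T \<subseteq> {..<d}"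
  shows "primeideal (Idl (x ` T)) R"
proof -
  have T: "finite T" using assms finite_subset by blast
  obtain Q where Q: "prime_chain R (d - card T) Q" "x ` T \<subseteq> Q 0"
    using partial_chain[OF T assms] by blast
  have Tc: "x ` T \<subseteq> carrier R" using assms x_carr by auto
  have Q0: "primeideal (Q 0) R" using Q by (simp add: prime_chain_def)
  have "Idl (x ` T) \<subseteq> Q 0" using Q Q0 by (intro genideal_minimal prime_ideal)
  then have "Q 0 = Idl (x ` T)"
    using assms x_carr
    by (intro prime_chain_bottom[OF _ _ _ partial_gen[OF assms] card_le[OF assms] Q(1)] genideal_ideal Tc) auto
  then show ?thesis using Q0 by simp
qed

text \<open>Otherwise d - |T| - 1 elements would generate \<mm> modulo the parameters in T, too few
  for a chain with d - |T| steps.\<close>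

lemma param_notin:
  assumes T: "T \<subseteq> {..<d}" and j: "j < d" "j \<notin> T"
  shows "x j \<notin> Idl (x ` T)"
proof
  assume xj: "x j \<in> Idl (x ` T)"
  have Tf: "finite T" using T finite_subset by blast
  obtain Q where Q: "prime_chain R (d - card T) Q" "x ` T \<subseteq> Q 0"
    using partial_chain[OF Tf T] by blast
  have Tc: "x ` T \<subseteq> carrier R" using T x_carr by auto
  have jT: "insert j T \<subseteq> {..<d}" using T j by auto
  have Q0: "primeideal (Q 0) R" using Q by (simp add: prime_chain_def)
  have sub: "Idl (x ` T) \<subseteq> Q 0" using Q Q0 by (intro genideal_minimal prime_ideal)
  have eq: "Idl (x ` insert j T) = Idl (x ` T)"
    using adjoin_absorb[OF genideal_ideal[OF Tc] xj] genideal_insert[OF Tc x_carr[OF j(1)]] by simp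
  have 1: "d - card T \<le> card (x ` ({..<d} - insert j T))"
    by (rule prime_chain_length_le[OF _ _ _ partial_gen[OF jT, unfolded eq] Q(1) sub])
      (use x_carr Tc genideal_ideal in auto)
  have 2: "card (insert j T) \<le> d" using card_mono[OF _ jT] by simp
  have 3: "card (insert j T) = Suc (card T)" using Tf j by simp
  show False using 1 2 3 card_le[OF jT] by linarith
qed

abbreviation "power_ideal n T \<equiv> Idl ((\<lambda>i. x i [^] (n i :: nat)) ` T)"

lemma power_ideal_ideal: "T \<subseteq> {..<d} \<Longrightarrow> ideal (power_ideal n T) R"
  using x_carr by (intro genideal_ideal) auto

lemma power_ideal_remove:
  assumes "T \<subseteq> {..<d}" "i \<in> T"
  shows "power_ideal n T = power_ideal n (T - {i}) <+> PIdl (x i [^] n i)"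
proof -
  have "(\<lambda>i. x i [^] n i) ` T = insert (x i [^] n i) ((\<lambda>i. x i [^] n i) ` (T - {i}))"
    using assms(2) by auto
  then show ?thesis using assms x_carr by (auto intro!: genideal_insert)
qed

lemma power_ideal_upd:
  assumes "T \<subseteq> {..<d}" "i \<in> T"
  shows "power_ideal (n(i := k)) T = power_ideal n (T - {i}) <+> PIdl (x i [^] k)"
proof -
  have "(\<lambda>j. x j [^] (n(i := k)) j) ` (T - {i}) = (\<lambda>j. x j [^] n j) ` (T - {i})" by auto
  then show ?thesis using power_ideal_remove[OF assms, of "n(i := k)"] by simp
qed

text \<open>Induction on the sum of the exponents. If all are one, the ideal is prime and does not
  contain \<open>x j\<close>. Otherwise some x_i has exponent k + 1 with k > 0. With L generated by
  the other powers, one cancels x_j modulo L + (x_i), then x_i modulo L, then x_j modulo L +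
  (x_i^k); each time the exponent sum is smaller.\<close>

lemma param_regular:
  assumes "T \<subseteq> {..<d}" "j < d" "j \<notin> T" "\<And>i. i \<in> T \<Longrightarrow> 0 < n i"
    "a \<in> carrier R" "a \<otimes> x j \<in> power_ideal n T"
  shows "a \<in> power_ideal n T"
  using assms
proof (induct "sum n T" arbitrary: T n j a rule: less_induct)
  case less
  have Tf: "finite T" using less(2) finite_subset by blast
  have z: "x j \<in> carrier R" using less x_carr by blast
  show ?case
  proof (cases "\<forall>i\<in>T. n i = 1")
    case True
    then have "(\<lambda>i. x i [^] n i) ` T = x ` T"
      using less(2) x_carr by (intro image_cong refl) (auto simp: nat_pow_eone)
    then show ?thesis
      using less(7) primeD[OF partial_prime[OF less(2)] _ less(6) z] param_notin[OF less(2-4)] by simp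
  next
    case False
    then obtain i where i: "i \<in> T" "n i \<noteq> 1" by blast
    obtain k where k: "n i = Suc k" "0 < k"
      using less(5)[OF i(1)] i(2) by (cases "n i") auto
    let ?L = "power_ideal n (T - {i})"
    have L: "ideal ?L R" using less(2) by (intro power_ideal_ideal) auto
    have y: "x i \<in> carrier R" using less(2) i x_carr by auto
    have yk: "x i [^] k \<in> carrier R" using y by simp
    have sum: "sum n T = Suc k + sum n (T - {i})" using Tf i k by (simp add: sum.remove)
    have sum_upd: "sum (n(i := m)) T = m + sum n (T - {i})" for m
    proof -
      have "sum (n(i := m)) (T - {i}) = sum n (T - {i})" by (intro sum.cong) auto
      then show ?thesis using sum.remove[OF Tf i(1), of "n(i := m)"] by simp
    qed
    have IH: "b \<in> ?L <+> PIdl (x i [^] m)" 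
      if "0 < m" "m < Suc k" "b \<in> carrier R" "b \<otimes> x j \<in> ?L <+> PIdl (x i [^] m)" for b m
      using less(1)[of "n(i := m)" T j b] that less(2-5) sum sum_upd power_ideal_upd[OF less(2) i(1)] by auto
    have IH_i: "b \<in> ?L" if "b \<in> carrier R" "b \<otimes> x i \<in> ?L" for b
      using less(1)[of n "T - {i}" i b] that less(2,5) sum i by auto
    have T_eq: "power_ideal n T = ?L <+> PIdl (x i [^] Suc k)"
      using power_ideal_remove[OF less(2) i(1)] k by metis
    obtain l0 b where l0: "l0 \<in> ?L" "b \<in> carrier R" "a \<otimes> x j = l0 \<oplus> b \<otimes> (x i [^] k \<otimes> x i)"
      using less(7) unfolding T_eq mem_adjoin by auto
    have l0c: "l0 \<in> carrier R" using L l0 ideal_carrD by blast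
    have "a \<otimes> x j = l0 \<oplus> (b \<otimes> x i [^] k) \<otimes> x i" unfolding l0(3) using l0(2) l0c y yk by algebra
    then have "a \<otimes> x j \<in> ?L <+> PIdl (x i [^] (1::nat))"
      unfolding mem_adjoin using l0 yk y by (auto simp: nat_pow_eone)
    then have "a \<in> ?L <+> PIdl (x i [^] (1::nat))" using IH[of 1] k less(6) by simp
    then obtain l a' where a: "l \<in> ?L" "a' \<in> carrier R" "a = l \<oplus> a' \<otimes> x i"
      unfolding mem_adjoin using y by (auto simp: nat_pow_eone)
    have lc: "l \<in> carrier R" using L a ideal_carrD by blast
    have "(a' \<otimes> x j \<ominus> b \<otimes> x i [^] k) \<otimes> x i = a \<otimes> x j \<ominus> l \<otimes> x j \<ominus> b \<otimes> (x i [^] k \<otimes> x i)"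
      unfolding a(3) using a(2) lc l0(2) y yk z by algebra
    also have "\<dots> = l0 \<ominus> l \<otimes> x j" unfolding l0(3) using lc l0c l0(2) y yk z by algebra
    also have "\<dots> \<in> ?L" using l0 a z by (intro ideal_minusD[OF L] ideal_rmultD[OF L])
    finally have 1: "a' \<otimes> x j \<ominus> b \<otimes> x i [^] k \<in> ?L"
      using IH_i[of "a' \<otimes> x j \<ominus> b \<otimes> x i [^] k"] a l0 y yk z by simp
    have "a' \<otimes> x j = (a' \<otimes> x j \<ominus> b \<otimes> x i [^] k) \<oplus> b \<otimes> x i [^] k" using a(2) l0(2) y yk z by algebra
    then have "a' \<otimes> x j \<in> ?L <+> PIdl (x i [^] k)" unfolding mem_adjoin using 1 l0(2) by blast
    then have "a' \<in> ?L <+> PIdl (x i [^] k)" using IH[of k] k a by simp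
    then obtain l2 c where c: "l2 \<in> ?L" "c \<in> carrier R" "a' = l2 \<oplus> c \<otimes> x i [^] k" unfolding mem_adjoin by blast
    have l2c: "l2 \<in> carrier R" using L c ideal_carrD by blast
    have "a = (l \<oplus> l2 \<otimes> x i) \<oplus> c \<otimes> (x i [^] k \<otimes> x i)" unfolding a(3) c(3) using lc l2c c(2) y yk by algebra
    moreover have "l \<oplus> l2 \<otimes> x i \<in> ?L" using a c y by (intro ideal_addD[OF L] ideal_rmultD[OF L])
    ultimately show ?thesis unfolding T_eq mem_adjoin using c(2) by auto
  qed
qed

text \<open>T holds the indices whose exponent may differ from one. Starting at \<mm>, of colength
  one, the exponents are raised one index at a time, each multiplying the colength by n j.\<close>

lemma len_power_ideal_aux:
  assumes "finite T" "T \<subseteq> {..<d}" "\<And>i. i < d \<Longrightarrow> 0 < n i" "\<And>i. i < d \<Longrightarrow> i \<notin> T \<Longrightarrow> n i = 1"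
  shows "len (power_ideal n {..<d}) (carrier R) = enat (\<Prod>i<d. n i)"
  using assms
proof (induct T arbitrary: n rule: finite_induct)
  case empty
  then have "(\<lambda>i. x i [^] n i) ` {..<d} = x ` {..<d}"
    using x_carr by (intro image_cong refl) (auto simp: nat_pow_eone)
  then show ?case using empty len_maximalideal[OF maximal] x_gen by (simp add: one_enat_def)
next
  case (insert j T)
  have j: "j \<in> {..<d}" using insert by auto
  let ?L = "power_ideal n ({..<d} - {j})"
  have L: "ideal ?L R" by (intro power_ideal_ideal) auto
  have "len (?L <+> PIdl (x j [^] (1::nat))) (carrier R) = enat (\<Prod>i<d. (n(j := 1)) i)"
    unfolding power_ideal_upd[OF subset_refl j, symmetric]
    by (rule insert(3)) (use insert in auto)
  moreover have "(\<Prod>i<d. (n(j := 1)) i) = (\<Prod>i\<in>{..<d} - {j}. (n(j := 1)) i)"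
    using j by (simp add: prod.remove[of "{..<d}" j])
  moreover have "(\<Prod>i\<in>{..<d} - {j}. (n(j := 1)) i) = (\<Prod>i\<in>{..<d} - {j}. n i)"
    by (intro prod.cong) auto
  ultimately have "len (?L <+> PIdl (x j)) (carrier R) = enat (\<Prod>i\<in>{..<d} - {j}. n i)"
    using x_carr j by (simp add: nat_pow_eone)
  moreover have "len (power_ideal n {..<d}) (carrier R) = enat (n j) * len (?L <+> PIdl (x j)) (carrier R)"
    unfolding power_ideal_remove[OF subset_refl j, of n]
  proof (rule len_adjoin_power[OF L])
    show "x j \<in> carrier R" using j x_carr by auto
    show "a \<in> ?L" if "a \<in> carrier R" "a \<otimes> x j \<in> ?L" for a
      by (rule param_regular[of _ j]) (use that j insert in auto)
  qed
  ultimately show ?case using j by (simp add: prod.remove)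
qed

theorem len_power_ideal:
  assumes "0 < q"
  shows "len (power_ideal (\<lambda>_. q) {..<d}) (carrier R) = enat (q ^ d)"
  using len_power_ideal_aux[of "{..<d}" "\<lambda>_. q"] assms by simp

end

section \<open>Frobenius powers\<close>

context cring begin

lemma binomial_theorem:
  assumes a: "a \<in> carrier R" and b: "b \<in> carrier R"
  shows "(a \<oplus> b) [^] n = (\<Oplus>k\<in>{..n}. add_pow R (n choose k) (a [^] k \<otimes> b [^] (n - k)))"
proof (induct n)
  case (Suc n)
  let ?t = "\<lambda>m k. add_pow R (m choose k) (a [^] k \<otimes> b [^] (m - k))"
  \<comment> \<open>The index m of the coefficient is kept apart from the exponent k, so that
    Pascal's rule can be applied term by term.\<close>
  let ?u = "\<lambda>m k. add_pow R (n choose m) (a [^] k \<otimes> b [^] (Suc n - k))"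
  have c: "add_pow R (m::nat) (a [^] (k::nat) \<otimes> b [^] (l::nat)) \<in> carrier R" for m k l
    using a b by simp
  have add_pow_m: "add_pow R m y \<otimes> z = add_pow R m (y \<otimes> z)" if "y \<in> carrier R" "z \<in> carrier R" for y z and m :: nat
    using that by (simp add: add_pow_ldistr)
  have A: "(\<Oplus>k\<in>{..n}. ?t n k) \<otimes> a = (\<Oplus>k\<in>{..n}. ?u k (Suc k))"
  proof -
    have "?t n k \<otimes> a = ?u k (Suc k)" for k
    proof -
      have "a [^] k \<otimes> b [^] (n - k) \<otimes> a = a [^] Suc k \<otimes> b [^] (n - k)"
        using a b by (simp add: m_ac)
      then show ?thesis using a b by (simp add: add_pow_m)
    qed
    then show ?thesis using a c by (simp add: finsum_ldistr)
  qed
  have B: "(\<Oplus>k\<in>{..n}. ?t n k) \<otimes> b = (\<Oplus>k\<in>{..n}. ?u k k)"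
  proof -
    have "?t n k \<otimes> b = ?u k k" if "k \<le> n" for k
      using that a b by (simp add: add_pow_m m_assoc Suc_diff_le)
    then have "(\<Oplus>k\<in>{..n}. ?t n k \<otimes> b) = (\<Oplus>k\<in>{..n}. ?u k k)"
      by (intro finsum_cong') (use c in auto)
    then show ?thesis using b c by (simp add: finsum_ldistr)
  qed
  have "(\<Oplus>k\<in>{..Suc n}. ?u k k) = (\<Oplus>k\<in>{..n}. ?u (Suc k) (Suc k)) \<oplus> ?u 0 0"
    using c by (intro finsum_Suc2) auto
  moreover have "(\<Oplus>k\<in>{..Suc n}. ?u k k) = ?u (Suc n) (Suc n) \<oplus> (\<Oplus>k\<in>{..n}. ?u k k)"
    using c by (intro finsum_Suc) auto
  \<comment> \<open>The coefficient n choose n + 1 vanishes, so the range of the b-part can be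
    extended by one and then shifted to match the a-part.\<close>
  moreover have "?u (Suc n) (Suc n) = \<zero>" by (simp add: add_pow_def binomial_eq_0)
  ultimately have B': "(\<Oplus>k\<in>{..n}. ?u k k) = (\<Oplus>k\<in>{..n}. ?u (Suc k) (Suc k)) \<oplus> ?u 0 0"
    using c by (simp add: finsum_closed)
  let ?U = "\<Oplus>k\<in>{..n}. ?u k (Suc k)" and ?V = "\<Oplus>k\<in>{..n}. ?u (Suc k) (Suc k)"
  have UV: "?U \<in> carrier R" "?V \<in> carrier R" "?u 0 0 \<in> carrier R"
    using a b by (auto intro!: finsum_closed)
  have "(\<Oplus>k\<in>{..n}. ?t (Suc n) (Suc k)) = (\<Oplus>k\<in>{..n}. ?u k (Suc k) \<oplus> ?u (Suc k) (Suc k))"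
  proof (intro finsum_cong')
    show "?t (Suc n) (Suc k) = ?u k (Suc k) \<oplus> ?u (Suc k) (Suc k)" for k
      using a b by (simp only: binomial_Suc_Suc add.nat_pow_mult[symmetric] nat_pow_closed m_closed)
  qed (use a b in auto)
  also have "\<dots> = ?U \<oplus> ?V"
    using a b by (intro finsum_addf) auto
  finally have 1: "(\<Oplus>k\<in>{..n}. ?t (Suc n) (Suc k)) = ?U \<oplus> ?V" .
  have 2: "(\<Oplus>k\<in>{..Suc n}. ?t (Suc n) k) = (\<Oplus>k\<in>{..n}. ?t (Suc n) (Suc k)) \<oplus> ?t (Suc n) 0"
    using c by (intro finsum_Suc2) auto
  have 3: "?t (Suc n) 0 = ?u 0 0" by simp
  have "(\<Oplus>k\<in>{..Suc n}. ?t (Suc n) k) = ?U \<oplus> (?V \<oplus> ?u 0 0)"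
    unfolding 2 1 3 by (rule a_assoc[OF UV])
  also have "\<dots> = (a \<oplus> b) [^] n \<otimes> a \<oplus> (a \<oplus> b) [^] n \<otimes> b"
    by (rule arg_cong2[OF A[folded Suc, symmetric] trans[OF B B', folded Suc, symmetric]])
  also have "\<dots> = (a \<oplus> b) [^] n \<otimes> (a \<oplus> b)"
    using a b by (intro r_distr[symmetric]) auto
  finally show ?case unfolding nat_pow_Suc by (rule sym)
qed (simp add: add_pow_def)

lemma frobenius_ideal: "J \<subseteq> carrier R \<Longrightarrow> ideal (frobenius_power R J q) R"
  unfolding frobenius_power_def by (intro genideal_ideal) auto

lemma frobenius_powerI: "J \<subseteq> carrier R \<Longrightarrow> f \<in> J \<Longrightarrow> f [^] q \<in> frobenius_power R J q"
  unfolding frobenius_power_def by (intro subsetD[OF genideal_self]) auto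

lemma frobenius_least: "ideal K R \<Longrightarrow> (\<And>f. f \<in> J \<Longrightarrow> f [^] q \<in> K) \<Longrightarrow> frobenius_power R J q \<subseteq> K"
  unfolding frobenius_power_def by (intro genideal_minimal) auto

lemma frobenius_mono: "J \<subseteq> K \<Longrightarrow> K \<subseteq> carrier R \<Longrightarrow> frobenius_power R J q \<subseteq> frobenius_power R K q"
  unfolding frobenius_power_def by (intro genideal_mono) auto

lemma frobenius_subset: "ideal J R \<Longrightarrow> 0 < q \<Longrightarrow> frobenius_power R J q \<subseteq> J"
  by (rule frobenius_least) (auto intro: pow_in_ideal)

lemma frobenius_1: "ideal J R \<Longrightarrow> frobenius_power R J 1 = J"
proof -
  assume J: "ideal J R"
  then have "(\<lambda>f. f [^] (1::nat)) ` J = J" using ideal_carrD by (force simp: nat_pow_eone)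
  then show ?thesis using genideal_of_ideal[OF J] by (simp add: frobenius_power_def)
qed

lemma frobenius_carrier: "frobenius_power R (carrier R) q = carrier R"
  by (rule ideal_oneD) (use frobenius_powerI[of "carrier R" \<one> q] in \<open>simp_all add: frobenius_ideal\<close>)

lemma frobenius_colon_subset:
  assumes "ideal K R" "s \<in> carrier R"
  shows "frobenius_power R (colon K s) q \<subseteq> colon (frobenius_power R K q) (s [^] q)"
proof (rule frobenius_least)
  fix f assume "f \<in> colon K s"
  then have "f \<in> carrier R" "(f \<otimes> s) [^] q \<in> frobenius_power R K q"
    using assms ideal_subset by (auto simp: mem_colon intro: frobenius_powerI)
  then show "f [^] q \<in> colon (frobenius_power R K q) (s [^] q)"
    using assms by (simp add: mem_colon nat_pow_distrib)
qed (intro colon_ideal frobenius_ideal ideal_subset nat_pow_closed assms)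

text \<open>By \<open>ideal_power_adjoin\<close> each generator costs q in the exponent; the final 1
  keeps the base case T = {}, the zero ideal, from being the unit ideal.\<close>

lemma ideal_power_genideal:
  assumes "finite T" "T \<subseteq> carrier R"
  shows "ideal_power R (Idl T) (card T * q + 1) \<subseteq> Idl ((\<lambda>y. y [^] (q::nat)) ` T)"
  using assms
proof (induct T rule: finite_induct)
  case empty
  then show ?case using ideal_power_1[of "Idl {}"] by (simp add: genideal_ideal)
next
  case (insert x T)
  have x: "x \<in> carrier R" and T: "T \<subseteq> carrier R" using insert by auto
  have "ideal_power R (Idl (insert x T)) ((card T * q + 1) + q) \<subseteq> ideal_power R (Idl T) (card T * q + 1) <+> PIdl (x [^] q)"
    unfolding genideal_insert[OF T x] by (intro ideal_power_adjoin genideal_ideal T x)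
  also have "\<dots> \<subseteq> Idl ((\<lambda>y. y [^] q) ` T) <+> PIdl (x [^] q)"
    using insert(3)[OF T] by (intro set_add_mono) auto
  also have "\<dots> = Idl ((\<lambda>y. y [^] q) ` insert x T)"
    using T x by (subst image_insert, subst genideal_insert) auto
  finally show ?case using insert by (simp add: add_ac)
qed

end

text \<open>The characteristic enters as the equation p 1 = 0, which passes to
  localizations.\<close>

locale char_p_ring = cring +
  fixes p :: nat
  assumes p_prime: "Factorial_Ring.prime p" and char_p: "add_pow R p \<one> = \<zero>"
begin

lemma p_pos: "0 < p"
  using p_prime by (simp add: prime_gt_0_nat)

lemma freshman:
  assumes a: "a \<in> carrier R" and b: "b \<in> carrier R"
  shows "(a \<oplus> b) [^] p = a [^] p \<oplus> b [^] p"
proof -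
  let ?t = "\<lambda>k. add_pow R (p choose k) (a [^] k \<otimes> b [^] (p - k))"
  have c: "?t k \<in> carrier R" for k using a b by simp
  have zero: "?t k = \<zero>" if "k \<in> {..p} - {0, p}" for k
  proof -
    have "p dvd (p choose k)" using that p_prime by (intro dvd_choose_prime) auto
    then obtain m where m: "p choose k = p * m" by (rule dvdE)
    let ?y = "a [^] k \<otimes> b [^] (p - k)"
    have y: "?y \<in> carrier R" using a b by simp
    have "add_pow R p z = \<zero>" if "z \<in> carrier R" for z
      using add_pow_ldistr[of \<one> z p] char_p that by simp
    moreover have "?t k = add_pow R p (add_pow R m ?y)" unfolding m using y by (simp add: add.nat_pow_pow mult.commute)
    ultimately show ?thesis using y by simp
  qed
  have "(a \<oplus> b) [^] p = (\<Oplus>k\<in>{..p}. ?t k)" by (rule binomial_theorem[OF a b])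
  also have "\<dots> = (\<Oplus>k\<in>{0, p}. ?t k)"
    by (rule add.finprod_mono_neutral_cong_right) (use zero c in auto)
  also have "\<dots> = a [^] p \<oplus> b [^] p"
    using p_pos a b c by (simp add: a_comm)
  finally show ?thesis .
qed

lemma freshman_iterated:
  "a \<in> carrier R \<Longrightarrow> b \<in> carrier R \<Longrightarrow> (a \<oplus> b) [^] (p ^ e) = a [^] (p ^ e) \<oplus> b [^] (p ^ e)"
proof (induct e)
  case (Suc e)
  then show ?case
    using freshman[of "a [^] (p ^ e)" "b [^] (p ^ e)"] by (simp add: nat_pow_pow[symmetric] power_Suc2 del: power_Suc)
qed (simp add: nat_pow_eone)

text \<open>As the Frobenius is additive, the elements whose p^e-th power lies in a given ideal form
  an ideal; it suffices that it contains the generators.\<close>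

lemma frobenius_genideal:
  assumes T: "T \<subseteq> carrier R"
  shows "frobenius_power R (Idl T) (p ^ e) = Idl ((\<lambda>f. f [^] (p ^ e)) ` T)" (is "_ = ?I")
proof
  have I: "ideal ?I R" using T by (intro genideal_ideal) auto
  show "?I \<subseteq> frobenius_power R (Idl T) (p ^ e)"
    unfolding frobenius_power_def using genideal_self[OF T] ideal_subset[OF genideal_ideal[OF T]]
    by (intro genideal_mono) auto
  have "ideal {f \<in> carrier R. f [^] (p ^ e) \<in> ?I} R"
  proof (rule ideal_criterion)
    have "(0::nat) < p ^ e" using p_pos by simp
    then have "\<zero> [^] (p ^ e) = \<zero>" by (simp add: nat_pow_zero)
    then show "\<zero> \<in> {f \<in> carrier R. f [^] (p ^ e) \<in> ?I}" using ideal_zeroD[OF I] by simp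
  qed (auto simp: freshman_iterated nat_pow_distrib ideal_addD[OF I] ideal_lmultD[OF I])
  moreover have "T \<subseteq> {f \<in> carrier R. f [^] (p ^ e) \<in> ?I}"
    using T genideal_self[of "(\<lambda>f. f [^] (p ^ e)) ` T"] by auto
  ultimately have "Idl T \<subseteq> {f \<in> carrier R. f [^] (p ^ e) \<in> ?I}" by (rule genideal_minimal)
  then show "frobenius_power R (Idl T) (p ^ e) \<subseteq> ?I" using I by (intro frobenius_least) auto
qed

lemma frobenius_frobenius:
  assumes J: "ideal J R"
  shows "frobenius_power R (frobenius_power R J (p ^ e)) (p ^ e') = frobenius_power R J (p ^ (e + e'))"
proof -
  have Jc: "J \<subseteq> carrier R" using J by (rule ideal_subset)
  have "(\<lambda>f. f [^] (p ^ e')) ` (\<lambda>f. f [^] (p ^ e)) ` J = (\<lambda>f. f [^] (p ^ (e + e'))) ` J"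
    unfolding image_image using Jc by (intro image_cong refl) (auto simp: nat_pow_pow power_add)
  then show ?thesis
    using frobenius_genideal[of "(\<lambda>f. f [^] (p ^ e)) ` J" e'] Jc by (auto simp: frobenius_power_def[of R J])
qed

lemma frobenius_adjoin:
  assumes K: "ideal K R" and s: "s \<in> carrier R"
  shows "frobenius_power R (K <+> PIdl s) (p ^ e) = frobenius_power R K (p ^ e) <+> PIdl (s [^] (p ^ e))"
proof -
  have Kc: "K \<subseteq> carrier R" using K by (rule ideal_subset)
  have "K <+> PIdl s = Idl (insert s K)" using genideal_insert[OF Kc s] genideal_of_ideal[OF K] by simp
  then have "frobenius_power R (K <+> PIdl s) (p ^ e) = Idl (insert (s [^] (p ^ e)) ((\<lambda>f. f [^] (p ^ e)) ` K))"
    using frobenius_genideal[of "insert s K" e] Kc s by simp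
  also have "\<dots> = Idl ((\<lambda>f. f [^] (p ^ e)) ` K) <+> PIdl (s [^] (p ^ e))"
    using Kc s by (intro genideal_insert) auto
  finally show ?thesis by (simp add: frobenius_power_def)
qed

text \<open>\<open>L\<close> will be a high power of \<mm>, an error term that Krull's intersection
  theorem removes; hence \<open>L\<close> itself stands on the right.\<close>

lemma frobenius_sum:
  assumes K: "ideal K R" and L: "ideal L R"
  shows "frobenius_power R (K <+> L) (p ^ e) \<subseteq> frobenius_power R K (p ^ e) <+> L"
proof (rule frobenius_least)
  show "ideal (frobenius_power R K (p ^ e) <+> L) R"
    using K L by (intro add_ideals frobenius_ideal ideal_subset)
  fix f assume "f \<in> K <+> L"
  then obtain k l where f: "k \<in> K" "l \<in> L" "f = k \<oplus> l" unfolding mem_set_add by blast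
  have c: "k \<in> carrier R" "l \<in> carrier R" using f K L ideal_carrD by blast+
  have "f [^] (p ^ e) = k [^] (p ^ e) \<oplus> l [^] (p ^ e)" unfolding f(3) using c by (rule freshman_iterated)
  moreover have "k [^] (p ^ e) \<in> frobenius_power R K (p ^ e)" using f(1) K ideal_subset frobenius_powerI by blast
  moreover have "l [^] (p ^ e) \<in> L" using f(2) L p_pos pow_in_ideal by simp
  ultimately show "f [^] (p ^ e) \<in> frobenius_power R K (p ^ e) <+> L" unfolding mem_set_add by blast
qed

end

subsection \<open>Flatness of the Frobenius on a regular local ring\<close>

locale char_p_parameter_system = parameter_system + char_p_ring
begin

abbreviation "F J \<equiv> frobenius_power R J p"

lemma F_ideal: "ideal J R \<Longrightarrow> ideal (F J) R"
  by (intro frobenius_ideal ideal_subset)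

lemma frobenius_\<mm>: "frobenius_power R \<mm> (p ^ e) = power_ideal (\<lambda>_. p ^ e) {..<d}"
proof -
  have "x ` {..<d} \<subseteq> carrier R" using x_carr by auto
  then show ?thesis using frobenius_genideal[of "x ` {..<d}" e] by (simp add: x_gen image_image)
qed

lemma len_frobenius_\<mm>: "len (frobenius_power R \<mm> (p ^ e)) (carrier R) = enat ((p ^ e) ^ d)"
  unfolding frobenius_\<mm> using p_pos by (intro len_power_ideal) simp

lemma F_adjoin: "ideal K R \<Longrightarrow> s \<in> carrier R \<Longrightarrow> F (K <+> PIdl s) = F K <+> PIdl (s [^] p)"
  using frobenius_adjoin[of K s 1] by simp

text \<open>It shows that Frobenius powers of \<mm> have finite colength; at an associated prime,
  the same containment produces the bound by the dimension.\<close>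

lemma power_\<mm>_le_frobenius: "ideal_power R \<mm> (d * q + 1) \<subseteq> frobenius_power R \<mm> q"
proof -
  have x: "x ` {..<d} \<subseteq> carrier R" using x_carr by auto
  have "card (x ` {..<d}) \<le> d" using card_image_le[of "{..<d}" x] by simp
  then have "ideal_power R \<mm> (d * q + 1) \<subseteq> ideal_power R \<mm> (card (x ` {..<d}) * q + 1)"
    by (intro ideal_power_antimono \<mm>_ideal) simp
  also have "\<dots> \<subseteq> Idl ((\<lambda>y. y [^] q) ` x ` {..<d})"
    using ideal_power_genideal[OF _ x, of q] by (simp add: x_gen)
  also have "\<dots> \<subseteq> frobenius_power R \<mm> q"
    unfolding frobenius_power_def using x_mem \<mm>_ideal ideal_carrD by (intro genideal_mono) auto
  finally show ?thesis .
qed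

text \<open>L/K is climbed by socle elements s. As (K : s) = \<mm>, the ideal (F K : s^p) contains F
  \<mm>, so each step of length one costs at most p^d after F.\<close>

lemma len_F_le:
  assumes "ideal K R" "ideal_power R \<mm> n \<subseteq> K" and L: "ideal L R" and "K \<subseteq> L"
  shows "len (F K) (F L) \<le> enat (p ^ d) * len K L"
  using assms(1,2,4)
proof (induct rule: noetherian_induct)
  case (step K)
  show ?case
  proof (cases "K = L")
    case False
    then obtain s where s: "s \<in> L" "s \<notin> K" "colon K s = \<mm>"
      using socle_element[OF step(1) L _ step(3)] step(4) by blast
    have sc: "s \<in> carrier R" using s L ideal_carrD by blast
    let ?K = "K <+> PIdl s"
    have K: "ideal ?K R" using step(1) sc by (rule adjoin_ideal)
    have sub: "K \<subset> ?K" using adjoin_subset[OF step(1) sc] adjoin_self[OF step(1) sc] s by blast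
    have KL: "?K \<subseteq> L" using L step(4) s by (intro adjoin_least)
    have "len (F K) (F ?K) = len (colon (F K) (s [^] p)) (carrier R)"
      using F_adjoin[OF step(1) sc] len_adjoin[OF F_ideal[OF step(1)]] sc by simp
    also have "\<dots> \<le> len (F \<mm>) (carrier R)"
      using frobenius_colon_subset[OF step(1) sc, of p] s(3) by (intro len_mono) auto
    also have "\<dots> = enat (p ^ d)" using len_frobenius_\<mm>[of 1] by simp
    finally have 1: "len (F K) (F ?K) \<le> enat (p ^ d)" .
    have "len (F K) (F L) = len (F K) (F ?K) + len (F ?K) (F L)"
      using step(1) K L sub KL by (intro len_add F_ideal frobenius_mono ideal_subset) auto
    also have "\<dots> \<le> enat (p ^ d) + enat (p ^ d) * len ?K L"
      using 1 step(2)[OF K sub] step(3) sub KL by (intro add_mono) auto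
    also have "\<dots> = enat (p ^ d) * (len K ?K + len ?K L)"
      using len_adjoin_socle[OF step(1) sc s(3)] by (simp add: distrib_left)
    also have "\<dots> = enat (p ^ d) * len K L"
      using step(1) K L sub KL by (subst len_add[of K ?K L]) auto
    finally show ?thesis .
  qed (simp add: len_self)
qed

text \<open>Equality holds for \<open>\<mm>\<^sup>[\<^sup>q\<^sup>]\<close>, whose colength is known, hence for every ideal above it.\<close>

lemma len_F:
  assumes K: "ideal K R" and n: "ideal_power R \<mm> n \<subseteq> K"
  shows "len (F K) (carrier R) = enat (p ^ d) * len K (carrier R)"
proof -
  let ?M = "frobenius_power R \<mm> (p ^ n)"
  have M: "ideal ?M R" by (intro frobenius_ideal ideal_subset \<mm>_ideal)
  \<comment> \<open>This puts \<mm>^[p^n] inside \<mm>^n, hence inside K.\<close>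
  have "n \<le> p ^ n" using p_prime prime_ge_2_nat[of p] self_le_ge2_pow by blast
  then have "ideal_power R \<mm> (p ^ n) \<subseteq> K" using ideal_power_antimono[OF \<mm>_ideal] n by blast
  then have MK: "?M \<subseteq> K" using pow_in_ideal_power[OF \<mm>_ideal] by (intro frobenius_least K) blast
  have pow: "ideal_power R \<mm> (d * p ^ n + 1) \<subseteq> ?M" by (rule power_\<mm>_le_frobenius)
  have Kc: "K \<subseteq> carrier R" using K by (rule ideal_subset)
  have FM: "F ?M = frobenius_power R \<mm> (p ^ Suc n)" using frobenius_frobenius[OF \<mm>_ideal, of n 1] by simp
  have "len (F ?M) (carrier R) = enat (p ^ d) * len ?M (carrier R)"
    unfolding FM len_frobenius_\<mm> by (simp add: power_mult_distrib)
  moreover have "len (F ?M) (carrier R) = len (F ?M) (F K) + len (F K) (carrier R)"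
    using MK by (intro len_add F_ideal M K oneideal frobenius_mono Kc ideal_subset)
  moreover have "len ?M (carrier R) = len ?M K + len K (carrier R)"
    using MK by (intro len_add M K oneideal Kc)
  moreover have "len (F ?M) (F K) \<le> enat (p ^ d) * len ?M K"
    using len_F_le[OF M pow K MK] .
  moreover have "len (F K) (carrier R) \<le> enat (p ^ d) * len K (carrier R)"
    using len_F_le[OF K n oneideal Kc] frobenius_carrier by simp
  moreover have "len ?M (carrier R) \<noteq> \<infinity>" by (rule len_finite[OF M pow])
  \<comment> \<open>The upper bounds for K/M and R/K, where M = \<mm>^[p^n], add up to the equality
    known for R/M; since all lengths are finite, both bounds are attained.\<close>
  ultimately show ?thesis
    by (cases "len (F ?M) (F K)"; cases "len (F K) (carrier R)"; cases "len ?M K"; cases "len K (carrier R)")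
      (auto simp: distrib_left)
qed

text \<open>Subtracting the colengths of K + (s) from those of K, before and after F, shows that (F
  K : s^p) and F (K : s) have the same finite colength; one contains the other.\<close>

lemma F_colon_primary:
  assumes K: "ideal K R" and n: "ideal_power R \<mm> n \<subseteq> K" and s: "s \<in> carrier R"
  shows "colon (F K) (s [^] p) = F (colon K s)"
proof -
  let ?L = "K <+> PIdl s"
  have L: "ideal ?L R" and KL: "K \<subseteq> ?L" and c: "ideal (colon K s) R" and Kc: "K \<subseteq> colon K s"
    using K s adjoin_ideal adjoin_subset colon_ideal subset_colon by auto
  have nL: "ideal_power R \<mm> n \<subseteq> ?L" and nc: "ideal_power R \<mm> n \<subseteq> colon K s"
    using n KL Kc by auto
  have FL: "F ?L = F K <+> PIdl (s [^] p)" using F_adjoin[OF K s] .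
  have sp: "s [^] p \<in> carrier R" using s by simp
  have cF: "ideal (colon (F K) (s [^] p)) R" using F_ideal[OF K] sp by (rule colon_ideal)
  have sub: "F (colon K s) \<subseteq> colon (F K) (s [^] p)" using K s by (rule frobenius_colon_subset)
  have "len (F K) (carrier R) = len (colon (F K) (s [^] p)) (carrier R) + len (F ?L) (carrier R)"
    unfolding len_adjoin[OF F_ideal[OF K] sp, symmetric] FL[symmetric]
    by (intro len_add F_ideal K L oneideal frobenius_mono KL ideal_subset)
  moreover have "len K (carrier R) = len (colon K s) (carrier R) + len ?L (carrier R)"
    unfolding len_adjoin[OF K s, symmetric] by (intro len_add K L oneideal KL ideal_subset)
  moreover have "len (F (colon K s)) (carrier R) 
      = len (F (colon K s)) (colon (F K) (s [^] p)) + len (colon (F K) (s [^] p)) (carrier R)"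
    by (intro len_add F_ideal c cF oneideal sub ideal_subset)
  moreover have "len K (carrier R) \<noteq> \<infinity>" using len_finite K n by blast
  moreover note len_F[OF K n] len_F[OF L nL] len_F[OF c nc]
  ultimately have "len (F (colon K s)) (colon (F K) (s [^] p)) = 0"
    by (cases "len (F (colon K s)) (colon (F K) (s [^] p))"; cases "len (colon K s) (carrier R)"; 
        cases "len ?L (carrier R)"; cases "len (colon (F K) (s [^] p)) (carrier R)")
      (auto simp: distrib_left zero_enat_def)
  then show ?thesis using len_eq_0_iff[OF F_ideal[OF c] cF sub] by simp
qed

text \<open>Enlarging K to the \<mm>-primary ideal K + L allows the previous lemma and changes (K :
  s) only by \<mm>^t, with t arbitrary.\<close>

lemma F_colon:
  assumes K: "ideal K R" and s: "s \<in> carrier R"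
  shows "colon (F K) (s [^] p) \<subseteq> F (colon K s)"
proof
  fix f assume f: "f \<in> colon (F K) (s [^] p)"
  have c: "ideal (colon K s) R" using K s by (rule colon_ideal)
  show "f \<in> F (colon K s)"
  proof (rule krull_intersection)
    show "ideal (F (colon K s)) R" using c by (rule F_ideal)
    show "f \<in> carrier R" using f by (simp add: mem_colon)
    fix t
    obtain L n where L: "ideal L R" "ideal_power R \<mm> n \<subseteq> L" 
      "colon (K <+> L) s \<subseteq> colon K s <+> ideal_power R \<mm> t"
      using weak_artin_rees[OF K s \<mm>_ideal] .
    have KL: "ideal (K <+> L) R" using K L by (simp add: add_ideals)
    have pow: "ideal_power R \<mm> n \<subseteq> K <+> L" using L(2) subset_set_add2[OF K L(1)] by blast
    have mt: "ideal (ideal_power R \<mm> t) R" using \<mm>_ideal by (rule ideal_power_ideal)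
    have "colon (F K) (s [^] p) \<subseteq> colon (F (K <+> L)) (s [^] p)"
      by (intro colon_mono frobenius_mono subset_set_add1 K L ideal_subset KL)
    also have "\<dots> = F (colon (K <+> L) s)" using KL pow s by (rule F_colon_primary)
    also have "\<dots> \<subseteq> F (colon K s <+> ideal_power R \<mm> t)"
      by (intro frobenius_mono L ideal_subset add_ideals c mt)
    also have "\<dots> \<subseteq> F (colon K s) <+> ideal_power R \<mm> t"
      using frobenius_sum[OF c mt, of 1] by simp
    finally show "f \<in> F (colon K s) <+> ideal_power R \<mm> t" using f by blast
  qed
qed

end

section \<open>Flatness of the Frobenius on a regular ring\<close>

text \<open>A finite supremum in \<open>enat\<close> bounds a finite set and is its maximum. The
  witness \<open>n0\<close> excludes the empty set, whose supremum 0 is not attained. Applied to the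
  Krull dimension, it provides a chain of full length.\<close>

lemma enat_Sup_attained:
  assumes Sup: "Sup {enat n | n. \<Phi> n} = enat d" and "\<Phi> n0"
  shows "\<Phi> d"
proof -
  let ?S = "{enat n | n. \<Phi> n}"
  have le: "x \<le> enat d" if "x \<in> ?S" for x
    unfolding Sup[symmetric] using that by (rule Sup_upper)
  have "?S \<subseteq> enat ` {..d}"
  proof
    fix x assume x: "x \<in> ?S"
    then obtain n where "x = enat n" by blast
    with le[OF x] show "x \<in> enat ` {..d}" by auto
  qed
  then have fin: "finite ?S" by (rule finite_subset) simp
  have ne: "?S \<noteq> {}" using assms(2) by blast
  have "enat d \<in> ?S" unfolding Sup[symmetric] Max_Sup[OF fin ne, symmetric] using fin ne by (rule Max_in)
  then show ?thesis by auto
qed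

lemma (in noetherian_local) parameter_system_exists:
  assumes reg: "regular_local_ring R"
  shows "\<exists>x. parameter_system R \<mm> (min_generators R \<mm>) x"
proof -
  let ?d = "min_generators R \<mm>"
  obtain B0 where B0: "B0 \<subseteq> carrier R" "finite B0" "\<mm> = Idl B0" using finetely_gen[OF \<mm>_ideal] by blast
  have "\<exists>B \<subseteq> carrier R. finite B \<and> card B = ?d \<and> Idl B = \<mm>"
    unfolding min_generators_def by (rule LeastI_ex) (use B0 in blast)
  then obtain B where B: "B \<subseteq> carrier R" "finite B" "card B = ?d" "Idl B = \<mm>" by blast
  obtain x where x: "bij_betw x {0..<?d} B" using ex_bij_betw_nat_finite[OF B(2)] B(3) by auto
  have xB: "x ` {..<?d} = B" using x by (simp add: bij_betw_def lessThan_atLeast0)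
  have "Sup {enat n | n. \<exists>Q. prime_chain R n Q} = enat ?d"
    using reg maximal by (simp add: regular_local_ring_def krull_dim_def)
  moreover have "\<exists>Q. prime_chain R 0 Q" using \<mm>_prime by (auto simp: prime_chain_def)
  ultimately have "\<exists>Q. prime_chain R ?d Q" by (rule enat_Sup_attained)
  moreover have "x i \<in> carrier R" if "i < ?d" for i using that xB B(1) by auto
  ultimately have "parameter_system R \<mm> ?d x"
    using xB B(4) by unfold_locales auto
  then show ?thesis by blast
qed

section \<open>Dimension, ideal powers and generators under localization\<close>

context localization_at_prime begin

text \<open>In a regular ring this is dim R_P, but as a natural number rather than an
  \<open>enat\<close>.\<close>

definition local_dim :: nat where "local_dim = min_generators A (ext P)"

lemma \<iota>_add_pow: "a \<in> carrier R \<Longrightarrow> \<iota> (add_pow R (n::nat) a) = add_pow A n (\<iota> a)"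
  by (induct n) (simp_all add: \<iota>_add zero_A)

lemma ext_genideal:
  assumes T: "T \<subseteq> carrier R"
  shows "ext (Idl T) = Idl\<^bsub>A\<^esub> (\<iota> ` T)"
proof
  have T': "\<iota> ` T \<subseteq> carrier A" using T \<iota>_closed by blast
  have I: "ideal (Idl\<^bsub>A\<^esub> (\<iota> ` T)) A" using T' by (rule A.genideal_ideal)
  have "Idl T \<subseteq> contr (Idl\<^bsub>A\<^esub> (\<iota> ` T))"
    using T A.genideal_self[OF T'] by (intro genideal_minimal contr_ideal I) (auto simp: contr_def)
  then show "ext (Idl T) \<subseteq> Idl\<^bsub>A\<^esub> (\<iota> ` T)"
    by (intro ext_least I) (auto simp: contr_def)
  show "Idl\<^bsub>A\<^esub> (\<iota> ` T) \<subseteq> ext (Idl T)"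
    using T genideal_self[OF T] ideal_subset[OF genideal_ideal[OF T]]
    by (intro A.genideal_minimal ext_ideal) (auto intro: \<iota>_in_ext)
qed

lemma \<iota>_ideal_power:
  assumes K: "ideal K R" and "y \<in> ideal_power R K n"
  shows "\<iota> y \<in> ideal_power A (ext K) n"
proof -
  have E: "ideal (ext K) A" using K ideal_subset ext_ideal by blast
  have "ideal_power R K n \<subseteq> contr (ideal_power A (ext K) n)"
  proof (induct n)
    case 0
    then show ?case using \<iota>_closed by (auto simp: ideal_power_0 A.ideal_power_0 contr_def)
  next
    case (Suc n)
    show ?case unfolding ideal_power_Suc
    proof (rule ideal_prod_least[OF contr_ideal[OF A.ideal_power_ideal[OF E]]])
      fix a b assume ab: "a \<in> ideal_power R K n" "b \<in> K"
      then have c: "a \<in> carrier R" "b \<in> carrier R"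
        using K ideal_power_ideal ideal_carrD by blast+
      have "\<iota> b \<in> ext K" using ab(2) K ideal_subset \<iota>_in_ext by blast
      then show "a \<otimes> b \<in> contr (ideal_power A (ext K) (Suc n))"
        using Suc ab c by (auto simp: contr_def A.ideal_power_Suc \<iota>_mult intro: A.ideal_prodI)
    qed
  qed
  then show ?thesis using assms(2) by (auto simp: contr_def)
qed

text \<open>Primes of R_P contract into P; the last one is replaced by P, since
  \<open>height\<close> counts chains ending exactly there.\<close>

lemma prime_chain_le_height:
  assumes "prime_chain A n Q"
  shows "enat n \<le> height R P"
proof -
  define Q' where "Q' = (\<lambda>i. if i = n then P else contr (Q i))"
  have Q: "primeideal (Q i) A" if "i \<le> n" for i using assms that by (simp add: prime_chain_def)
  have "Q' i \<subset> Q' (Suc i)" if i: "i < n" for i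
  proof -
    have "contr (Q i) \<subset> contr (Q (Suc i))"
      using assms i Q[of i] Q[of "Suc i"] A.prime_ideal
      by (intro contr_strict) (auto simp: prime_chain_def)
    moreover have "contr (Q (Suc i)) \<subseteq> P"
    proof (rule proper_disjoint)
      show "ideal (Q (Suc i)) A" using Q[of "Suc i"] i A.prime_ideal by simp
      show "Q (Suc i) \<noteq> carrier A" using primeideal.I_notcarr[OF Q[of "Suc i"]] i by auto
    qed
    ultimately show ?thesis using i by (auto simp: Q'_def)
  qed
  then have "prime_chain R n Q'"
    using Q contr_prime P_prime by (auto simp: prime_chain_def Q'_def)
  moreover have "Q' n = P" by (simp add: Q'_def)
  ultimately show ?thesis unfolding height_def by (intro Sup_upper) blast
qed

end

locale regular_char_p = char_p_ring +
  assumes regular: "regular_ring R"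

sublocale regular_char_p \<subseteq> noetherian_cring
  using regular unfolding regular_ring_def noetherian_cring_def by blast

context regular_char_p begin

lemma localization: "primeideal P R \<Longrightarrow> localization_at_prime R P"
  by (intro localization_at_prime.intro is_cring localization_at_prime_axioms.intro)

abbreviation "dim_at P \<equiv> localization_at_prime.local_dim R P"

lemma local_parameters:
  assumes P: "primeideal P R"
  shows "\<exists>x. char_p_parameter_system (local_at R P) (localization_at_prime.ext R P P) (dim_at P) x p"
proof -
  interpret L: localization_at_prime R P using P by (rule localization)
  interpret A: noetherian_local L.A "L.ext P" using P by (rule noetherian_local_at)
  have "regular_local_ring L.A" using regular P by (simp add: regular_ring_def)
  then obtain x where "parameter_system L.A (L.ext P) L.local_dim x"
    using A.parameter_system_exists unfolding L.local_dim_def by blast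
  moreover have "add_pow L.A p \<one>\<^bsub>L.A\<^esub> = \<zero>\<^bsub>L.A\<^esub>"
    using L.\<iota>_add_pow[of \<one> p] char_p by (simp add: L.one_A L.zero_A)
  then have "char_p_ring L.A p"
    using p_prime L.A_cring by (intro char_p_ring.intro char_p_ring_axioms.intro)
  ultimately show ?thesis
    unfolding char_p_parameter_system_def by blast
qed

lemma dim_at_le_height:
  assumes P: "primeideal P R"
  shows "enat (dim_at P) \<le> height R P"
proof -
  interpret L: localization_at_prime R P using P by (rule localization)
  obtain x where "char_p_parameter_system L.A (L.ext P) L.local_dim x p"
    using local_parameters[OF P] by blast
  then interpret A: char_p_parameter_system L.A "L.ext P" L.local_dim x p .
  show ?thesis using A.chain_ex L.prime_chain_le_height by blast
qed

text \<open>Both sides are generated by the images of p^e-th powers from K; for the right side this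
  rests on \<open>frobenius_genideal\<close> in R_P.\<close>

lemma frobenius_ext:
  assumes P: "primeideal P R" and K: "ideal K R"
  shows "localization_at_prime.ext R P (frobenius_power R K (p ^ e)) 
    = frobenius_power (local_at R P) (localization_at_prime.ext R P K) (p ^ e)"
proof -
  interpret L: localization_at_prime R P using P by (rule localization)
  obtain x where "char_p_parameter_system L.A (L.ext P) L.local_dim x p"
    using local_parameters[OF P] by blast
  then interpret A: char_p_parameter_system L.A "L.ext P" L.local_dim x p .
  have Kc: "K \<subseteq> carrier R" using K by (rule ideal_subset)
  have "L.ext (frobenius_power R K (p ^ e)) = Idl\<^bsub>L.A\<^esub> (L.\<iota> ` (\<lambda>f. f [^] (p ^ e)) ` K)"
    unfolding frobenius_power_def using Kc by (intro L.ext_genideal) auto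
  also have "L.\<iota> ` (\<lambda>f. f [^] (p ^ e)) ` K = (\<lambda>f. f [^]\<^bsub>L.A\<^esub> (p ^ e)) ` L.\<iota> ` K"
    unfolding image_image using Kc by (intro image_cong refl L.\<iota>_pow) auto
  also have "Idl\<^bsub>L.A\<^esub> \<dots> = frobenius_power L.A (Idl\<^bsub>L.A\<^esub> (L.\<iota> ` K)) (p ^ e)"
    using Kc L.\<iota>_closed by (intro A.frobenius_genideal[symmetric]) auto
  finally show ?thesis by (simp add: L.ext_def)
qed

text \<open>The inclusion that expresses flatness is local: if f were not in (K : s)^[p], a prime P
  over ((K : s)^[p] : f) would exist, and the formula in R_P gives a multiplier of f outside
  P.\<close>

theorem frobenius_colon:
  assumes K: "ideal K R" and s: "s \<in> carrier R"
  shows "colon (frobenius_power R K p) (s [^] p) = frobenius_power R (colon K s) p"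
proof
  show "frobenius_power R (colon K s) p \<subseteq> colon (frobenius_power R K p) (s [^] p)"
    using K s by (rule frobenius_colon_subset)
  have c: "ideal (colon K s) R" using K s by (rule colon_ideal)
  have F: "ideal (frobenius_power R (colon K s) p) R" by (intro frobenius_ideal ideal_subset c)
  have FK: "ideal (frobenius_power R K p) R" by (intro frobenius_ideal ideal_subset K)
  show "colon (frobenius_power R K p) (s [^] p) \<subseteq> frobenius_power R (colon K s) p"
  proof
    fix f assume "f \<in> colon (frobenius_power R K p) (s [^] p)"
    then have f: "f \<in> carrier R" "f \<otimes> s [^] p \<in> frobenius_power R K p" by (auto simp: mem_colon)
    let ?W = "colon (frobenius_power R (colon K s) p) f"
    have W: "ideal ?W R" using F f by (intro colon_ideal)
    have "?W = carrier R"
    proof (rule ccontr)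
      assume "?W \<noteq> carrier R"
      then obtain P where P: "primeideal P R" "?W \<subseteq> P" by (rule prime_above[OF W])
      interpret L: localization_at_prime R P using P(1) by (rule localization)
      obtain x where "char_p_parameter_system L.A (L.ext P) L.local_dim x p"
        using local_parameters[OF P(1)] by blast
      then interpret A: char_p_parameter_system L.A "L.ext P" L.local_dim x p .
      have ext: "L.ext (frobenius_power R J p) = frobenius_power L.A (L.ext J) p" if "ideal J R" for J
        using frobenius_ext[OF P(1) that, of 1] by simp
      have "L.\<iota> (f \<otimes> s [^] p) \<in> L.ext (frobenius_power R K p)"
        using f FK ideal_subset L.\<iota>_in_ext by blast
      then have "L.\<iota> f \<otimes>\<^bsub>L.A\<^esub> (L.\<iota> s [^]\<^bsub>L.A\<^esub> p) \<in> A.F (L.ext K)"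
        using f s ext[OF K] by (simp add: L.\<iota>_mult L.\<iota>_pow)
      then have "L.\<iota> f \<in> L.A.colon (A.F (L.ext K)) (L.\<iota> s [^]\<^bsub>L.A\<^esub> p)"
        using f L.\<iota>_closed by (simp add: L.A.mem_colon)
      then have "L.\<iota> f \<in> A.F (L.A.colon (L.ext K) (L.\<iota> s))"
        using A.F_colon[OF L.ext_ideal[OF ideal_subset[OF K]] L.\<iota>_closed[OF s]] by blast
      then have "L.\<iota> f \<in> L.ext (frobenius_power R (colon K s) p)"
        using L.colon_ext[OF K s] ext[OF c] by simp
      then obtain u where "u \<in> L.S" "u \<otimes> f \<in> frobenius_power R (colon K s) p"
        using L.\<iota>_in_ext_iff[OF F f(1)] by blast
      then show False using P(2) by (auto simp: mem_colon)
    qed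
    then show "f \<in> frobenius_power R (colon K s) p" using colon_eq_carrier[OF F f(1)] by simp
  qed
qed

text \<open>The colon formula with s = f makes (K : f)^[p], and with it (K : f), the unit
  ideal.\<close>

lemma frobenius_closed:
  assumes K: "ideal K R" and f: "f \<in> carrier R" and "f [^] p \<in> frobenius_power R K p"
  shows "f \<in> K"
proof -
  have "colon (frobenius_power R K p) (f [^] p) = carrier R"
    using assms by (simp add: colon_eq_carrier frobenius_ideal ideal_subset)
  then have "carrier R \<subseteq> colon K f"
    using frobenius_colon[OF K f] frobenius_subset[OF colon_ideal[OF K f] p_pos] by simp
  then show ?thesis using colon_eq_carrier[OF K f] by (auto simp: mem_colon)
qed

lemma frobenius_regular_element:
  assumes J: "ideal J R" and s: "s \<in> carrier R" and "colon J s = J"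
  shows "colon (frobenius_power R J (p ^ e)) (s [^] (p ^ e)) = frobenius_power R J (p ^ e)"
proof (induct e)
  case 0
  then show ?case using assms frobenius_1[OF J] by (simp add: nat_pow_eone)
next
  case (Suc e)
  have F: "ideal (frobenius_power R J (p ^ e)) R" by (intro frobenius_ideal ideal_subset J)
  have pow: "s [^] (p ^ Suc e) = (s [^] (p ^ e)) [^] p"
    using s by (simp add: nat_pow_pow mult.commute)
  have "frobenius_power R J (p ^ Suc e) = frobenius_power R (frobenius_power R J (p ^ e)) p"
    using frobenius_frobenius[OF J, of e 1] by simp
  then show ?case
    unfolding pow using frobenius_colon[OF F, of "s [^] (p ^ e)"] s Suc by simp
qed

end

section \<open>Associated primes and symbolic powers\<close>

context cring begin

text \<open>The exponent 0 is harmless, since 1 in J already means J = R.\<close>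

definition radical_ideal :: "'a set \<Rightarrow> bool"
  where "radical_ideal J \<longleftrightarrow> ideal J R \<and> (\<forall>x\<in>carrier R. \<forall>n::nat. x [^] n \<in> J \<longrightarrow> x \<in> J)"

lemma radical_idealD: "radical_ideal J \<Longrightarrow> x \<in> carrier R \<Longrightarrow> x [^] (n::nat) \<in> J \<Longrightarrow> x \<in> J"
  by (auto simp: radical_ideal_def)

lemma mem_Ass: "P \<in> Ass R J \<longleftrightarrow> primeideal P R \<and> (\<exists>x\<in>carrier R. P = colon J x)"
  by (simp add: Ass_def colon_def)

lemma Ass_prime: "P \<in> Ass R J \<Longrightarrow> primeideal P R"
  by (simp add: Ass_def)

text \<open>If x were in P = (J : x), then x^2 and hence x would lie in J, and P would contain 1.
  With x outside P and x P inside J, the ideals J and P agree locally at P.\<close>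

lemma Ass_radicalE:
  assumes J: "radical_ideal J" and P: "P \<in> Ass R J"
  obtains x where "x \<in> carrier R" "x \<notin> P" "P = colon J x"
proof -
  obtain x where x: "x \<in> carrier R" "P = colon J x" using P mem_Ass by blast
  have "x \<notin> P"
  proof
    assume "x \<in> P"
    then have "x [^] (2::nat) \<in> J" using x by (simp add: mem_colon numeral_2_eq_2)
    then have "x \<in> J" using J x(1) radical_idealD by blast
    then have "\<one> \<in> P" using x by (simp add: mem_colon)
    then show False using P Ass_prime prime_one by blast
  qed
  then show ?thesis using that x by blast
qed

lemma Ass_superset: "ideal J R \<Longrightarrow> P \<in> Ass R J \<Longrightarrow> J \<subseteq> P"
  using mem_Ass subset_colon by metis

text \<open>A radical ideal has no embedded primes: P x lies in J and so in Q, while x is not in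
  Q.\<close>

lemma Ass_minimal:
  assumes J: "radical_ideal J" and P: "P \<in> Ass R J" and Q: "primeideal Q R" "J \<subseteq> Q" "Q \<subseteq> P"
  shows "Q = P"
proof -
  obtain x where x: "x \<in> carrier R" "x \<notin> P" "P = colon J x" using Ass_radicalE[OF J P] .
  have "y \<in> Q" if y: "y \<in> P" for y
  proof -
    have "y \<in> carrier R" "y \<otimes> x \<in> Q" using y x(3) Q(2) by (auto simp: mem_colon)
    then show ?thesis using primeD[OF Q(1) _ _ x(1)] x(2) Q(3) by blast
  qed
  then show ?thesis using Q(3) by blast
qed

lemma avoid_one_prime:
  assumes "finite \<P>" "\<And>Q. Q \<in> \<P> \<Longrightarrow> ideal Q R \<and> \<not> Q \<subseteq> P" "primeideal P R" "ideal W R" "\<not> W \<subseteq> P"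
  shows "\<exists>t\<in>W. t \<notin> P \<and> (\<forall>Q\<in>\<P>. t \<in> Q)"
  using assms(1,2)
proof (induct \<P> rule: finite_induct)
  case empty
  then show ?case using assms(5) by auto
next
  case (insert Q \<P>)
  then obtain t where t: "t \<in> W" "t \<notin> P" "\<forall>Q\<in>\<P>. t \<in> Q" by auto
  obtain u where u: "u \<in> Q" "u \<notin> P" using insert by blast
  have c: "t \<in> carrier R" "u \<in> carrier R" using t u insert(4) assms(4) ideal_carrD by blast+
  have "t \<otimes> u \<notin> P" using primeD[OF assms(3)] t u c by blast
  moreover have "t \<otimes> u \<in> W" using assms(4) t(1) c(2) by (rule ideal_rmultD)
  moreover have "t \<otimes> u \<in> Q" using insert(4)[of Q] u(1) c(1) by (simp add: ideal_lmultD)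
  moreover have "t \<otimes> u \<in> Q'" if "Q' \<in> \<P>" for Q'
    using that t(3) c(2) insert(4)[of Q'] by (simp add: ideal_rmultD)
  ultimately show ?case by auto
qed

text \<open>Incomparability yields some t in W that lies in all older primes but not in the new P.
  If s, which avoids the older ones, falls into P, then s + t avoids them all.\<close>

lemma prime_avoidance_antichain:
  assumes "finite \<P>" "\<And>P. P \<in> \<P> \<Longrightarrow> primeideal P R" "\<And>P. P \<in> \<P> \<Longrightarrow> \<not> W \<subseteq> P"
    "\<And>P Q. P \<in> \<P> \<Longrightarrow> Q \<in> \<P> \<Longrightarrow> P \<subseteq> Q \<Longrightarrow> P = Q" and W: "ideal W R"
  shows "\<exists>s\<in>W. \<forall>P\<in>\<P>. s \<notin> P"
  using assms(1-4)
proof (induct \<P> rule: finite_induct)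
  case empty
  then show ?case using ideal_zeroD[OF W] by blast
next
  case (insert P \<P>)
  have "\<exists>s\<in>W. \<forall>Q\<in>\<P>. s \<notin> Q" by (rule insert(3)) (use insert(4-6) in auto)
  then obtain s where s: "s \<in> W" "\<forall>Q\<in>\<P>. s \<notin> Q" by blast
  show ?case
  proof (cases "s \<in> P")
    case True
    have "\<exists>t\<in>W. t \<notin> P \<and> (\<forall>Q\<in>\<P>. t \<in> Q)"
    proof (rule avoid_one_prime[OF insert(1) _ _ W])
      show "ideal Q R \<and> \<not> Q \<subseteq> P" if "Q \<in> \<P>" for Q
        using that insert(2) insert(4)[of Q] insert(6)[of Q P] prime_ideal by auto
    qed (use insert in auto)
    then obtain t where t: "t \<in> W" "t \<notin> P" "\<forall>Q\<in>\<P>. t \<in> Q" by blast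
    have c: "s \<in> carrier R" "t \<in> carrier R" using s t W ideal_carrD by blast+
    have Pi: "ideal P R" using insert(4) prime_ideal by blast
    have "t \<oplus> s \<notin> P" using ideal_diff_cancel[OF Pi _ True c(2)] t(2) by blast
    moreover have "s \<oplus> t \<notin> Q" if "Q \<in> \<P>" for Q
      using ideal_diff_cancel[of Q s t] that insert(4)[of Q] prime_ideal s t c by blast
    moreover have "s \<oplus> t = t \<oplus> s" using c by (rule a_comm)
    moreover have "s \<oplus> t \<in> W" using s t W ideal_addD by blast
    ultimately show ?thesis by auto
  qed (use s in blast)
qed

section \<open>Symbolic powers\<close>

lemma symbolic_power_iff:
  assumes J: "ideal J R"
  shows "f \<in> symbolic_power R J n \<longleftrightarrow>
    f \<in> carrier R \<and> (\<forall>P\<in>Ass R J. \<exists>u\<in>carrier R - P. u \<otimes> f \<in> ideal_power R J n)"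
proof -
  have "f \<in> loc_contract R P (ideal_power R J n) \<longleftrightarrow> f \<in> carrier R \<and> (\<exists>u\<in>carrier R - P. u \<otimes> f \<in> ideal_power R J n)"
    if "P \<in> Ass R J" for P
  proof -
    interpret L: localization_at_prime R P
      by (intro localization_at_prime.intro is_cring localization_at_prime_axioms.intro Ass_prime[OF that])
    show ?thesis using J by (intro L.loc_contract_iff ideal_power_ideal)
  qed
  then show ?thesis by (auto simp: symbolic_power_def)
qed

lemma ideal_power_le_symbolic:
  assumes J: "ideal J R"
  shows "ideal_power R J n \<subseteq> symbolic_power R J n"
proof
  fix f assume f: "f \<in> ideal_power R J n"
  then have "f \<in> carrier R" using J ideal_power_ideal ideal_carrD by blast
  then show "f \<in> symbolic_power R J n"
    unfolding symbolic_power_iff[OF J] using f Ass_prime prime_one by (auto intro!: bexI[of _ \<one>])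
qed

lemma ideal_power_pow:
  assumes J: "ideal J R" and "f \<in> ideal_power R J n"
  shows "f [^] (m::nat) \<in> ideal_power R J (n * m)"
proof (induct m)
  case 0
  then show ?case by (simp add: ideal_power_0)
next
  case (Suc m)
  have "f [^] m \<otimes> f \<in> ideal_power R J (n * m) \<cdot> ideal_power R J n"
    using Suc assms(2) by (rule ideal_prodI)
  then show ?case using ideal_power_add[OF J, of "n * m" n] by (simp add: add.commute)
qed

text \<open>This is the property of the filtration that makes \<nu>(p^e)/p^e nondecreasing; the
  multiplier u is raised to the m-th power and stays outside P.\<close>

lemma symbolic_power_pow:
  assumes J: "ideal J R" and f: "f \<in> symbolic_power R J n"
  shows "f [^] (m::nat) \<in> symbolic_power R J (n * m)"
  unfolding symbolic_power_iff[OF J]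
proof (intro conjI ballI)
  have fc: "f \<in> carrier R" using f symbolic_power_iff[OF J] by blast
  then show "f [^] m \<in> carrier R" by simp
  fix P assume P: "P \<in> Ass R J"
  then obtain u where u: "u \<in> carrier R - P" "u \<otimes> f \<in> ideal_power R J n"
    using f symbolic_power_iff[OF J] by blast
  have "u [^] m \<otimes> f [^] m = (u \<otimes> f) [^] m" using u fc by (simp add: nat_pow_distrib)
  then have "u [^] m \<otimes> f [^] m \<in> ideal_power R J (n * m)" using ideal_power_pow[OF J u(2)] by simp
  moreover have "u [^] m \<in> carrier R - P" using u prime_powD[OF Ass_prime[OF P]] by auto
  ultimately show "\<exists>u\<in>carrier R - P. u \<otimes> f [^] m \<in> ideal_power R J (n * m)" by blast
qed

end

context noetherian_cring begin

text \<open>Among the elements that do not vanish in (R/J)_P, one with maximal annihilator (J : w)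
  is chosen; this annihilator is prime, and it lies in P because w survives there.\<close>

lemma Ass_below:
  assumes J: "ideal J R" and P: "primeideal P R" and z: "z \<in> carrier R"
    and zP: "\<And>u. u \<in> carrier R - P \<Longrightarrow> u \<otimes> z \<notin> J"
  shows "\<exists>W\<in>Ass R J. W \<subseteq> P"
proof -
  let ?ok = "\<lambda>z. z \<in> carrier R \<and> (\<forall>u\<in>carrier R - P. u \<otimes> z \<notin> J)"
  obtain M where "M \<in> colon J ` {z. ?ok z}" and max: "\<And>I. I \<in> colon J ` {z. ?ok z} \<Longrightarrow> M \<subseteq> I \<Longrightarrow> I = M"
    by (rule maximal_ideal_exists[of "colon J ` {z. ?ok z}"]) (use z zP colon_ideal[OF J] in auto)
  then obtain w where w: "?ok w" "M = colon J w" by blast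
  have wc: "w \<in> carrier R" using w by blast
  have Mi: "ideal M R" unfolding w(2) using J wc by (rule colon_ideal)
  have eq: "colon J (u \<otimes> w) = M" if "u \<in> carrier R" "?ok (u \<otimes> w)" for u
  proof -
    have "M \<subseteq> colon J (u \<otimes> w)"
    proof
      fix r assume "r \<in> M"
      then have r: "r \<in> carrier R" "r \<otimes> w \<in> J" unfolding w(2) mem_colon by auto
      have "r \<otimes> (u \<otimes> w) = u \<otimes> (r \<otimes> w)" using r(1) that(1) wc by algebra
      then show "r \<in> colon J (u \<otimes> w)" using r that(1) ideal_lmultD[OF J r(2)] by (simp add: mem_colon)
    qed
    then show ?thesis using max that by blast
  qed
  have "M \<subseteq> P" unfolding w(2) using w(1) by (auto simp: mem_colon)
  moreover have "primeideal M R"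
  proof (rule primeidealI[OF Mi is_cring])
    have "\<one> \<in> carrier R - P" using prime_one[OF P] by simp
    then show "carrier R \<noteq> M" using \<open>M \<subseteq> P\<close> by blast
    fix r t assume rt: "r \<in> carrier R" "t \<in> carrier R" "r \<otimes> t \<in> M"
    then have rtw: "r \<otimes> (t \<otimes> w) \<in> J" using wc unfolding w(2) by (simp add: mem_colon m_assoc)
    \<comment> \<open>If t w survives at P, its annihilator is M by maximality and contains r.
      Otherwise u t w lies in J for some u outside P, and t lies in (J : u w), which is again
      M.\<close>
    show "r \<in> M \<or> t \<in> M"
    proof (cases "?ok (t \<otimes> w)")
      case True
      have "r \<in> colon J (t \<otimes> w)" using rt rtw by (simp add: mem_colon)
      then show ?thesis using eq[OF rt(2) True] by simp
    next
      case False
      then obtain u where u: "u \<in> carrier R - P" "u \<otimes> (t \<otimes> w) \<in> J" using rt wc by auto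
      have uc: "u \<in> carrier R" using u by simp
      have "v \<otimes> (u \<otimes> w) \<notin> J" if "v \<in> carrier R - P" for v
      proof -
        have "v \<otimes> u \<in> carrier R - P" using that u primeD[OF P, of v u] by auto
        then have "(v \<otimes> u) \<otimes> w \<notin> J" using w(1) by blast
        then show ?thesis using that uc wc by (simp add: m_assoc)
      qed
      then have "colon J (u \<otimes> w) = M" using uc wc by (intro eq) auto
      moreover have "t \<otimes> (u \<otimes> w) = u \<otimes> (t \<otimes> w)" using rt(2) uc wc by algebra
      then have "t \<in> colon J (u \<otimes> w)" using rt u by (simp add: mem_colon)
      ultimately show ?thesis by blast
    qed
  qed
  ultimately show ?thesis using w wc mem_Ass by blast
qed

lemma Ass_below_prime:
  assumes J: "ideal J R" and P: "primeideal P R" "J \<subseteq> P"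
  shows "\<exists>W\<in>Ass R J. W \<subseteq> P"
  using P by (intro Ass_below[OF J P(1) one_closed]) auto

text \<open>An associated prime contains a member of any list of primes over J whose product lies in
  J, and by minimality it equals that member.\<close>

lemma finite_Ass_radical:
  assumes J: "radical_ideal J"
  shows "finite (Ass R J)"
proof -
  have Ji: "ideal J R" using J by (simp add: radical_ideal_def)
  obtain Ps where Ps: "\<forall>P\<in>set Ps. primeideal P R \<and> J \<subseteq> P" "foldr (ideal_prod R) Ps (carrier R) \<subseteq> J"
    using contains_prime_product[OF Ji] by blast
  have "Ass R J \<subseteq> set Ps"
  proof
    fix P assume P: "P \<in> Ass R J"
    have "foldr (ideal_prod R) Ps (carrier R) \<subseteq> P" using Ps(2) Ass_superset[OF Ji P] by blast
    then obtain Q where Q: "Q \<in> set Ps" "Q \<subseteq> P"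
      using prime_contains_product[OF Ass_prime[OF P]] Ps(1) prime_ideal by blast
    then show "P \<in> set Ps" using Ass_minimal[OF J P] Ps(1) by blast
  qed
  then show ?thesis by (rule finite_subset) simp
qed

text \<open>If a s is in J, then a lies in every associated prime, hence in every prime of a list
  whose product lies in J; a power of a is then in J.\<close>

lemma regular_mod_radical:
  assumes J: "radical_ideal J" and s: "s \<in> carrier R" and avoid: "\<And>P. P \<in> Ass R J \<Longrightarrow> s \<notin> P"
  shows "colon J s = J"
proof
  have Ji: "ideal J R" using J by (simp add: radical_ideal_def)
  show "J \<subseteq> colon J s" using Ji s by (rule subset_colon)
  obtain Ps where Ps: "\<forall>P\<in>set Ps. primeideal P R \<and> J \<subseteq> P" "foldr (ideal_prod R) Ps (carrier R) \<subseteq> J"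
    using contains_prime_product[OF Ji] by blast
  show "colon J s \<subseteq> J"
  proof
    fix a assume "a \<in> colon J s"
    then have a: "a \<in> carrier R" "a \<otimes> s \<in> J" by (auto simp: mem_colon)
    have "a \<in> P" if P: "P \<in> set Ps" for P
    proof -
      obtain W where W: "W \<in> Ass R J" "W \<subseteq> P" using Ass_below_prime[OF Ji] Ps(1) P by blast
      have "a \<otimes> s \<in> W" using a Ass_superset[OF Ji W(1)] by blast
      then show ?thesis using primeD[OF Ass_prime[OF W(1)] _ a(1) s] avoid[OF W(1)] W(2) by blast
    qed
    then have "a [^] length Ps \<in> foldr (ideal_prod R) Ps (carrier R)"
    proof (induct Ps)
      case (Cons P Ps)
      then have "a \<otimes> a [^] length Ps \<in> P \<cdot> foldr (ideal_prod R) Ps (carrier R)"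
        by (intro ideal_prodI) auto
      moreover have "a \<otimes> a [^] length Ps = a [^] Suc (length Ps)" using a(1) by (simp add: m_comm)
      ultimately show ?case by simp
    qed simp
    then show "a \<in> J" using Ps(2) radical_idealD[OF J a(1)] by blast
  qed
qed

end

lemma (in char_p_ring) radical_is_radical_ideal:
  assumes J: "ideal J R"
  shows "radical_ideal (radical R J)"
  unfolding radical_ideal_def
proof (intro conjI ballI allI impI)
  show "ideal (radical R J) R"
  proof (rule ideal_criterion)
    show "radical R J \<subseteq> carrier R" by (auto simp: radical_def)
    show "\<zero> \<in> radical R J" using ideal_zeroD[OF J] by (auto simp: radical_def intro!: exI[of _ "1::nat"])
  next
    fix a b assume "a \<in> radical R J" "b \<in> radical R J"
    then obtain m n :: nat where a: "a \<in> carrier R" "a [^] m \<in> J" and b: "b \<in> carrier R" "b [^] n \<in> J"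
      by (auto simp: radical_def)
    \<comment> \<open>A power of p above both exponents lets additivity of the Frobenius replace a
      binomial expansion.\<close>
    let ?q = "p ^ (m + n)"
    have "m + n \<le> ?q" using p_prime prime_ge_2_nat[of p] self_le_ge2_pow by blast
    then have "a [^] ?q \<in> J" "b [^] ?q \<in> J"
      using pow_ideal_le[OF J a] pow_ideal_le[OF J b] by auto
    then have "(a \<oplus> b) [^] ?q \<in> J" using freshman_iterated[OF a(1) b(1)] ideal_addD[OF J] by simp
    moreover have "0 < ?q" using p_pos by simp
    ultimately show "a \<oplus> b \<in> radical R J" using a b unfolding radical_def by blast
  next
    fix a r assume "a \<in> radical R J" and r: "r \<in> carrier R"
    then obtain m :: nat where a: "a \<in> carrier R" "0 < m" "a [^] m \<in> J" by (auto simp: radical_def)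
    then have "(r \<otimes> a) [^] m \<in> J" using r ideal_lmultD[OF J a(3)] by (simp add: nat_pow_distrib)
    then show "r \<otimes> a \<in> radical R J" using a r unfolding radical_def by blast
  qed
  fix x and n :: nat assume x: "x \<in> carrier R" "x [^] n \<in> radical R J"
  then obtain m :: nat where m: "0 < m" "x [^] (n * m) \<in> J" by (auto simp: radical_def nat_pow_pow)
  then have "x [^] Suc (n * m) \<in> J" by (intro pow_ideal_le[OF J x(1) m(2)]) simp
  then show "x \<in> radical R J" using x(1) unfolding radical_def by blast
qed

context cring begin

lemma subset_radical: "ideal J R \<Longrightarrow> J \<subseteq> radical R J"
  using ideal_carrD by (force simp: radical_def nat_pow_eone intro!: exI[of _ "1::nat"])

lemma radical_subset_prime: "primeideal P R \<Longrightarrow> J \<subseteq> P \<Longrightarrow> radical R J \<subseteq> P"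
  using prime_powD by (auto simp: radical_def)

lemma radical_least: "radical_ideal K \<Longrightarrow> J \<subseteq> K \<Longrightarrow> radical R J \<subseteq> K"
  using radical_idealD by (auto simp: radical_def)

end

section \<open>Symbolic powers inside Frobenius powers\<close>

context regular_char_p begin

text \<open>An associated prime W of J inside P contains the radical of J, so minimality of P gives
  W = P. Passing to the radical thus imposes conditions at fewer primes, whence the inclusion of
  symbolic powers below.\<close>

lemma Ass_radical_subset:
  assumes J: "ideal J R"
  shows "Ass R (radical R J) \<subseteq> Ass R J"
proof
  fix P assume P: "P \<in> Ass R (radical R J)"
  note rad = radical_is_radical_ideal[OF J]
  have radi: "ideal (radical R J) R" using rad by (simp add: radical_ideal_def)
  have "J \<subseteq> P" using subset_radical[OF J] Ass_superset[OF radi P] by blast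
  then obtain W where W: "W \<in> Ass R J" "W \<subseteq> P" using Ass_below_prime[OF J Ass_prime[OF P]] by blast
  have "radical R J \<subseteq> W" using radical_subset_prime Ass_prime[OF W(1)] Ass_superset[OF J W(1)] .
  then show "P \<in> Ass R J" using Ass_minimal[OF rad P Ass_prime[OF W(1)]] W by blast
qed

lemma symbolic_power_le_radical:
  assumes J: "ideal J R"
  shows "symbolic_power R J n \<subseteq> symbolic_power R (radical R J) n"
proof -
  have "ideal (radical R J) R" using radical_is_radical_ideal[OF J] by (simp add: radical_ideal_def)
  then show ?thesis
    using Ass_radical_subset[OF J] ideal_power_mono[OF subset_radical[OF J], of n]
    unfolding subset_iff symbolic_power_iff[OF J] by (simp add: symbolic_power_iff) blast
qed

text \<open>At an associated prime \<open>P\<close> of the radical ideal \<open>J\<close>, the maximal ideal of the local ring has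
  \<open>dim_at P\<close> generators, so its \<open>n\<close>-th power lies in its \<open>q\<close>-th Frobenius power by the pigeonhole
  principle; flatness of the Frobenius passes from these local statements to \<open>J\<close>.\<close>

theorem symbolic_power_le_frobenius_power:
  assumes J: "radical_ideal J" and h: "\<And>P. P \<in> Ass R J \<Longrightarrow> dim_at P \<le> h" and n: "h * p ^ e < n"
  shows "symbolic_power R J n \<subseteq> frobenius_power R J (p ^ e)"
proof
  let ?q = "p ^ e"
  fix f assume f: "f \<in> symbolic_power R J n"
  have Ji: "ideal J R" using J by (simp add: radical_ideal_def)
  have F: "ideal (frobenius_power R J ?q) R" by (intro frobenius_ideal ideal_subset Ji)
  have fc: "f \<in> carrier R" using f symbolic_power_iff[OF Ji] by blast
  let ?W = "colon (frobenius_power R J ?q) f"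
  have W: "ideal ?W R" using F fc by (rule colon_ideal)
  have "\<not> ?W \<subseteq> P" if P: "P \<in> Ass R J" for P
  proof -
    have Pp: "primeideal P R" using P by (rule Ass_prime)
    note Pi = prime_ideal[OF Pp]
    interpret L: localization_at_prime R P using Pp by (rule localization)
    obtain y where "char_p_parameter_system L.A (L.ext P) L.local_dim y p"
      using local_parameters[OF Pp] by blast
    then interpret A: char_p_parameter_system L.A "L.ext P" L.local_dim y p .
    obtain x where x: "x \<in> carrier R" "x \<notin> P" "P = colon J x" using Ass_radicalE[OF J P] .
    obtain u where u: "u \<in> carrier R - P" "u \<otimes> f \<in> ideal_power R J n"
      using f symbolic_power_iff[OF Ji] P by blast
    have FP: "ideal (frobenius_power R P ?q) R" by (intro frobenius_ideal ideal_subset Pi)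
    have "u \<otimes> f \<in> ideal_power R P n" using u ideal_power_mono[OF Ass_superset[OF Ji P]] by blast
    then have "L.\<iota> (u \<otimes> f) \<in> ideal_power L.A (L.ext P) n" by (rule L.\<iota>_ideal_power[OF Pi])
    moreover have "L.local_dim * ?q + 1 \<le> n"
    proof -
      have "L.local_dim * ?q \<le> h * ?q" using h[OF P] by (rule mult_le_mono1)
      then show ?thesis using n by linarith
    qed
    then have "ideal_power L.A (L.ext P) n \<subseteq> ideal_power L.A (L.ext P) (L.local_dim * ?q + 1)"
      by (rule L.A.ideal_power_antimono[OF A.\<mm>_ideal])
    ultimately have "L.\<iota> (u \<otimes> f) \<in> frobenius_power L.A (L.ext P) ?q" using A.power_\<mm>_le_frobenius by blast
    then have "L.\<iota> (u \<otimes> f) \<in> L.ext (frobenius_power R P ?q)" using frobenius_ext[OF Pp Pi] by simp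
    then obtain v where v: "v \<in> L.S" "v \<otimes> (u \<otimes> f) \<in> frobenius_power R P ?q"
      using L.\<iota>_in_ext_iff[OF FP, of "u \<otimes> f"] u fc by auto
    \<comment> \<open>Since x P lies in J, x^q carries P^[q] into J^[q]; so v u x^q, which is
      outside P, multiplies f into J^[q].\<close>
    have "frobenius_power R P ?q \<subseteq> colon (frobenius_power R J ?q) (x [^] ?q)"
      using frobenius_colon_subset[OF Ji x(1)] x(3) by simp
    then have vuf: "v \<otimes> (u \<otimes> f) \<otimes> x [^] ?q \<in> frobenius_power R J ?q" using v by (auto simp: mem_colon)
    have c: "u \<in> carrier R" "v \<in> carrier R" "x [^] ?q \<in> carrier R" using u v x by auto
    have "(v \<otimes> u \<otimes> x [^] ?q) \<otimes> f = v \<otimes> (u \<otimes> f) \<otimes> x [^] ?q" using c fc by algebra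
    then have "v \<otimes> u \<otimes> x [^] ?q \<in> ?W" using vuf c by (simp add: mem_colon)
    moreover have "x [^] ?q \<in> L.S" using x prime_powD[OF Pp x(1)] by auto
    then have "v \<otimes> u \<otimes> x [^] ?q \<notin> P" using L.S_mult u v by blast
    ultimately show ?thesis by blast
  qed
  moreover have "P = Q" if "P \<in> Ass R J" "Q \<in> Ass R J" "P \<subseteq> Q" for P Q
    using Ass_minimal[OF J that(2) Ass_prime[OF that(1)] Ass_superset[OF Ji that(1)] that(3)] .
  \<comment> \<open>Prime avoidance replaces the multipliers at the separate associated primes by a
    single s.\<close>
  ultimately have "\<exists>s\<in>?W. \<forall>P\<in>Ass R J. s \<notin> P"
    by (intro prime_avoidance_antichain finite_Ass_radical J Ass_prime W)
  then obtain s where s: "s \<in> ?W" "\<forall>P\<in>Ass R J. s \<notin> P" by blast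
  have sc: "s \<in> carrier R" "s \<otimes> f \<in> frobenius_power R J ?q" using s by (auto simp: mem_colon)
  have "colon J s = J" using s sc by (intro regular_mod_radical[OF J]) auto
  then have reg: "colon (frobenius_power R J ?q) (s [^] ?q) = frobenius_power R J ?q"
    by (rule frobenius_regular_element[OF Ji sc(1)])
  \<comment> \<open>It is s^q that is known to be regular modulo J^[q], so s f is multiplied by
    s^(q-1).\<close>
  obtain k where k: "?q = Suc k" using p_pos by (metis gr0_implies_Suc zero_less_power)
  have "f \<otimes> s [^] ?q = s [^] k \<otimes> (s \<otimes> f)"
    unfolding k nat_pow_Suc using sc fc nat_pow_closed[OF sc(1), of k] by algebra
  then have "f \<in> colon (frobenius_power R J ?q) (s [^] ?q)"
    using sc fc ideal_lmultD[OF F sc(2)] by (simp add: mem_colon)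
  then show "f \<in> frobenius_power R J ?q" using reg by simp
qed

end

section \<open>The limits\<close>

lemma nu_le: "(\<And>r. \<not> F r \<subseteq> frobenius_power R J (p ^ e) \<Longrightarrow> enat r \<le> b) \<Longrightarrow> nu R p J F e \<le> b"
  unfolding nu_def by (rule Sup_least) blast

lemma nu_ge: "\<not> F r \<subseteq> frobenius_power R J (p ^ e) \<Longrightarrow> enat r \<le> nu R p J F e"
  unfolding nu_def by (rule Sup_upper) blast

lemma nu_mono:
  assumes "\<And>r. F r \<subseteq> F' r" "frobenius_power R J' (p ^ e) \<subseteq> frobenius_power R J (p ^ e)"
  shows "nu R p J F e \<le> nu R p J' F' e"
proof (rule nu_le)
  fix r assume "\<not> F r \<subseteq> frobenius_power R J (p ^ e)"
  then have "\<not> F' r \<subseteq> frobenius_power R J' (p ^ e)" using assms(1)[of r] assms(2) by blast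
  then show "enat r \<le> nu R p J' F' e" by (rule nu_ge)
qed

lemma has_C_unique: "has_C R p J F c \<Longrightarrow> has_C R p J F c' \<Longrightarrow> c = c'"
  unfolding has_C_def using LIMSEQ_unique by fastforce

lemma C_inv_eq: "has_C R p J F c \<Longrightarrow> C_inv R p J F = c"
  unfolding C_inv_def using has_C_unique by blast

lemma has_C_C_inv: "C_exists R p J F \<Longrightarrow> has_C R p J F (C_inv R p J F)"
  unfolding C_exists_def using C_inv_eq by metis

lemma C_inv_mono:
  assumes "C_exists R p J F" "C_exists R p J' F'" "0 < p" "\<And>e. nu R p J F e \<le> nu R p J' F' e"
  shows "C_inv R p J F \<le> C_inv R p J' F'"
proof -
  let ?a = "\<lambda>e. ereal_of_enat (nu R p J F e) / ereal (real (p ^ e))"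
  let ?b = "\<lambda>e. ereal_of_enat (nu R p J' F' e) / ereal (real (p ^ e))"
  have "?a e \<le> ?b e" for e
    using assms(3,4) by (intro ereal_divide_right_mono) auto
  moreover have "?a \<longlonglongrightarrow> ereal (C_inv R p J F)" "?b \<longlonglongrightarrow> ereal (C_inv R p J' F')"
    using has_C_C_inv[OF assms(1)] has_C_C_inv[OF assms(2)] by (simp_all only: has_C_def)
  ultimately have "ereal (C_inv R p J F) \<le> ereal (C_inv R p J' F')"
    using LIMSEQ_le by blast
  then show ?thesis by simp
qed

context regular_char_p begin

text \<open>Since ideals of a regular ring are Frobenius closed, \<open>\<nu>(p\<^sup>e) / p\<^sup>e\<close> is nondecreasing in \<open>e\<close>.\<close>

lemma C_exists_bounded:
  assumes J: "ideal J R" and F: "\<And>r. F r \<subseteq> carrier R"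
    and F_pow: "\<And>r f. f \<in> F r \<Longrightarrow> f [^] p \<in> F (r * p)"
    and bound: "\<And>e r. h * p ^ e < r \<Longrightarrow> F r \<subseteq> frobenius_power R J (p ^ e)"
  shows "C_exists R p J F \<and> C_inv R p J F \<le> real h"
proof -
  have nu_bound: "nu R p J F e \<le> enat (h * p ^ e)" for e
  proof (rule nu_le)
    show "enat r \<le> enat (h * p ^ e)" if "\<not> F r \<subseteq> frobenius_power R J (p ^ e)" for r
      using that bound[of e r] by (cases "h * p ^ e < r") auto
  qed
  define n where "n e = the_enat (nu R p J F e)" for e
  have n: "nu R p J F e = enat (n e)" for e
    using nu_bound[of e] unfolding n_def by (cases "nu R p J F e") auto
  define a where "a e = real (n e) / real (p ^ e)" for e
  have p: "0 < real p" using p_pos by simp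
  \<comment> \<open>The value 0 is treated apart: it is also the supremum of the empty set, for
    which no failing index exists.\<close>
  have step: "n e * p \<le> n (Suc e)" for e
  proof (cases "n e = 0")
    case False
    have "\<exists>r\<ge>n e. \<not> F r \<subseteq> frobenius_power R J (p ^ e)"
    proof (rule ccontr)
      assume "\<not> (\<exists>r\<ge>n e. \<not> F r \<subseteq> frobenius_power R J (p ^ e))"
      then have "r \<le> n e - 1" if "\<not> F r \<subseteq> frobenius_power R J (p ^ e)" for r
        using that by (cases "n e \<le> r") auto
      then have "nu R p J F e \<le> enat (n e - 1)" by (intro nu_le) auto
      then show False using n[of e] False by simp
    qed
    then obtain r f where r: "n e \<le> r" and f: "f \<in> F r" "f \<notin> frobenius_power R J (p ^ e)" by blast
    have fc: "f \<in> carrier R" using f F by blast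
    \<comment> \<open>Frobenius closedness of J^[p^e] keeps f^p outside J^[p^(e+1)], so a failure at
      index r for e becomes one at index r p for e + 1.\<close>
    have "f [^] p \<notin> frobenius_power R (frobenius_power R J (p ^ e)) p"
      using frobenius_closed[OF frobenius_ideal[OF ideal_subset[OF J]] fc] f(2) by blast
    then have "f [^] p \<notin> frobenius_power R J (p ^ Suc e)"
      using frobenius_frobenius[OF J, of e 1] by simp
    then have "\<not> F (r * p) \<subseteq> frobenius_power R J (p ^ Suc e)" using F_pow[OF f(1)] by blast
    then have "enat (r * p) \<le> enat (n (Suc e))" unfolding n[symmetric] by (rule nu_ge)
    then show ?thesis using r by (meson enat_ord_simps(1) le_trans mult_le_mono1)
  qed simp
  have "a e \<le> a (Suc e)" for e
  proof -
    have "real (n e) * real p \<le> real (n (Suc e))"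
      using step[of e] by (metis of_nat_le_iff of_nat_mult)
    then show ?thesis using p by (simp add: a_def field_simps)
  qed
  then have "incseq a" by (rule incseq_SucI)
  moreover have a_le: "a e \<le> real h" for e
  proof -
    have "n e \<le> h * p ^ e" using nu_bound[of e] n[of e] by simp
    then have "real (n e) \<le> real h * real (p ^ e)" by (metis of_nat_le_iff of_nat_mult)
    then show ?thesis using p by (simp add: a_def divide_simps)
  qed
  ultimately obtain c where c: "a \<longlonglongrightarrow> c"
    using incseq_convergent by blast
  have "ereal_of_enat (nu R p J F e) / ereal (real (p ^ e)) = ereal (a e)" for e
    using p_pos by (simp add: n a_def)
  then have "has_C R p J F c" unfolding has_C_def using c by simp
  moreover have "c \<le> real h" using c a_le by (intro LIMSEQ_le_const2) auto
  ultimately show ?thesis using C_inv_eq unfolding C_exists_def by blast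
qed

end

lemma char_p_ringI:
  assumes "cring R" "Factorial_Ring.prime p" "ring_char R = p"
  shows "char_p_ring R p"
proof -
  interpret cring R by fact
  have "add_pow R p \<one>\<^bsub>R\<^esub> = \<zero>\<^bsub>R\<^esub>"
    unfolding add_pow_def assms(3)[symmetric] ring_char_def
    using group.pow_ord_eq_1[OF a_group, of "\<one>\<^bsub>R\<^esub>"] by simp
  then show ?thesis using assms by (intro char_p_ring.intro char_p_ring_axioms.intro)
qed

theorem proposition5p1:
  fixes R :: "('a, 'm) ring_scheme" and p :: nat and I \<aa> :: "'a set"
  assumes "regular_ring R"
    and "Factorial_Ring.prime p" and "ring_char R = p"
    and "ideal I R" and "I \<noteq> {\<zero>\<^bsub>R\<^esub>}" and "I \<noteq> carrier R"
    and "ideal \<aa> R" and "\<aa> \<noteq> {\<zero>\<^bsub>R\<^esub>}" and "\<aa> \<noteq> carrier R"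
    and "\<aa> \<subseteq> radical R I"
  shows
    "(\<forall>P. primeideal P R \<and> I \<subseteq> P \<longrightarrow>
        C_exists R p P (symbolic_power R \<aa>) \<and>
        C_inv R p P (symbolic_power R \<aa>) \<le> C_inv R p (radical R I) (symbolic_power R \<aa>)) \<and>
     C_exists R p (radical R I) (symbolic_power R \<aa>) \<and>
     C_inv R p (radical R I) (symbolic_power R \<aa>)
       \<le> C_inv R p (radical R \<aa>) (symbolic_power R (radical R \<aa>)) \<and>
     C_exists R p (radical R \<aa>) (symbolic_power R (radical R \<aa>)) \<and>
     ereal (C_inv R p (radical R \<aa>) (symbolic_power R (radical R \<aa>)))
       \<le> ereal_of_enat (big_height R (radical R \<aa>)) \<and>
     C_exists R p (radical R I) (ideal_power R \<aa>) \<and>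
     ereal (C_inv R p (radical R I) (ideal_power R \<aa>))
       \<le> ereal_of_enat (big_height R (radical R \<aa>))"
proof -
  have "cring R" using assms(1) by (simp add: regular_ring_def)
  then interpret regular_char_p R p
    using assms(1-3) by (intro regular_char_p.intro regular_char_p_axioms.intro char_p_ringI)
  let ?J = "radical R \<aa>" and ?I = "radical R I"
  note J_rad = radical_is_radical_ideal[OF assms(7)] and I_rad = radical_is_radical_ideal[OF assms(4)]
  have J: "ideal ?J R" and Ii: "ideal ?I R" using J_rad I_rad by (auto simp: radical_ideal_def)
  have JI: "?J \<subseteq> ?I" using radical_least[OF I_rad assms(10)] .
  obtain P0 where P0: "primeideal P0 R" "\<aa> \<subseteq> P0" using prime_above[OF assms(7,9)] .
  have fin: "finite (Ass R ?J)" using finite_Ass_radical[OF J_rad] .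
  have ne: "Ass R ?J \<noteq> {}" using Ass_below_prime[OF J P0(1) radical_subset_prime[OF P0]] by blast
  \<comment> \<open>The bound is taken over local dimensions, which are natural numbers;
    \<open>dim_at_le_height\<close> compares it with the big height, an \<open>enat\<close>.\<close>
  define h where "h = Max (dim_at ` Ass R ?J)"
  have h: "dim_at P \<le> h" if "P \<in> Ass R ?J" for P
    using that fin by (simp add: h_def)
  have "h \<in> dim_at ` Ass R ?J" unfolding h_def using fin ne by (intro Max_in) auto
  then obtain P1 where P1: "P1 \<in> Ass R ?J" "h = dim_at P1" by blast
  have "enat h \<le> height R P1" unfolding P1(2) by (rule dim_at_le_height[OF Ass_prime[OF P1(1)]])
  also have "\<dots> \<le> big_height R ?J" unfolding big_height_def using fin P1(1) by (intro Max_ge) auto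
  finally have h_le: "ereal (real h) \<le> ereal_of_enat (big_height R ?J)"
    by (metis ereal_of_enat_le_iff ereal_of_enat_simps(1))
  have sym_carr: "symbolic_power R K r \<subseteq> carrier R" for K r by (auto simp: symbolic_power_def)
  \<comment> \<open>One bound serves all the invariants, because both the radical of I and the
    primes over I contain the radical of \<aa>, and Frobenius powers are monotone.\<close>
  have contain: "symbolic_power R ?J r \<subseteq> frobenius_power R K (p ^ e)"
    if "h * p ^ e < r" "?J \<subseteq> K" "ideal K R" for e r K
    using symbolic_power_le_frobenius_power[OF J_rad h that(1)] frobenius_mono[OF that(2) ideal_subset[OF that(3)]] by blast
  have sym: "C_exists R p K (symbolic_power R \<aa>) \<and> C_inv R p K (symbolic_power R \<aa>) \<le> real h"
    if "ideal K R" "?J \<subseteq> K" for K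
    using contain[OF _ that(2,1)] symbolic_power_le_radical[OF assms(7)]
    by (intro C_exists_bounded that sym_carr symbolic_power_pow assms(7)) blast+
  have symJ: "C_exists R p ?J (symbolic_power R ?J) \<and> C_inv R p ?J (symbolic_power R ?J) \<le> real h"
    by (intro C_exists_bounded J sym_carr symbolic_power_pow contain subset_refl)
  have ord: "C_exists R p ?I (ideal_power R \<aa>) \<and> C_inv R p ?I (ideal_power R \<aa>) \<le> real h"
    using contain[OF _ JI Ii] symbolic_power_le_radical[OF assms(7)] ideal_power_le_symbolic[OF assms(7)]
    by (intro C_exists_bounded Ii ideal_power_pow ideal_subset ideal_power_ideal assms(7)) blast+
  have "C_exists R p P (symbolic_power R \<aa>) \<and> C_inv R p P (symbolic_power R \<aa>) \<le> C_inv R p ?I (symbolic_power R \<aa>)"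
    if P: "primeideal P R" "I \<subseteq> P" for P
  proof -
    have IP: "?I \<subseteq> P" using P by (rule radical_subset_prime)
    have Pi: "ideal P R" using P(1) by (rule prime_ideal)
    have "?J \<subseteq> P" using JI IP by blast
    then have 1: "C_exists R p P (symbolic_power R \<aa>)" using sym Pi by blast
    have "nu R p P (symbolic_power R \<aa>) e \<le> nu R p ?I (symbolic_power R \<aa>) e" for e
      by (intro nu_mono frobenius_mono IP ideal_subset Pi subset_refl)
    then show ?thesis using 1 sym[OF Ii JI] C_inv_mono p_pos by blast
  qed
  moreover have "C_inv R p ?I (symbolic_power R \<aa>) \<le> C_inv R p ?J (symbolic_power R ?J)"
  proof (rule C_inv_mono[OF conjunct1[OF sym[OF Ii JI]] conjunct1[OF symJ] p_pos])
    show "nu R p ?I (symbolic_power R \<aa>) e \<le> nu R p ?J (symbolic_power R ?J) e" for e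
      by (intro nu_mono frobenius_mono JI ideal_subset Ii symbolic_power_le_radical assms(7))
  qed
  moreover have "ereal c \<le> ereal_of_enat (big_height R ?J)" if "c \<le> real h" for c
    using that h_le by (meson ereal_less_eq(3) order_trans)
  ultimately show ?thesis using sym[OF Ii JI] symJ ord by blast
qed

end
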